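(* Let $A=A^T\in\mathbb C^{n\times n}$, $B=B^*\in\mathbb C^{n\times n}$, $h\in\mathbb C^n$, and $$\widehat H=\tfrac{i}{2}\bigl((a^\dagger,Aa^\dagger)-(a,\overline A a)\bigr)+(a^\dagger,Ba)+i(a^\dagger,h)-i(a,\overline h).$$ Let $\Phi_t,\Psi_t,h_t$ be defined as in the context, and set $\overline\rho_t=\overline\Psi_t\Phi_t^{-1}$ and $f_t=h_t-\rho_t\overline h_t$, so $\overline f_t=\overline h_t-\overline\rho_th_t$. Then the function $s_t$ determined by $e^{s_t}=\langle0|e^{i\widehat Ht}|0\rangle$ (continuous in $t$, $s_0=0$) is $$s_t=-\int_0^t\Bigl((\overline f_\tau,h)+\tfrac12(\overline f_\tau,A\overline f_\tau)+\tfrac12\operatorname{tr}(\overline\rho_\tau A)\Bigr)d\tau .$$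
   Context: $a=(a_1,\dots,a_n)$, $a^\dagger=(a_1^\dagger,\dots,a_n^\dagger)$ are the annihilation and creation operators on $\mathcal H=\otimes_1^n\ell_2$ (the $n$-mode boson Fock space), $[a_i,a_j^\dagger]=\delta_{ij}$, with vacuum $|0\rangle$. $(u,v)=\sum_iu_iv_i$ is the bilinear (not sesquilinear) form, also used for tuples of operators, e.g. $(a^\dagger,Ma)=\sum_{ij}M_{ij}a_i^\dagger a_j$; $\langle\cdot|\cdot\rangle$ is the sesquilinear inner product of $\mathcal H$. A bar is entrywise complex conjugation, $T$ is transpose, $*$ is Hermitian conjugation. $\widehat H$ denotes the self-adjoint closure of the given expression from the finite-particle vectors. Define $G=\begin{pmatrix}-iB&A\\ \overline A&i\overline B\end{pmatrix}$, and $n\times n$ blocks $\Phi_t,\Psi_t$ by $e^{Gt}=\begin{pmatrix}\Phi_t&\Psi_t\\ \overline\Psi_t&\overline\Phi_t\end{pmatrix}$; $\Phi_t$ is invertible for all $t\in\mathbb R$. The vector $h_t$ is defined by $\begin{pmatrix}h_t\\ \overline h_t\end{pmatrix}=\int_0^te^{G\tau}\begin{pmatrix}h\\ \overline h\end{pmatrix}d\tau$. The scalar $s_t$ is the exponent of the scalar factor in the normal ordered decomposition of $e^{i\widehat Ht}$, i.e. $e^{s_t}=\langle0|e^{i\widehat Ht}|0\rangle$, which never vanishes. *)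

theory Defs
  imports "HOL-Analysis.Analysis"
begin

section \<open>The Hilbert space of square-summable families\<close>

typedef 'a ell2 = "{f :: 'a \<Rightarrow> complex. (\<lambda>k. (cmod (f k))\<^sup>2) summable_on UNIV}"
  morphisms coeff_ell2 Abs_ell2
  by (rule exI[of _ "\<lambda>_. 0"]) simp

setup_lifting type_definition_ell2

lemma summable_ell2: "(\<lambda>k. (cmod (coeff_ell2 x k))\<^sup>2) summable_on UNIV"
  using coeff_ell2[of x] by simp

lemma ell2_eqI: "(\<And>k. coeff_ell2 x k = coeff_ell2 y k) \<Longrightarrow> x = y"
  by (metis coeff_ell2_inject ext)

lemma square_summable_add:
  fixes f g :: "'a \<Rightarrow> complex"
  assumes "(\<lambda>k. (cmod (f k))\<^sup>2) summable_on UNIV" "(\<lambda>k. (cmod (g k))\<^sup>2) summable_on UNIV"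
  shows "(\<lambda>k. (cmod (f k + g k))\<^sup>2) summable_on UNIV"
proof (rule summable_on_comparison_test)
  show "(\<lambda>k. 2 * ((cmod (f k))\<^sup>2 + (cmod (g k))\<^sup>2)) summable_on UNIV"
    by (intro summable_on_cmult_right summable_on_add assms)
next
  fix k
  have "(cmod (f k + g k))\<^sup>2 \<le> (cmod (f k) + cmod (g k))\<^sup>2"
    by (simp add: norm_triangle_ineq power_mono)
  also have "\<dots> \<le> 2 * ((cmod (f k))\<^sup>2 + (cmod (g k))\<^sup>2)"
    using sum_squares_bound[of "cmod (f k)" "cmod (g k)"] by (simp add: power2_sum)
  finally show "(cmod (f k + g k))\<^sup>2 \<le> 2 * ((cmod (f k))\<^sup>2 + (cmod (g k))\<^sup>2)" .
qed auto

lemma square_summable_mult: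
  fixes f :: "'a \<Rightarrow> complex"
  assumes "(\<lambda>k. (cmod (f k))\<^sup>2) summable_on UNIV"
  shows "(\<lambda>k. (cmod (c * f k))\<^sup>2) summable_on UNIV"
  using summable_on_cmult_right[OF assms, of "(cmod c)\<^sup>2"]
  by (simp add: norm_mult power_mult_distrib)

lift_definition scaleC_ell2 :: "complex \<Rightarrow> 'a ell2 \<Rightarrow> 'a ell2" is "\<lambda>c f k. c * f k"
  by (simp add: square_summable_mult)

instantiation ell2 :: (type) real_vector
begin

lift_definition zero_ell2 :: "'a ell2" is "\<lambda>_. 0" by simp
lift_definition plus_ell2 :: "'a ell2 \<Rightarrow> 'a ell2 \<Rightarrow> 'a ell2" is "\<lambda>f g k. f k + g k"
  by (simp add: square_summable_add)
lift_definition uminus_ell2 :: "'a ell2 \<Rightarrow> 'a ell2" is "\<lambda>f k. - f k" by simp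
lift_definition minus_ell2 :: "'a ell2 \<Rightarrow> 'a ell2 \<Rightarrow> 'a ell2" is "\<lambda>f g k. f k - g k"
proof -
  fix f g :: "'a \<Rightarrow> complex"
  assume "(\<lambda>k. (cmod (f k))\<^sup>2) summable_on UNIV"
    and "(\<lambda>k. (cmod (g k))\<^sup>2) summable_on UNIV"
  then show "(\<lambda>k. (cmod (f k - g k))\<^sup>2) summable_on UNIV"
    using square_summable_add[of f "\<lambda>k. - g k"] by simp
qed
lift_definition scaleR_ell2 :: "real \<Rightarrow> 'a ell2 \<Rightarrow> 'a ell2" is "\<lambda>r f k. complex_of_real r * f k"
  by (simp add: square_summable_mult)

instance
  by standard (transfer; simp add: fun_eq_iff algebra_simps)+

end

lemma summable_inner_ell2: "(\<lambda>k. coeff_ell2 x k \<bullet> coeff_ell2 y k) summable_on UNIV"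
proof (rule summable_on_iff_abs_summable_on_real[THEN iffD2], rule summable_on_comparison_test)
  show "(\<lambda>k. (cmod (coeff_ell2 x k))\<^sup>2 + (cmod (coeff_ell2 y k))\<^sup>2) summable_on UNIV"
    by (intro summable_on_add summable_ell2)
next
  fix k
  let ?a = "cmod (coeff_ell2 x k)" and ?b = "cmod (coeff_ell2 y k)"
  have "norm (coeff_ell2 x k \<bullet> coeff_ell2 y k) \<le> ?a * ?b"
    by (simp add: Cauchy_Schwarz_ineq2)
  also have "\<dots> \<le> ?a\<^sup>2 + ?b\<^sup>2"
  proof -
    have "0 \<le> ?a * ?b" by simp
    moreover have "2 * (?a * ?b) \<le> ?a\<^sup>2 + ?b\<^sup>2"
      using sum_squares_bound[of ?a ?b] by (simp add: mult.assoc)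
    ultimately show ?thesis by linarith
  qed
  finally show "norm (coeff_ell2 x k \<bullet> coeff_ell2 y k) \<le> ?a\<^sup>2 + ?b\<^sup>2" .
qed auto

lemma coeff_ell2_simps:
  "coeff_ell2 0 k = 0"
  "coeff_ell2 (x + y) k = coeff_ell2 x k + coeff_ell2 y k"
  "coeff_ell2 (x - y) k = coeff_ell2 x k - coeff_ell2 y k"
  "coeff_ell2 (- x) k = - coeff_ell2 x k"
  "coeff_ell2 (r *\<^sub>R x) k = r *\<^sub>R coeff_ell2 x k"
  "coeff_ell2 (scaleC_ell2 c x) k = c * coeff_ell2 x k"
  by (transfer; simp add: scaleR_conv_of_real)+

instantiation ell2 :: (type) real_inner
begin

definition inner_ell2 :: "'a ell2 \<Rightarrow> 'a ell2 \<Rightarrow> real" where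
  "x \<bullet> y = (\<Sum>\<^sub>\<infinity>k. coeff_ell2 x k \<bullet> coeff_ell2 y k)"
definition norm_ell2 :: "'a ell2 \<Rightarrow> real" where
  "norm x = sqrt (x \<bullet> x)" for x :: "'a ell2"
definition sgn_ell2 :: "'a ell2 \<Rightarrow> 'a ell2" where
  "sgn x = inverse (norm x) *\<^sub>R x" for x :: "'a ell2"
definition dist_ell2 :: "'a ell2 \<Rightarrow> 'a ell2 \<Rightarrow> real" where
  "dist x y = norm (x - y)" for x y :: "'a ell2"
definition uniformity_ell2 :: "('a ell2 \<times> 'a ell2) filter" where
  "uniformity_ell2 = (INF e\<in>{0 <..}. principal {(x, y). dist x y < e})"
definition open_ell2 :: "'a ell2 set \<Rightarrow> bool" where
  "open_ell2 S = (\<forall>x\<in>S. \<forall>\<^sub>F (x', y) in uniformity. x' = x \<longrightarrow> y \<in> S)"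

instance
proof
  fix x y z :: "'a ell2" and r :: real
  show "x \<bullet> y = y \<bullet> x"
    by (simp add: inner_ell2_def inner_commute)
  show "(x + y) \<bullet> z = x \<bullet> z + y \<bullet> z"
    by (simp add: inner_ell2_def coeff_ell2_simps inner_add_left infsum_add summable_inner_ell2)
  show "(r *\<^sub>R x) \<bullet> y = r * (x \<bullet> y)"
    by (simp add: inner_ell2_def coeff_ell2_simps infsum_cmult_right' del: scaleR_complex.simps)
  show "0 \<le> x \<bullet> x"
    by (simp add: inner_ell2_def infsum_nonneg)
  show "x \<bullet> x = 0 \<longleftrightarrow> x = 0"
  proof
    assume "x \<bullet> x = 0"
    then have "coeff_ell2 x k \<bullet> coeff_ell2 x k = 0" for k
      using nonneg_infsum_le_0D[of "\<lambda>k. coeff_ell2 x k \<bullet> coeff_ell2 x k" UNIV k]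
      by (simp add: inner_ell2_def summable_inner_ell2)
    then show "x = 0"
      by (intro ell2_eqI) (simp add: coeff_ell2_simps)
  qed (simp add: inner_ell2_def coeff_ell2_simps)
qed (simp_all add: norm_ell2_def sgn_ell2_def dist_ell2_def uniformity_ell2_def open_ell2_def)

end

text \<open>The complex inner product, conjugate-linear in the first argument. Its real part is the
  real inner product of the class instance.\<close>

definition cinner_ell2 :: "'a ell2 \<Rightarrow> 'a ell2 \<Rightarrow> complex" where
  "cinner_ell2 x y = (\<Sum>\<^sub>\<infinity>k. cnj (coeff_ell2 x k) * coeff_ell2 y k)"


section \<open>Unitary groups and their generators\<close>

text \<open>An unbounded operator is represented by its graph, so that the closure of an operator is the
  topological closure of its graph.\<close>

definition unitary_group :: "(real \<Rightarrow> 'a ell2 \<Rightarrow> 'a ell2) \<Rightarrow> bool" where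
  "unitary_group U \<longleftrightarrow>
     (\<forall>t x y. U t (x + y) = U t x + U t y) \<and>
     (\<forall>t c x. U t (scaleC_ell2 c x) = scaleC_ell2 c (U t x)) \<and>
     (\<forall>t x y. cinner_ell2 (U t x) (U t y) = cinner_ell2 x y) \<and>
     U 0 = id \<and>
     (\<forall>s t. U (s + t) = U s \<circ> U t) \<and>
     (\<forall>x. continuous_on UNIV (\<lambda>t. U t x))"

text \<open>The operator \<open>K\<close> with \<open>U t = exp (i K t)\<close> in the sense of Stone's theorem: \<open>x\<close> is in its
  domain iff \<open>U t x\<close> is differentiable at \<open>t = 0\<close>, with derivative \<open>i K x\<close>.\<close>

definition stone_generator :: "(real \<Rightarrow> 'a ell2 \<Rightarrow> 'a ell2) \<Rightarrow> ('a ell2 \<times> 'a ell2) set" where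
  "stone_generator U =
     {(x, y). ((\<lambda>t. U t x) has_vector_derivative scaleC_ell2 \<i> y) (at 0)}"

text \<open>\<open>exp_i K t\<close> is \<open>exp (i K t)\<close> for self-adjoint \<open>K\<close>; by Stone's theorem the group exists iff
  \<open>K\<close> is self-adjoint, and it is then unique.\<close>

definition exp_i :: "('a ell2 \<times> 'a ell2) set \<Rightarrow> real \<Rightarrow> 'a ell2 \<Rightarrow> 'a ell2" where
  "exp_i K = (THE U. unitary_group U \<and> stone_generator U = K)"


section \<open>The Fock space of \<open>n\<close> modes\<close>

text \<open>The \<open>n\<close>-fold tensor power of \<open>\<ell>\<^sub>2\<close> is realised in the occupation number basis, which is
  indexed by the multi-indices \<open>'n \<Rightarrow> nat\<close>. The formulas for the annihilation and creation
  operators make sense on arbitrary coefficient families; as Hilbert space operators they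
  are used on the finite-particle vectors only.\<close>

type_synonym 'n fock = "('n \<Rightarrow> nat) ell2"

definition annihil :: "'n \<Rightarrow> (('n \<Rightarrow> nat) \<Rightarrow> complex) \<Rightarrow> ('n \<Rightarrow> nat) \<Rightarrow> complex" where
  "annihil i \<psi> k = complex_of_real (sqrt (real (k i + 1))) * \<psi> (k(i := k i + 1))"

definition creat :: "'n \<Rightarrow> (('n \<Rightarrow> nat) \<Rightarrow> complex) \<Rightarrow> ('n \<Rightarrow> nat) \<Rightarrow> complex" where
  "creat i \<psi> k = complex_of_real (sqrt (real (k i))) * \<psi> (k(i := k i - 1))"

lemma canonical_commutation:
  "annihil i (creat j \<psi>) k - creat j (annihil i \<psi>) k = (if i = j then \<psi> k else 0)"
proof (cases "i = j")
  case True
  have sq: "complex_of_real (sqrt (real m)) * (complex_of_real (sqrt (real m)) * z) = of_nat m * z"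
    for m :: nat and z
    by (simp add: mult.assoc[symmetric] of_real_mult[symmetric] del: of_real_mult)
  have "annihil i (creat i \<psi>) k = of_nat (k i + 1) * \<psi> k"
    using sq[of "k i + 1"] by (simp add: annihil_def creat_def)
  moreover have "creat i (annihil i \<psi>) k = of_nat (k i) * \<psi> k"
    using sq[of "k i"] by (cases "k i") (simp_all add: annihil_def creat_def fun_upd_idem)
  ultimately show ?thesis
    using True by (simp add: algebra_simps)
next
  case False
  then have "k(i := k i + 1, j := k j - 1) = k(j := k j - 1, i := k i + 1)"
    by (simp add: fun_upd_twist)
  with False show ?thesis
    by (simp add: annihil_def creat_def)
qed

lift_definition vacuum :: "'n fock" is "\<lambda>k. if k = (\<lambda>_. 0) then 1 else 0"
proof -
  have "(\<lambda>k :: 'n \<Rightarrow> nat. (cmod (if k = (\<lambda>_. 0) then 1 else 0))\<^sup>2) summable_on {\<lambda>_. 0}"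
    by simp
  then show "(\<lambda>k :: 'n \<Rightarrow> nat. (cmod (if k = (\<lambda>_. 0) then 1 else 0))\<^sup>2) summable_on UNIV"
    by (rule summable_on_cong_neutral[THEN iffD1, rotated -1]) auto
qed

definition finite_particle :: "'n fock set" where
  "finite_particle = {x. finite {k. coeff_ell2 x k \<noteq> 0}}"

definition quadratic_expr ::
  "complex^'n^'n \<Rightarrow> complex^'n^'n \<Rightarrow> complex^'n \<Rightarrow>
     (('n::finite \<Rightarrow> nat) \<Rightarrow> complex) \<Rightarrow> ('n \<Rightarrow> nat) \<Rightarrow> complex" where
  "quadratic_expr A B h \<psi> k =
     \<i> / 2 * ((\<Sum>i\<in>UNIV. \<Sum>j\<in>UNIV. A $ i $ j * creat i (creat j \<psi>) k)
            - (\<Sum>i\<in>UNIV. \<Sum>j\<in>UNIV. cnj (A $ i $ j) * annihil i (annihil j \<psi>) k))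
     + (\<Sum>i\<in>UNIV. \<Sum>j\<in>UNIV. B $ i $ j * creat i (annihil j \<psi>) k)
     + \<i> * (\<Sum>i\<in>UNIV. h $ i * creat i \<psi> k)
     - \<i> * (\<Sum>i\<in>UNIV. cnj (h $ i) * annihil i \<psi> k)"

definition hamiltonian ::
  "complex^'n^'n \<Rightarrow> complex^'n^'n \<Rightarrow> complex^'n \<Rightarrow> ('n::finite fock \<times> 'n fock) set" where
  "hamiltonian A B h =
     closure {(x, y). x \<in> finite_particle \<and> coeff_ell2 y = quadratic_expr A B h (coeff_ell2 x)}"


section \<open>The classical flow\<close>

definition cnjv :: "complex^'n \<Rightarrow> complex^'n" where
  "cnjv v = (\<chi> i. cnj (v $ i))"

definition bilin :: "complex^'n \<Rightarrow> complex^'n \<Rightarrow> complex" where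
  "bilin u v = (\<Sum>i\<in>UNIV. u $ i * v $ i)"

definition matrix_exp :: "complex^'m^'m \<Rightarrow> complex^'m^'m" where
  "matrix_exp M = (\<Sum>k. (1 / fact k) *\<^sub>R (((\<lambda>X. M ** X) ^^ k) (mat 1)))"

definition G_mat :: "complex^'n^'n \<Rightarrow> complex^'n^'n \<Rightarrow> complex^('n + 'n)^('n + 'n)" where
  "G_mat A B = (\<chi> p q. case (p, q) of
       (Inl i, Inl j) \<Rightarrow> - \<i> * B $ i $ j
     | (Inl i, Inr j) \<Rightarrow> A $ i $ j
     | (Inr i, Inl j) \<Rightarrow> cnj (A $ i $ j)
     | (Inr i, Inr j) \<Rightarrow> \<i> * cnj (B $ i $ j))"

definition flow :: "complex^'n^'n \<Rightarrow> complex^'n^'n \<Rightarrow> real \<Rightarrow> complex^('n + 'n)^('n + 'n)" where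
  "flow A B t = matrix_exp (t *\<^sub>R G_mat A B)"

text \<open>The lower blocks of the flow are the conjugates of the upper ones, and likewise for the
  lower half of the integral in \<open>h_vec\<close>; so the upper parts are used as definitions.\<close>

definition Phi :: "complex^'n^'n \<Rightarrow> complex^'n^'n \<Rightarrow> real \<Rightarrow> complex^'n^'n" where
  "Phi A B t = (\<chi> i j. flow A B t $ Inl i $ Inl j)"

definition Psi :: "complex^'n^'n \<Rightarrow> complex^'n^'n \<Rightarrow> real \<Rightarrow> complex^'n^'n" where
  "Psi A B t = (\<chi> i j. flow A B t $ Inl i $ Inr j)"

definition doubled :: "complex^'n \<Rightarrow> complex^('n + 'n)" where
  "doubled h = (\<chi> p. case p of Inl i \<Rightarrow> h $ i | Inr i \<Rightarrow> cnj (h $ i))"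

text \<open>The interval integral is oriented, so that negative times are covered.\<close>

definition h_vec :: "complex^'n^'n \<Rightarrow> complex^'n^'n \<Rightarrow> complex^'n \<Rightarrow> real \<Rightarrow> complex^'n" where
  "h_vec A B h t = (\<chi> i. (LBINT \<tau>=0..t. flow A B \<tau> *v doubled h) $ Inl i)"

definition rho_bar :: "complex^'n^'n \<Rightarrow> complex^'n^'n \<Rightarrow> real \<Rightarrow> complex^'n^'n" where
  "rho_bar A B t = map_matrix cnj (Psi A B t) ** matrix_inv (Phi A B t)"

definition rho :: "complex^'n^'n \<Rightarrow> complex^'n^'n \<Rightarrow> real \<Rightarrow> complex^'n^'n" where
  "rho A B t = map_matrix cnj (rho_bar A B t)"

definition f_vec :: "complex^'n^'n \<Rightarrow> complex^'n^'n \<Rightarrow> complex^'n \<Rightarrow> real \<Rightarrow> complex^'n" where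
  "f_vec A B h t = h_vec A B h t - rho A B t *v cnjv (h_vec A B h t)"

end

(*
  The quadratic expression X = i H raises the particle number by at most 2 and has norm O(N) on
  N-particle vectors, so exp (t X) converges on finite-particle vectors for |t| below a radius that
  does not depend on the vector. As X is skew, this yields (Nelson) a global isometry group whose
  generator is the closure of X, and a group is determined by its densely defined generator: this
  identifies exp_i.

  Put L t psi = <0| exp (i H t) psi>, so that L' psi = L (X psi) on finite-particle psi. The commutator
  of X with the ladder operators (a, b), b = adjoint of a, is G (a, b) + (h, cnj h), hence the functionals
  psi |-> sum_q (exp (- G t))_(p q) (L t (a_q psi) - (h_t)_q L t psi) also satisfy M' psi = M (X psi).
  For creation operators p they vanish at t = 0, and by Taylor's formula with the growth bound for X
  they vanish for all t. Solving these equations for the creation operators gives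
  <0| exp (i H t) b = cnj rho_t <0| exp (i H t) a + cnj f_t <0| exp (i H t).
  Applied to the vacuum and to one-particle vectors this expresses L' |0> = L (X |0>) as a multiple of
  L |0>, a scalar linear differential equation whose solution is the exponential in the theorem.
*)

theory Submission
  imports Defs
begin

section \<open>Completeness of the sequence space\<close>

text \<open>The obstacle throughout is the domain. The exponential series of a finite-particle
  vector leaves the finite-particle space, so neither the operator nor another series can be applied
  to its value. Identities are therefore proved for partial sums or inside inner products, and
  composition in time starts only after the short-time isometries have been extended by density. For
  the same reason the vacuum functional applies all ladder operators to \<open>\<psi>\<close> before
  the evolution and never after it. That the generator is the closure, and not a proper extension of
  it, comes from time averages: an orbit averaged over a short interval always lies in the domain of
  the closure. The relation M' psi = M (X psi) is an infinite coupled system with an unbounded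
  coefficient, so no Gronwall argument applies. Uniqueness rests instead on the powers of X growing
  no faster than a factorial times a geometric sequence. Solving for the creation operators needs
  \<open>Phi\<close> to be invertible, which follows from an indefinite Hermitian form preserved by
  the flow. The amplitude is never divided by; that it does not vanish comes out of the final
  formula.\<close>

lemma norm_ell2_power2: "(norm x)\<^sup>2 = (\<Sum>\<^sub>\<infinity>k. (cmod (coeff_ell2 x k))\<^sup>2)"
  by (simp add: power2_norm_eq_inner inner_ell2_def)

lemma sum_coeff_le_norm_ell2:
  assumes "finite F"
  shows "(\<Sum>k\<in>F. (cmod (coeff_ell2 x k))\<^sup>2) \<le> (norm x)\<^sup>2"
  unfolding norm_ell2_power2
  by (rule finite_sum_le_infsum) (use assms summable_ell2[of x] in auto)

lemma cmod_coeff_le_norm_ell2: "cmod (coeff_ell2 x k) \<le> norm x"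
proof -
  have "(cmod (coeff_ell2 x k))\<^sup>2 \<le> (norm x)\<^sup>2"
    using sum_coeff_le_norm_ell2[of "{k}" x] by simp
  then show ?thesis
    by (rule power2_le_imp_le) simp
qed

lemma norm_ell2_leI:
  assumes "\<And>F. finite F \<Longrightarrow> (\<Sum>k\<in>F. (cmod (coeff_ell2 x k))\<^sup>2) \<le> b\<^sup>2" "b \<ge> 0"
  shows "norm x \<le> b"
proof -
  have "(\<Sum>\<^sub>\<infinity>k. (cmod (coeff_ell2 x k))\<^sup>2) \<le> b\<^sup>2"
    by (rule infsum_le_finite_sums[OF summable_ell2]) (use assms in auto)
  then show ?thesis
    using assms(2) by (metis norm_ell2_power2 power2_le_imp_le)
qed

text \<open>The limit is taken coefficientwise. A Cauchy bound on finite sums survives that limit,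
  uniformly in the finite set, and yields both square summability of the limit and convergence in
  norm. Completeness is what makes the exponential series converge and lets densely defined
  isometries extend.\<close>

instance ell2 :: (type) complete_space
proof
  fix X :: "nat \<Rightarrow> 'a ell2"
  assume X: "Cauchy X"
  have coeff_Cauchy: "Cauchy (\<lambda>n. coeff_ell2 (X n) k)" for k
  proof (rule metric_CauchyI)
    fix e :: real assume "e > 0"
    then obtain M where "\<forall>m\<ge>M. \<forall>n\<ge>M. dist (X m) (X n) < e"
      using X by (meson Cauchy_def)
    moreover have "dist (coeff_ell2 (X m) k) (coeff_ell2 (X n) k) \<le> dist (X m) (X n)" for m n
      using cmod_coeff_le_norm_ell2[of "X m - X n" k] by (simp add: dist_norm coeff_ell2_simps)
    ultimately show "\<exists>M. \<forall>m\<ge>M. \<forall>n\<ge>M. dist (coeff_ell2 (X m) k) (coeff_ell2 (X n) k) < e"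
      by (meson order.strict_trans1)
  qed
  define f where "f k = lim (\<lambda>n. coeff_ell2 (X n) k)" for k
  have f: "(\<lambda>n. coeff_ell2 (X n) k) \<longlonglongrightarrow> f k" for k
    using coeff_Cauchy[of k] Cauchy_convergent convergent_LIMSEQ_iff f_def by metis
  have bound: "(\<Sum>k\<in>F. (cmod (f k - coeff_ell2 (X n) k))\<^sup>2) \<le> e\<^sup>2"
    if "finite F" and near: "\<And>m. m \<ge> M \<Longrightarrow> norm (X m - X n) \<le> e" for F n M e
  proof (rule tendsto_upperbound)
    show "(\<lambda>m. \<Sum>k\<in>F. (cmod (coeff_ell2 (X m) k - coeff_ell2 (X n) k))\<^sup>2)
        \<longlonglongrightarrow> (\<Sum>k\<in>F. (cmod (f k - coeff_ell2 (X n) k))\<^sup>2)"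
      by (intro tendsto_intros f)
    have "(\<Sum>k\<in>F. (cmod (coeff_ell2 (X m) k - coeff_ell2 (X n) k))\<^sup>2) \<le> e\<^sup>2" if "m \<ge> M" for m
    proof -
      have "(\<Sum>k\<in>F. (cmod (coeff_ell2 (X m) k - coeff_ell2 (X n) k))\<^sup>2) \<le> (norm (X m - X n))\<^sup>2"
        using sum_coeff_le_norm_ell2[OF \<open>finite F\<close>, of "X m - X n"] by (simp add: coeff_ell2_simps)
      also have "\<dots> \<le> e\<^sup>2"
        using near[OF \<open>m \<ge> M\<close>] by (intro power_mono) auto
      finally show ?thesis .
    qed
    then show "\<forall>\<^sub>F m in sequentially. (\<Sum>k\<in>F. (cmod (coeff_ell2 (X m) k - coeff_ell2 (X n) k))\<^sup>2) \<le> e\<^sup>2"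
      using eventually_sequentially by blast
  qed simp
  have cau: "\<exists>M. \<forall>m\<ge>M. \<forall>n\<ge>M. norm (X m - X n) \<le> e" if "e > 0" for e
    using X that by (metis Cauchy_def dist_norm less_imp_le)
  have summable: "(\<lambda>k. (cmod (f k))\<^sup>2) summable_on UNIV"
  proof -
    obtain M where M: "\<forall>m\<ge>M. \<forall>n\<ge>M. norm (X m - X n) \<le> 1"
      using cau[of 1] by auto
    have "(\<lambda>k. (cmod (f k - coeff_ell2 (X M) k))\<^sup>2) summable_on UNIV"
      by (rule nonneg_bdd_above_summable_on)
        (use bound[of _ M M 1] M in \<open>auto intro!: bdd_aboveI[of _ 1]\<close>)
    then show ?thesis
      using square_summable_add[of "\<lambda>k. f k - coeff_ell2 (X M) k" "coeff_ell2 (X M)"]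
      by (simp add: summable_ell2)
  qed
  then have coeff_lim: "coeff_ell2 (Abs_ell2 f) = f"
    by (simp add: Abs_ell2_inverse)
  have "X \<longlonglongrightarrow> Abs_ell2 f"
  proof (rule metric_LIMSEQ_I)
    fix e :: real assume "e > 0"
    then obtain M where M: "\<forall>m\<ge>M. \<forall>n\<ge>M. norm (X m - X n) \<le> e / 2"
      using cau[of "e / 2"] by auto
    have "norm (Abs_ell2 f - X n) \<le> e / 2" if "n \<ge> M" for n
      by (rule norm_ell2_leI)
        (use bound[of _ M n "e / 2"] M that \<open>e > 0\<close> in \<open>auto simp: coeff_ell2_simps coeff_lim\<close>)
    then show "\<exists>M. \<forall>n\<ge>M. dist (X n) (Abs_ell2 f) < e"
      using \<open>e > 0\<close> by (intro exI[of _ M] allI impI)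
        (smt (verit) dist_norm norm_minus_commute field_sum_of_halves)
  qed
  then show "convergent X"
    by (auto simp: convergent_def)
qed

instance ell2 :: (type) banach ..

lemma scaleC_ell2_simps:
  "scaleC_ell2 c (x + y) = scaleC_ell2 c x + scaleC_ell2 c y"
  "scaleC_ell2 c (x - y) = scaleC_ell2 c x - scaleC_ell2 c y"
  "scaleC_ell2 c (r *\<^sub>R x) = r *\<^sub>R scaleC_ell2 c x"
  "scaleC_ell2 c (scaleC_ell2 d x) = scaleC_ell2 (c * d) x"
  "scaleC_ell2 1 x = x"
  "scaleC_ell2 0 x = 0"
  "scaleC_ell2 c 0 = 0"
  "scaleC_ell2 (- c) x = - scaleC_ell2 c x"
  "scaleC_ell2 c (- x) = - scaleC_ell2 c x"
  by (rule ell2_eqI; simp add: coeff_ell2_simps algebra_simps)+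

lemma inner_scaleC_ell2: "inner (scaleC_ell2 c x) y = inner x (scaleC_ell2 (cnj c) y)"
  unfolding inner_ell2_def
  by (rule infsum_cong) (simp add: coeff_ell2_simps inner_complex_def algebra_simps)

lemma norm_scaleC_ell2: "norm (scaleC_ell2 c x) = cmod c * norm x"
proof -
  have "scaleC_ell2 (of_real r) x = r *\<^sub>R x" for r
    by (rule ell2_eqI) (simp add: coeff_ell2_simps scaleR_conv_of_real)
  then have "inner (scaleC_ell2 c x) (scaleC_ell2 c x) = (cmod c)\<^sup>2 * inner x x"
    by (metis inner_scaleC_ell2 scaleC_ell2_simps(4) complex_norm_square mult.commute
        inner_scaleR_right)
  then show ?thesis
    by (simp add: norm_eq_sqrt_inner real_sqrt_mult)
qed

lemma bounded_linear_scaleC_ell2: "bounded_linear (scaleC_ell2 c)"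
  by (rule bounded_linear_intro[of _ "cmod c"])
    (simp_all add: scaleC_ell2_simps norm_scaleC_ell2 mult.commute)

text \<open>Real and imaginary part are both real inner products, so boundedness and invariance
  statements for \<open>inner\<close> carry over to \<open>cinner_ell2\<close>.\<close>

lemma cinner_ell2_eq_inner:
  "cinner_ell2 x y = Complex (inner x y) (inner (scaleC_ell2 \<i> x) y)"
proof -
  have "((\<lambda>k. of_real (coeff_ell2 x k \<bullet> coeff_ell2 y k)
       + \<i> * of_real (coeff_ell2 (scaleC_ell2 \<i> x) k \<bullet> coeff_ell2 y k)) has_sum
      (of_real (inner x y) + \<i> * of_real (inner (scaleC_ell2 \<i> x) y))) UNIV"
    unfolding inner_ell2_def
    by (intro has_sum_add has_sum_cmult_right has_sum_of_real has_sum_infsum summable_inner_ell2)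
  moreover have "of_real (coeff_ell2 x k \<bullet> coeff_ell2 y k)
       + \<i> * of_real (coeff_ell2 (scaleC_ell2 \<i> x) k \<bullet> coeff_ell2 y k)
      = cnj (coeff_ell2 x k) * coeff_ell2 y k" for k
    by (simp add: complex_eq_iff coeff_ell2_simps inner_complex_def)
  ultimately show ?thesis
    unfolding cinner_ell2_def by (simp add: complex_eq infsumI Complex_eq)
qed

lemma bounded_linear_cinner_ell2_right: "bounded_linear (cinner_ell2 x)"
proof -
  have "bounded_linear (\<lambda>y. of_real (inner x y) + \<i> * of_real (inner (scaleC_ell2 \<i> x) y))"
    by (intro bounded_linear_add bounded_linear_const_mult
        bounded_linear_compose[OF bounded_linear_of_real] bounded_linear_inner_right)
  then show ?thesis
    by (simp add: cinner_ell2_eq_inner[abs_def] Complex_eq)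
qed

lemma cinner_ell2_scaleC_right: "cinner_ell2 x (scaleC_ell2 c y) = c * cinner_ell2 x y"
  unfolding cinner_ell2_def
  by (simp add: coeff_ell2_simps mult.left_commute infsum_cmult_right')

lemma norm_cinner_ell2_le: "cmod (cinner_ell2 x y) \<le> norm x * norm y"
proof -
  \<comment> \<open>Scaling \<open>y\<close> by \<open>cnj c\<close> rotates the product onto the
    positive axis, where the real Cauchy-Schwarz inequality applies.\<close>
  define c where "c = cinner_ell2 x y"
  have "(cmod c)\<^sup>2 = Re (cinner_ell2 x (scaleC_ell2 (cnj c) y))"
    by (simp add: cinner_ell2_scaleC_right flip: c_def) (simp add: cmod_def power2_eq_square)
  also have "\<dots> = inner x (scaleC_ell2 (cnj c) y)"
    by (simp add: cinner_ell2_eq_inner)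
  also have "\<dots> \<le> norm x * (cmod c * norm y)"
    using norm_cauchy_schwarz[of x "scaleC_ell2 (cnj c) y"] by (simp add: norm_scaleC_ell2)
  finally have "cmod c * cmod c \<le> cmod c * (norm x * norm y)"
    by (simp add: power2_eq_square mult_ac)
  then show ?thesis
    by (cases "c = 0") (auto simp flip: c_def)
qed

section \<open>Groups of isometries and their generators\<close>

lemma dense_induct:
  assumes "closure D = UNIV" "closed {x. P x}" "\<And>x. x \<in> D \<Longrightarrow> P x"
  shows "P x"
proof -
  have "closure D \<subseteq> {x. P x}"
    using assms(2,3) by (intro closure_minimal) auto
  then show ?thesis
    using assms(1) by auto
qed

text \<open>The part of \<open>unitary_group\<close> that makes sense in a real inner product space.
  The construction of the exponential takes place at this level; complex linearity is added back at
  the end.\<close>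

definition isometry_group :: "(real \<Rightarrow> 'a::real_inner \<Rightarrow> 'a) \<Rightarrow> bool" where
  "isometry_group U \<longleftrightarrow>
     (\<forall>t. linear (U t)) \<and> (\<forall>t x. norm (U t x) = norm x) \<and> U 0 = id \<and>
     (\<forall>s t. U (s + t) = U s \<circ> U t) \<and> (\<forall>x. continuous_on UNIV (\<lambda>t. U t x))"

text \<open>The derivative itself, without the factor \<open>\<i>\<close> of
  \<open>stone_generator\<close>: for a unitary group with self-adjoint generator K this is the skew
  operator iK.\<close>

definition group_generator :: "(real \<Rightarrow> 'a::real_inner \<Rightarrow> 'a) \<Rightarrow> ('a \<times> 'a) set" where
  "group_generator U = {(x, z). ((\<lambda>t. U t x) has_vector_derivative z) (at 0)}"

lemma inner_isometry:
  assumes "linear f" "\<And>x. norm (f x) = norm x"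
  shows "inner (f x) (f y) = inner x y"
proof -
  have "(norm (f x + f y))\<^sup>2 = (norm (x + y))\<^sup>2"
    using assms by (metis linear_add)
  then have "inner (f x + f y) (f x + f y) = inner (x + y) (x + y)"
    by (simp add: power2_norm_eq_inner)
  moreover have "inner (f z) (f z) = inner z z" for z
    using assms(2)[of z] by (metis power2_norm_eq_inner)
  ultimately show ?thesis
    by (simp add: inner_add inner_commute)
qed

context
  fixes U :: "real \<Rightarrow> 'a::real_inner \<Rightarrow> 'a"
  assumes U: "isometry_group U"
begin

lemma bounded_linear_isometry_group: "bounded_linear (U t)"
  using U by (intro bounded_linear_intro[of _ 1])
    (auto simp: isometry_group_def linear_add linear_scale)

lemma inner_isometry_group: "inner (U t x) (U t y) = inner x y"
  using U by (intro inner_isometry) (auto simp: isometry_group_def)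

lemma group_generator_derivative:
  assumes "(x, z) \<in> group_generator U"
  shows "((\<lambda>t. U t x) has_vector_derivative U t z) (at t)"
proof -
  have "((\<lambda>s. U t (U s x)) has_vector_derivative U t z) (at 0)"
    using assms by (intro bounded_linear.has_vector_derivative[OF bounded_linear_isometry_group])
      (simp add: group_generator_def)
  then have "((\<lambda>s. U t (U s x)) has_vector_derivative U t z) (at (t - t))"
    by simp
  moreover have "((\<lambda>s. s - t) has_vector_derivative 1) (at t)"
    by (auto intro!: derivative_eq_intros)
  ultimately have "((\<lambda>s. U t (U s x)) \<circ> (\<lambda>s. s - t) has_vector_derivative 1 *\<^sub>R U t z) (at t)"
    by (rule vector_diff_chain_at[rotated])
  moreover have "U t (U (s - t) x) = U s x" for s
  proof -
    have "U (t + (s - t)) = U t \<circ> U (s - t)"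
      using U unfolding isometry_group_def by blast
    then show ?thesis
      by (simp add: fun_eq_iff)
  qed
  ultimately show ?thesis
    by (simp add: o_def)
qed

lemma group_generator_invariant:
  assumes "(x, z) \<in> group_generator U"
  shows "(U t x, U t z) \<in> group_generator U"
proof -
  have "((\<lambda>s. U t (U s x)) has_vector_derivative U t z) (at 0)"
    using assms by (intro bounded_linear.has_vector_derivative[OF bounded_linear_isometry_group])
      (simp add: group_generator_def)
  moreover have "U t (U s x) = U s (U t x)" for s
  proof -
    have "U t \<circ> U s = U s \<circ> U t"
      using U by (metis isometry_group_def add.commute)
    then show ?thesis
      by (simp add: fun_eq_iff)
  qed
  ultimately show ?thesis
    by (simp add: group_generator_def)
qed

text \<open>The inner product of two orbits is constant in time; its derivative at 0 is the sum of
  the two terms.\<close>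

lemma group_generator_skew:
  assumes "(x, z) \<in> group_generator U" "(y, w) \<in> group_generator U"
  shows "inner z y = - inner x w"
proof -
  have 1: "((\<lambda>t. inner (U t x) (U t y)) has_derivative (\<lambda>h. inner (U 0 x) (h *\<^sub>R w) + inner (h *\<^sub>R z) (U 0 y))) (at 0)"
    by (rule has_derivative_inner)
      (use assms in \<open>auto simp: group_generator_def has_vector_derivative_def\<close>)
  have "U 0 = id"
    using U by (simp add: isometry_group_def)
  with 1 have "((\<lambda>t. inner x y) has_derivative (\<lambda>h. h * (inner x w + inner z y))) (at 0)"
    by (simp add: inner_isometry_group algebra_simps)
  then have "(\<lambda>h. h * (inner x w + inner z y)) = (\<lambda>h. 0)"
    using has_derivative_const has_derivative_unique by blast
  then show ?thesis
    by (metis add.inverse_unique add.commute mult_1)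
qed

lemma closed_group_generator: "closed (group_generator U)"
  unfolding closed_sequential_limits
proof safe
  fix p x z
  assume p: "\<forall>n. p n \<in> group_generator U" "p \<longlonglongrightarrow> (x, z)"
  define X Z where "X n = fst (p n)" and "Z n = snd (p n)" for n
  have XZ: "(X n, Z n) \<in> group_generator U" for n
    using p(1) by (simp add: X_def Z_def)
  have lim: "X \<longlonglongrightarrow> x" "Z \<longlonglongrightarrow> z"
    using tendsto_fst[OF p(2)] tendsto_snd[OF p(2)] by (auto simp: X_def[abs_def] Z_def[abs_def])
  have U0: "U 0 = id" and isom: "norm (U t y) = norm y" for t y
    using U by (auto simp: isometry_group_def)
  have lin: "U t (y - y') = U t y - U t y'" for t y y'
    using bounded_linear_isometry_group[of t] by (simp add: bounded_linear.linear linear_diff)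
  \<comment> \<open>For \<open>X n\<close> this is the mean value inequality, with an error
    controlled by \<open>Z n - z\<close>. Letting n grow at fixed \<open>t\<close> removes that
    error, so no interchange of limits is needed when \<open>t\<close> tends to 0
    afterwards.\<close>
  have est: "norm (U t x - x - t *\<^sub>R z) \<le> e * \<bar>t\<bar>"
    if e: "e \<ge> 0" "\<And>s. \<bar>s\<bar> \<le> \<bar>t\<bar> \<Longrightarrow> norm (U s z - z) \<le> e" for t e
  proof -
    have "norm (U t (X n) - X n - t *\<^sub>R Z n) \<le> (e + 2 * norm (Z n - z)) * \<bar>t\<bar>" for n
    proof -
      have "norm (U t (X n) - U 0 (X n) - (t - 0) *\<^sub>R U 0 (Z n)) \<le> norm (t - 0) * (e + 2 * norm (Z n - z))"
      proof (rule vector_differentiable_bound_linearization[where S = "closed_segment 0 t"])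
        fix s assume s: "s \<in> closed_segment 0 t"
        show "((\<lambda>t. U t (X n)) has_vector_derivative U s (Z n)) (at s within closed_segment 0 t)"
          using group_generator_derivative[OF XZ] has_vector_derivative_at_within by blast
        have "U s (Z n) - U 0 (Z n) = U s (Z n - z) + (U s z - z) - (Z n - z)"
          by (simp add: lin U0)
        also have "norm \<dots> \<le> norm (U s (Z n - z)) + norm (U s z - z) + norm (Z n - z)"
          by (meson norm_triangle_ineq norm_triangle_ineq4 order_trans add_right_mono)
        also have "norm (U s z - z) \<le> e"
          using s by (intro e) (auto simp: closed_segment_eq_real_ivl split: if_splits)
        finally show "norm (U s (Z n) - U 0 (Z n)) \<le> e + 2 * norm (Z n - z)"
          by (simp add: isom)
      qed auto
      then show ?thesis
        by (simp add: U0 mult.commute)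
    qed
    moreover have "(\<lambda>n. norm (U t (X n) - X n - t *\<^sub>R Z n)) \<longlonglongrightarrow> norm (U t x - x - t *\<^sub>R z)"
      by (intro tendsto_intros lim bounded_linear.tendsto[OF bounded_linear_isometry_group])
    moreover have "(\<lambda>n. (e + 2 * norm (Z n - z)) * \<bar>t\<bar>) \<longlonglongrightarrow> (e + 2 * norm (z - z)) * \<bar>t\<bar>"
      by (intro tendsto_intros lim)
    ultimately show ?thesis
      using LIMSEQ_le by fastforce
  qed
  show "(x, z) \<in> group_generator U"
    unfolding group_generator_def has_vector_derivative_def has_derivative_at_alt mem_Collect_eq case_prod_conv
  proof (intro conjI allI impI)
    show "bounded_linear (\<lambda>h. h *\<^sub>R z)"
      by (rule bounded_linear_scaleR_left)
    fix e :: real assume "e > 0"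
    have "continuous (at 0) (\<lambda>t. U t z)"
      using U by (auto simp: isometry_group_def continuous_on_eq_continuous_at)
    then obtain d where d: "d > 0" "\<And>s. \<bar>s\<bar> < d \<Longrightarrow> norm (U s z - z) < e"
      using \<open>e > 0\<close> by (auto simp: continuous_at_eps_delta dist_norm U0)
    show "\<exists>d>0. \<forall>y. norm (y - 0) < d \<longrightarrow> norm (U y x - U 0 x - (y - 0) *\<^sub>R z) \<le> e * norm (y - 0)"
    proof (intro exI[of _ d] conjI allI impI)
      fix t :: real assume "norm (t - 0) < d"
      then have "norm (U t x - x - t *\<^sub>R z) \<le> e * \<bar>t\<bar>"
        using \<open>e > 0\<close> by (intro est) (auto intro!: less_imp_le[OF d(2)])
      then show "norm (U t x - U 0 x - (t - 0) *\<^sub>R z) \<le> e * norm (t - 0)"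
        by (simp add: U0)
    qed (rule d)
  qed
qed

end

text \<open>Both orbits of a vector in the common domain stay in that domain, so skewness makes the
  inner product of \<open>U t x\<close> and \<open>V t x\<close> constant. It equals the squared
  norm of \<open>x\<close>, which forces the orbits to coincide; density does the rest.\<close>

lemma isometry_group_unique:
  assumes U: "isometry_group U" and V: "isometry_group V"
    and gen: "group_generator U = group_generator V"
    and dense: "closure (fst ` group_generator U) = UNIV"
  shows "U = V"
proof (intro ext)
  fix t x
  have isom: "norm (U t y) = norm y" "norm (V t y) = norm y" "U 0 = id" "V 0 = id" for t y
    using U V by (auto simp: isometry_group_def)
  have *: "U t x = V t x" if "(x, z) \<in> group_generator U" for x z
  proof -
    have "((\<lambda>t. inner (U t x) (V t x)) has_vector_derivative 0) (at t)" for t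
    proof -
      have "(U t x, U t z) \<in> group_generator U" "(V t x, V t z) \<in> group_generator U"
        using that gen group_generator_invariant[OF U] group_generator_invariant[OF V] by auto
      then have skew: "inner (U t z) (V t x) = - inner (U t x) (V t z)"
        by (rule group_generator_skew[OF U])
      have "((\<lambda>t. inner (U t x) (V t x)) has_derivative
          (\<lambda>h. inner (U t x) (h *\<^sub>R V t z) + inner (h *\<^sub>R U t z) (V t x))) (at t)"
        using group_generator_derivative[OF U that]
          group_generator_derivative[OF V that[unfolded gen]]
        by (intro has_derivative_inner) (simp_all add: has_vector_derivative_def)
      then show ?thesis
        by (simp add: has_vector_derivative_def skew)
    qed
    then obtain c where "inner (U t x) (V t x) = c" for t
      using has_vector_derivative_zero_constant[of UNIV "\<lambda>t. inner (U t x) (V t x)"] by auto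
    then have "inner (U t x) (V t x) = inner x x"
      using isom by (metis id_apply)
    moreover have "inner (U t x) (U t x) = inner x x" "inner (V t x) (V t x) = inner x x"
      using isom by (metis power2_norm_eq_inner)+
    ultimately have "inner (U t x - V t x) (U t x - V t x) = 0"
      by (simp add: inner_diff inner_commute)
    then show ?thesis
      by simp
  qed
  show "U t x = V t x"
  proof (rule dense_induct[OF dense, where x = x])
    show "closed {x. U t x = V t x}"
      using linear_continuous_on[OF bounded_linear_isometry_group[OF U]]
        linear_continuous_on[OF bounded_linear_isometry_group[OF V]] by (rule closed_Collect_eq)
  qed (use * in auto)
qed

section \<open>Exponentials of skew operators with analytic vectors\<close>

lemma funpow_comp_commute:
  assumes "f \<circ> g = g \<circ> f"
  shows "(f \<circ> g) ^^ n = f ^^ n \<circ> g ^^ n"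
proof (induction n)
  case (Suc n)
  have "(f ^^ n) (g x) = g ((f ^^ n) x)" for n x
    using assms by (induction n) (simp_all add: fun_eq_iff)
  then show ?case
    using Suc by (simp add: fun_eq_iff)
qed simp

text \<open>The setting of Nelson's analytic vector theorem in a strong form: one radius
  \<open>r\<close> serves every vector of the invariant domain, so steps of a fixed length can be
  iterated.\<close>

locale analytic_skew_operator =
  fixes D :: "'a::{real_inner,banach} set" and X :: "'a \<Rightarrow> 'a" and r :: real
  assumes subspace: "subspace D"
    and dense: "closure D = UNIV"
    and maps: "x \<in> D \<Longrightarrow> X x \<in> D"
    and add: "x \<in> D \<Longrightarrow> y \<in> D \<Longrightarrow> X (x + y) = X x + X y"
    and scale: "x \<in> D \<Longrightarrow> X (c *\<^sub>R x) = c *\<^sub>R X x"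
    and skew: "x \<in> D \<Longrightarrow> y \<in> D \<Longrightarrow> inner (X x) y = - inner x (X y)"
    and radius_pos: "r > 0"
    and analytic: "x \<in> D \<Longrightarrow> summable (\<lambda>k. r ^ k / fact k * norm ((X ^^ k) x))"
begin

lemma power_maps: "x \<in> D \<Longrightarrow> (X ^^ k) x \<in> D"
  by (induction k) (auto intro: maps)

lemma power_add: "x \<in> D \<Longrightarrow> y \<in> D \<Longrightarrow> (X ^^ k) (x + y) = (X ^^ k) x + (X ^^ k) y"
  by (induction k) (auto simp: add power_maps)

lemma power_scale: "x \<in> D \<Longrightarrow> (X ^^ k) (c *\<^sub>R x) = c *\<^sub>R (X ^^ k) x"
  by (induction k) (auto simp: scale power_maps)

definition partial_exp :: "nat \<Rightarrow> real \<Rightarrow> 'a \<Rightarrow> 'a" where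
  "partial_exp n t x = (\<Sum>k<n. (t ^ k / fact k) *\<^sub>R (X ^^ k) x)"

definition exp_series :: "real \<Rightarrow> 'a \<Rightarrow> 'a" where
  "exp_series t x = (\<Sum>k. (t ^ k / fact k) *\<^sub>R (X ^^ k) x)"

lemma norm_term_le:
  assumes "\<bar>t\<bar> \<le> r"
  shows "norm ((t ^ k / fact k) *\<^sub>R (X ^^ k) x) \<le> r ^ k / fact k * norm ((X ^^ k) x)"
  using power_mono[OF assms, of k]
  by (simp add: power_abs mult_right_mono divide_right_mono)

lemma summable_exp_series:
  assumes "\<bar>t\<bar> \<le> r" "x \<in> D"
  shows "summable (\<lambda>k. (t ^ k / fact k) *\<^sub>R (X ^^ k) x)"
  by (rule summable_comparison_test'[OF analytic[OF assms(2)], of 0]) (rule norm_term_le[OF assms(1)])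

lemma partial_exp_LIMSEQ:
  assumes "\<bar>t\<bar> \<le> r" "x \<in> D"
  shows "(\<lambda>n. partial_exp n t x) \<longlonglongrightarrow> exp_series t x"
  unfolding partial_exp_def exp_series_def using summable_LIMSEQ[OF summable_exp_series[OF assms]] .

lemma partial_exp_maps:
  assumes "x \<in> D"
  shows "partial_exp n t x \<in> D"
  unfolding partial_exp_def
  by (intro subspace_sum[OF subspace] subspace_scale[OF subspace] power_maps assms)

text \<open>Partial sums stay in \<open>D\<close>, where \<open>X\<close> may be applied; their
  limits in general do not. Every statement about \<open>X\<close> and \<open>exp_series\<close>
  passes through this one.\<close>

lemma X_partial_exp:
  assumes "x \<in> D"
  shows "X (partial_exp n t x) = partial_exp n t (X x)"
proof (induction n)
  case 0
  have "X (0 *\<^sub>R 0) = 0 *\<^sub>R X 0"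
    by (rule scale) (rule subspace_0[OF subspace])
  then show ?case
    by (simp add: partial_exp_def)
next
  case (Suc n)
  have "X (partial_exp (Suc n) t x)
      = X (partial_exp n t x + (t ^ n / fact n) *\<^sub>R (X ^^ n) x)"
    by (simp add: partial_exp_def)
  also have "\<dots> = X (partial_exp n t x) + (t ^ n / fact n) *\<^sub>R X ((X ^^ n) x)"
    by (simp add: add scale partial_exp_maps power_maps assms subspace_scale[OF subspace])
  also have "\<dots> = partial_exp (Suc n) t (X x)"
    by (simp add: Suc) (simp add: partial_exp_def funpow_swap1)
  finally show ?case .
qed

lemma exp_series_skew:
  assumes "\<bar>s\<bar> \<le> r" "\<bar>t\<bar> \<le> r" "x \<in> D" "y \<in> D"
  shows "inner (exp_series s (X x)) (exp_series t y) = - inner (exp_series s x) (exp_series t (X y))"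
proof (rule LIMSEQ_unique)
  show "(\<lambda>n. inner (partial_exp n s (X x)) (partial_exp n t y))
      \<longlonglongrightarrow> inner (exp_series s (X x)) (exp_series t y)"
    by (intro tendsto_inner partial_exp_LIMSEQ assms maps)
  have "(\<lambda>n. - inner (partial_exp n s x) (partial_exp n t (X y)))
      \<longlonglongrightarrow> - inner (exp_series s x) (exp_series t (X y))"
    by (intro tendsto_minus tendsto_inner partial_exp_LIMSEQ assms maps)
  then show "(\<lambda>n. inner (partial_exp n s (X x)) (partial_exp n t y))
      \<longlonglongrightarrow> - inner (exp_series s x) (exp_series t (X y))"
    using assms by (simp add: skew partial_exp_maps flip: X_partial_exp)
qed

lemma exp_series_0: "exp_series 0 x = x"
proof -
  have "exp_series 0 x = (\<Sum>k\<in>{0::nat}. (0 ^ k / fact k) *\<^sub>R (X ^^ k) x)"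
    unfolding exp_series_def by (rule suminf_finite) auto
  then show ?thesis
    by simp
qed

lemma exp_series_add:
  assumes "\<bar>t\<bar> \<le> r" "x \<in> D" "y \<in> D"
  shows "exp_series t (x + y) = exp_series t x + exp_series t y"
  unfolding exp_series_def
  by (subst suminf_add[OF summable_exp_series[OF assms(1,2)] summable_exp_series[OF assms(1,3)]])
    (simp add: power_add assms scaleR_add_right)

lemma exp_series_scale:
  assumes "\<bar>t\<bar> \<le> r" "x \<in> D"
  shows "exp_series t (c *\<^sub>R x) = c *\<^sub>R exp_series t x"
  unfolding exp_series_def
  by (subst suminf_scaleR_right[OF summable_exp_series[OF assms]])
    (simp add: power_scale assms mult.commute)

lemma exp_series_has_vector_derivative:
  assumes "\<bar>t\<bar> < r" "x \<in> D"
  shows "((\<lambda>t. exp_series t x) has_vector_derivative exp_series t (X x)) (at t)"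
proof -
  define S where "S = {-r<..<r}"
  \<comment> \<open>The derivative of the term of index k + 1 is the term of index k for
    \<open>X x\<close>, and the constant term contributes 0. This shift by one is why the estimate
    below is proved for \<open>Suc n\<close> summands.\<close>
  define f' where "f' n t = (case n of 0 \<Rightarrow> 0 | Suc k \<Rightarrow> (t ^ k / fact k) *\<^sub>R (X ^^ k) (X x))" for n and t :: real
  have unif: "uniform_limit S (\<lambda>n t. \<Sum>k<n. (t ^ k / fact k) *\<^sub>R (X ^^ k) (X x))
      (\<lambda>t. exp_series t (X x)) sequentially"
    unfolding exp_series_def
    by (rule Weierstrass_m_test[OF norm_term_le analytic[OF maps[OF assms(2)]]]) (auto simp: S_def)
  have "\<exists>g. \<forall>t\<in>S. (\<lambda>n. (t ^ n / fact n) *\<^sub>R (X ^^ n) x) sums g t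
      \<and> (g has_derivative (\<lambda>h. h *\<^sub>R exp_series t (X x))) (at t within S)"
  proof (rule has_derivative_series)
    show "convex S"
      by (simp add: S_def)
    show "((\<lambda>t. (t ^ n / fact n) *\<^sub>R (X ^^ n) x) has_derivative (\<lambda>h. h *\<^sub>R f' n t)) (at t within S)" for n and t :: real
    proof (cases n)
      case (Suc k)
      have "((\<lambda>t. t ^ Suc k / fact (Suc k)) has_real_derivative t ^ k / fact k) (at t within S)"
        by (rule derivative_eq_intros refl | simp)+
      then have "((\<lambda>t. (t ^ Suc k / fact (Suc k)) *\<^sub>R (X ^^ Suc k) x) has_vector_derivative
          (t ^ k / fact k) *\<^sub>R (X ^^ Suc k) x) (at t within S)"
        by (rule has_vector_derivative_scaleR[OF _ has_vector_derivative_const, simplified])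
      then show ?thesis
        unfolding has_vector_derivative_def Suc f'_def by (simp only: nat.case funpow_Suc_right comp_def)
    qed (simp add: f'_def)
    fix e :: real assume "e > 0"
    have sum_f': "(\<Sum>i<Suc n. h *\<^sub>R f' i t) = h *\<^sub>R (\<Sum>k<n. (t ^ k / fact k) *\<^sub>R (X ^^ k) (X x))" for n t and h :: real
      by (simp add: sum.lessThan_Suc_shift f'_def scaleR_sum_right del: sum.lessThan_Suc)
    have "\<forall>\<^sub>F n in sequentially. \<forall>t\<in>S.
        norm ((\<Sum>k<n. (t ^ k / fact k) *\<^sub>R (X ^^ k) (X x)) - exp_series t (X x)) < e"
      using unif \<open>e > 0\<close> by (simp add: uniform_limit_iff dist_norm)
    then have "\<forall>\<^sub>F n in sequentially. \<forall>t\<in>S. \<forall>h.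
        norm ((\<Sum>i<Suc n. h *\<^sub>R f' i t) - h *\<^sub>R exp_series t (X x)) \<le> e * norm h"
    proof eventually_elim
      case (elim n)
      show ?case
      proof (intro ballI allI)
        fix t h :: real assume "t \<in> S"
        then have "norm h * norm ((\<Sum>k<n. (t ^ k / fact k) *\<^sub>R (X ^^ k) (X x)) - exp_series t (X x)) \<le> norm h * e"
          using elim by (intro mult_left_mono) (auto intro: less_imp_le)
        then show "norm ((\<Sum>i<Suc n. h *\<^sub>R f' i t) - h *\<^sub>R exp_series t (X x)) \<le> e * norm h"
          unfolding sum_f' scaleR_diff_right[symmetric] norm_scaleR by (simp add: mult.commute)
      qed
    qed
    then show "\<forall>\<^sub>F n in sequentially. \<forall>t\<in>S. \<forall>h.
        norm ((\<Sum>i<n. h *\<^sub>R f' i t) - h *\<^sub>R exp_series t (X x)) \<le> e * norm h"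
      by (rule eventually_sequentially_Suc[THEN iffD1])
  next
    show "0 \<in> S"
      using radius_pos by (simp add: S_def)
    show "(\<lambda>n. (0 ^ n / fact n) *\<^sub>R (X ^^ n) x) sums exp_series 0 x"
      unfolding exp_series_def using summable_sums[OF summable_exp_series[OF _ assms(2), of 0]] radius_pos
      by simp
  qed
  then obtain g where g: "\<And>t. t \<in> S \<Longrightarrow> (\<lambda>n. (t ^ n / fact n) *\<^sub>R (X ^^ n) x) sums g t"
    "\<And>t. t \<in> S \<Longrightarrow> (g has_derivative (\<lambda>h. h *\<^sub>R exp_series t (X x))) (at t within S)"
    by blast
  have t: "t \<in> S" "open S"
    using assms by (auto simp: S_def)
  have "exp_series t x = g t" if "t \<in> S" for t
    using g(1)[OF that] unfolding exp_series_def by (rule sums_unique[symmetric])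
  then have "((\<lambda>t. exp_series t x) has_derivative (\<lambda>h. h *\<^sub>R exp_series t (X x))) (at t within S)"
    by (rule has_derivative_transform[OF t(1) _ g(2)[OF t(1)]])
  then show ?thesis
    unfolding has_vector_derivative_def at_within_open[OF t] .
qed

text \<open>The left side does not change with \<open>s\<close>, because its derivative vanishes by
  skewness; \<open>s\<close> is compared with 0. This is a weak form of the group law that never
  feeds the value of one series into another.\<close>

lemma inner_exp_series_shift:
  assumes "\<bar>s\<bar> < r" "\<bar>t\<bar> < r" "\<bar>s + t\<bar> < r" "x \<in> D" "y \<in> D"
  shows "inner (exp_series s y) (exp_series (s + t) x) = inner y (exp_series t x)"
proof -
  \<comment> \<open>The times at which both series are differentiable; an interval containing 0 and
    \<open>s\<close>.\<close>
  define S where "S = {-r<..<r} \<inter> {-r - t<..<r - t}"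
  have "((\<lambda>s. inner (exp_series s y) (exp_series (s + t) x)) has_vector_derivative 0) (at s within S)"
    if "s \<in> S" for s
  proof -
    have s: "\<bar>s\<bar> < r" "\<bar>s + t\<bar> < r"
      using that by (auto simp: S_def)
    have "((\<lambda>s. s + t) has_vector_derivative 1) (at s)"
      by (auto intro!: derivative_eq_intros)
    from vector_diff_chain_at[OF this exp_series_has_vector_derivative[OF s(2) assms(4)]]
    have "((\<lambda>s. exp_series (s + t) x) has_vector_derivative exp_series (s + t) (X x)) (at s)"
      by (simp add: o_def)
    with exp_series_has_vector_derivative[OF s(1) assms(5)]
    have "((\<lambda>s. inner (exp_series s y) (exp_series (s + t) x)) has_derivative
        (\<lambda>h. inner (exp_series s y) (h *\<^sub>R exp_series (s + t) (X x))
           + inner (h *\<^sub>R exp_series s (X y)) (exp_series (s + t) x))) (at s)"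
      unfolding has_vector_derivative_def by (intro has_derivative_inner)
    then have "((\<lambda>s. inner (exp_series s y) (exp_series (s + t) x)) has_vector_derivative 0) (at s)"
      using exp_series_skew[of s "s + t" y x] s assms(4,5) by (simp add: has_vector_derivative_def)
    then show ?thesis
      by (rule has_vector_derivative_at_within)
  qed
  moreover have "convex S"
    unfolding S_def by (intro convex_Int convex_real_interval)
  ultimately obtain c where c: "\<And>s. s \<in> S \<Longrightarrow> inner (exp_series s y) (exp_series (s + t) x) = c"
    using has_vector_derivative_zero_constant[of S "\<lambda>s. inner (exp_series s y) (exp_series (s + t) x)"]
    by blast
  have "s \<in> S" "0 \<in> S"
    using assms(1-3) by (auto simp: S_def)
  then show ?thesis
    using c[of s] c[of 0] by (simp add: exp_series_0)
qed

lemma norm_exp_series: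
  assumes "\<bar>t\<bar> < r" "x \<in> D"
  shows "norm (exp_series t x) = norm x"
  using inner_exp_series_shift[of t 0 x x] assms radius_pos
  by (simp add: exp_series_0 norm_eq_sqrt_inner)


section \<open>Extension of the short-time isometries to the whole space and to all times\<close>

lemma exp_series_diff:
  assumes "\<bar>t\<bar> \<le> r" "x \<in> D" "y \<in> D"
  shows "exp_series t (x - y) = exp_series t x - exp_series t y"
  using exp_series_add[OF assms(1,2), of "- y"] exp_series_scale[OF assms(1,3), of "- 1"]
    subspace_neg[OF subspace assms(3)] by simp

lemma exp_series_extension:
  assumes "\<bar>t\<bar> < r"
  shows "\<exists>g. continuous_on UNIV g \<and> (\<forall>x\<in>D. g x = exp_series t x)"
proof -
  have "uniformly_continuous_on D (exp_series t)"
    unfolding uniformly_continuous_on_def dist_norm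
  proof (intro allI impI)
    fix e :: real assume "e > 0"
    moreover have "norm (exp_series t x' - exp_series t x) = norm (x' - x)" if "x \<in> D" "x' \<in> D" for x x'
      using norm_exp_series[OF assms, of "x' - x"] exp_series_diff[of t x' x] assms that
        subspace_diff[OF subspace] by simp
    ultimately show "\<exists>d>0. \<forall>x\<in>D. \<forall>x'\<in>D. norm (x' - x) < d \<longrightarrow> norm (exp_series t x' - exp_series t x) < e"
      by auto
  qed
  then obtain g where "uniformly_continuous_on (closure D) g" "\<And>x. x \<in> D \<Longrightarrow> exp_series t x = g x"
    using uniformly_continuous_on_extension_on_closure by metis
  then show ?thesis
    using uniformly_continuous_imp_continuous unfolding dense by metis
qed

text \<open>Within the radius the series is isometric on \<open>D\<close>, hence uniformly
  continuous, so it extends to the closure; density makes the chosen extension the only one.\<close>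

definition local_exp :: "real \<Rightarrow> 'a \<Rightarrow> 'a" where
  "local_exp t = (SOME g. continuous_on UNIV g \<and> (\<forall>x\<in>D. g x = exp_series t x))"

context
  fixes t :: real
  assumes t: "\<bar>t\<bar> < r"
begin

lemma continuous_local_exp: "continuous_on S (local_exp t)"
  and local_exp_eq: "x \<in> D \<Longrightarrow> local_exp t x = exp_series t x"
proof -
  have "continuous_on UNIV (local_exp t) \<and> (\<forall>x\<in>D. local_exp t x = exp_series t x)"
    unfolding local_exp_def by (rule someI_ex[OF exp_series_extension[OF t]])
  then show "continuous_on S (local_exp t)" "x \<in> D \<Longrightarrow> local_exp t x = exp_series t x"
    using continuous_on_subset by blast+
qed

lemma continuous_local_exp_compose:
  "continuous_on S f \<Longrightarrow> continuous_on S (\<lambda>x. local_exp t (f x))"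
  by (rule continuous_on_compose2[OF continuous_local_exp[of UNIV]]) auto

lemma linear_local_exp: "linear (local_exp t)"
proof
  show "local_exp t (c *\<^sub>R x) = c *\<^sub>R local_exp t x" for c x
  proof (rule dense_induct[OF dense, where x = x])
    show "closed {x. local_exp t (c *\<^sub>R x) = c *\<^sub>R local_exp t x}"
      by (intro closed_Collect_eq continuous_local_exp_compose continuous_intros)
  qed (use t in \<open>simp add: local_exp_eq exp_series_scale subspace_scale[OF subspace]\<close>)
  have *: "local_exp t (x + y) = local_exp t x + local_exp t y" if "x \<in> D" for x y
  proof (rule dense_induct[OF dense, where x = y])
    show "closed {y. local_exp t (x + y) = local_exp t x + local_exp t y}"
      by (intro closed_Collect_eq continuous_local_exp_compose continuous_intros)
  qed (use t that in \<open>simp add: local_exp_eq exp_series_add subspace_add[OF subspace]\<close>)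
  show "local_exp t (x + y) = local_exp t x + local_exp t y" for x y
  proof (rule dense_induct[OF dense, where x = x])
    show "closed {x. local_exp t (x + y) = local_exp t x + local_exp t y}"
      by (intro closed_Collect_eq continuous_local_exp_compose continuous_intros)
  qed (rule *)
qed

lemma norm_local_exp: "norm (local_exp t x) = norm x"
proof (rule dense_induct[OF dense, where x = x])
  show "closed {x. norm (local_exp t x) = norm x}"
    by (intro closed_Collect_eq continuous_local_exp_compose continuous_intros)
qed (use t in \<open>simp add: local_exp_eq norm_exp_series\<close>)

lemma inner_local_exp: "inner (local_exp t x) (local_exp t y) = inner x y"
  by (rule inner_isometry[OF linear_local_exp norm_local_exp])

end

lemma local_exp_0: "local_exp 0 = id"
proof
  fix x
  have 0: "\<bar>0\<bar> < r"
    using radius_pos by simp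
  show "local_exp 0 x = id x"
  proof (rule dense_induct[OF dense, where x = x])
    show "closed {x. local_exp 0 x = id x}"
      using continuous_local_exp[OF 0] continuous_on_id' by (rule closed_Collect_eq)
  qed (simp add: local_exp_eq[OF 0] exp_series_0)
qed

text \<open>With \<open>p = exp_series (s + t) x\<close> and \<open>q = local_exp s (exp_series t x)\<close>, the shift identity
  gives \<open>inner q p = inner q q\<close>, and both have the norm of \<open>x\<close>.\<close>

lemma local_exp_add:
  assumes s: "\<bar>s\<bar> < r" and t: "\<bar>t\<bar> < r" and st: "\<bar>s + t\<bar> < r"
  shows "local_exp (s + t) = local_exp s \<circ> local_exp t"
proof
  fix x
  have *: "local_exp (s + t) x = local_exp s (local_exp t x)" if "x \<in> D" for x
  proof -
    let ?p = "local_exp (s + t) x" and ?q = "local_exp s (local_exp t x)"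
    have "inner (local_exp s y) ?p = inner y (local_exp t x)" for y
    proof (rule dense_induct[OF dense, where x = y])
      show "closed {y. inner (local_exp s y) ?p = inner y (local_exp t x)}"
        by (intro closed_Collect_eq continuous_local_exp_compose s continuous_intros)
    qed (use inner_exp_series_shift[OF s t st that] that in \<open>simp add: local_exp_eq s t st\<close>)
    then have "inner ?q ?p = inner x x"
      by (simp add: inner_local_exp t)
    moreover have "inner ?p ?p = inner x x" "inner ?q ?q = inner x x"
      by (simp_all add: inner_local_exp s t st)
    ultimately have "inner (?p - ?q) (?p - ?q) = 0"
      by (simp add: inner_diff inner_commute)
    then show ?thesis
      by simp
  qed
  show "local_exp (s + t) x = (local_exp s \<circ> local_exp t) x"
    unfolding comp_apply
  proof (rule dense_induct[OF dense, where x = x])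
    show "closed {x. local_exp (s + t) x = local_exp s (local_exp t x)}"
      using continuous_local_exp[OF st] continuous_local_exp_compose[OF s continuous_local_exp[OF t]]
      by (rule closed_Collect_eq)
  qed (rule *)
qed

lemma local_exp_power:
  assumes "\<bar>t\<bar> < r" "m > 0"
  shows "local_exp t = local_exp (t / real m) ^^ m"
proof -
  \<comment> \<open>All intermediate times stay inside the radius, so the local group law is
    available at each step.\<close>
  have small: "\<bar>real k * (t / real m)\<bar> < r" if "k \<le> m" for k
  proof -
    have "\<bar>real k * (t / real m)\<bar> = (real k / real m) * \<bar>t\<bar>"
      by (simp add: abs_mult)
    also have "\<dots> \<le> 1 * \<bar>t\<bar>"
      using that assms(2) by (intro mult_right_mono) auto
    finally show ?thesis
      using assms(1) by simp
  qed
  have "k \<le> m \<Longrightarrow> local_exp (real k * (t / real m)) = local_exp (t / real m) ^^ k" for k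
  proof (induction k)
    case (Suc k)
    have "local_exp (t / real m + real k * (t / real m))
        = local_exp (t / real m) \<circ> local_exp (real k * (t / real m))"
      using Suc.prems small[of 1] small[of k] small[of "Suc k"] assms(2)
      by (intro local_exp_add) (auto simp: algebra_simps add_divide_distrib)
    then show ?case
      using Suc by (simp add: algebra_simps add_divide_distrib)
  qed (simp add: local_exp_0)
  from this[of m] show ?thesis
    using assms(2) by simp
qed

text \<open>The number of steps exceeds \<open>\<bar>t\<bar> / r\<close>, which brings
  \<open>t / real n\<close> inside the radius.\<close>

definition global_exp :: "real \<Rightarrow> 'a \<Rightarrow> 'a" where
  "global_exp t = (let n = Suc (nat \<lceil>\<bar>t\<bar> / r\<rceil>) in local_exp (t / real n) ^^ n)"

lemma global_exp_eq:
  assumes "n > 0" "\<bar>t / real n\<bar> < r"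
  shows "global_exp t = local_exp (t / real n) ^^ n"
proof -
  define m where "m = Suc (nat \<lceil>\<bar>t\<bar> / r\<rceil>)"
  have "\<bar>t\<bar> / r < real m"
    unfolding m_def by linarith
  moreover have "m > 0"
    by (simp add: m_def)
  ultimately have m: "m > 0" "\<bar>t / real m\<bar> < r"
    using radius_pos by (auto simp: field_simps)
  \<comment> \<open>Common refinement: both sides are the power with m times n steps of length t /
    (m n).\<close>
  have "local_exp (t / real m) ^^ m = local_exp (t / real n) ^^ n"
    using local_exp_power[OF m(2) assms(1)] local_exp_power[OF assms(2) m(1)]
    by (simp add: funpow_mult mult.commute)
  then show ?thesis
    by (simp add: global_exp_def m_def Let_def)
qed

lemma global_exp_eq_local: "\<bar>t\<bar> < r \<Longrightarrow> global_exp t = local_exp t"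
  using global_exp_eq[of 1 t] by simp

lemma ex_step:
  obtains n where "n > 0" "\<bar>s\<bar> + \<bar>t\<bar> < r * real n"
proof -
  obtain n where "(\<bar>s\<bar> + \<bar>t\<bar>) / r < real n"
    using reals_Archimedean2 by blast
  moreover from this have "n > 0"
    using radius_pos by (intro gr0I) (auto simp: field_simps)
  ultimately show ?thesis
    using that radius_pos by (simp add: field_simps)
qed

text \<open>Cutting both times into the same number of steps reduces the claim to powers of two
  commuting short-time isometries.\<close>

lemma global_exp_add: "global_exp (s + t) = global_exp s \<circ> global_exp t"
proof -
  obtain n where n: "n > 0" "\<bar>s\<bar> + \<bar>t\<bar> < r * real n"
    by (rule ex_step)
  have small: "\<bar>s / real n\<bar> < r" "\<bar>t / real n\<bar> < r" "\<bar>s / real n + t / real n\<bar> < r"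
    using n by (auto simp: field_simps simp flip: add_divide_distrib)
  have "local_exp (s / real n) \<circ> local_exp (t / real n) = local_exp (t / real n) \<circ> local_exp (s / real n)"
    using local_exp_add[OF small] local_exp_add[OF small(2,1)] small(3) by (simp add: add.commute)
  from funpow_comp_commute[OF this, of n]
  have "local_exp (s / real n + t / real n) ^^ n = local_exp (s / real n) ^^ n \<circ> local_exp (t / real n) ^^ n"
    by (simp add: local_exp_add[OF small])
  then show ?thesis
    using global_exp_eq[OF n(1) small(1)] global_exp_eq[OF n(1) small(2)]
      global_exp_eq[OF n(1), of "s + t"] small(3) by (simp add: add_divide_distrib)
qed

lemma global_exp_induct:
  assumes local: "\<And>t x. \<bar>t\<bar> < r \<Longrightarrow> P x \<Longrightarrow> P (local_exp t x)" and "P x"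
  shows "P (global_exp t x)"
proof -
  obtain n where n: "n > 0" "\<bar>t\<bar> + \<bar>0\<bar> < r * real n"
    by (rule ex_step)
  then have small: "\<bar>t / real n\<bar> < r"
    by (simp add: field_simps)
  have "P ((local_exp (t / real n) ^^ k) x)" for k
    by (induction k) (auto intro: local small \<open>P x\<close>)
  then show ?thesis
    by (simp add: global_exp_eq[OF n(1) small])
qed

lemma linear_global_exp: "linear (global_exp t)"
proof -
  obtain n where n: "n > 0" "\<bar>t\<bar> + \<bar>0\<bar> < r * real n"
    by (rule ex_step)
  then have small: "\<bar>t / real n\<bar> < r"
    by (simp add: field_simps)
  have "linear (local_exp (t / real n) ^^ k)" for k
  proof (induction k)
    case 0
    show ?case
      using linear_id by (simp add: id_def)
  next
    case (Suc k)
    then show ?case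
      using linear_compose[OF Suc linear_local_exp[OF small]] by (simp add: o_def)
  qed
  then show ?thesis
    by (simp add: global_exp_eq[OF n(1) small])
qed

lemma norm_global_exp: "norm (global_exp t x) = norm x"
  by (rule global_exp_induct[where P = "\<lambda>y. norm y = norm x"]) (simp_all add: norm_local_exp)

lemma global_exp_0: "global_exp 0 = id"
  using global_exp_eq_local[of 0] radius_pos by (simp add: local_exp_0)

lemma global_exp_derivative_0:
  assumes "x \<in> D"
  shows "((\<lambda>t. global_exp t x) has_vector_derivative X x) (at 0)"
proof (rule has_vector_derivative_transform_within_open)
  show "((\<lambda>t. exp_series t x) has_vector_derivative X x) (at 0)"
    using exp_series_has_vector_derivative[OF _ assms, of 0] radius_pos by (simp add: exp_series_0)
  show "open {-r<..<r}" "0 \<in> {-r<..<r}"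
    using radius_pos by auto
  show "exp_series t x = global_exp t x" if "t \<in> {-r<..<r}" for t
    using that assms by (simp add: global_exp_eq_local local_exp_eq abs_less_iff)
qed

lemma isCont_global_exp_0: "isCont (\<lambda>t. global_exp t x) 0"
  unfolding continuous_at_eps_delta
proof (intro allI impI)
  fix e :: real assume "e > 0"
  obtain y where y: "y \<in> D" "dist y x < e / 3"
    using \<open>e > 0\<close> closure_approachable[of x D] dense by (metis UNIV_I zero_less_divide_iff zero_less_numeral)
  have "isCont (\<lambda>t. global_exp t y) 0"
    using global_exp_derivative_0[OF y(1)] has_vector_derivative_continuous by blast
  then obtain d where d: "d > 0" "\<And>t. \<bar>t\<bar> < d \<Longrightarrow> dist (global_exp t y) y < e / 3"
    using \<open>e > 0\<close> unfolding continuous_at_eps_delta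
    by (metis global_exp_0 id_apply dist_real_def diff_zero zero_less_divide_iff zero_less_numeral)
  have "dist (global_exp t x) x < e" if "\<bar>t\<bar> < d" for t
  proof -
    have "dist (global_exp t x) (global_exp t y) = dist x y"
      using linear_diff[OF linear_global_exp] by (metis dist_norm norm_global_exp)
    then show ?thesis
      using d(2)[OF that] y(2) dist_triangle[of "global_exp t x" x "global_exp t y"]
        dist_triangle[of "global_exp t y" x y] dist_commute[of x y] by linarith
  qed
  then show "\<exists>d>0. \<forall>x'. dist x' 0 < d \<longrightarrow> dist (global_exp x' x) (global_exp 0 x) < e"
    using d(1) by (auto simp: global_exp_0)
qed

lemma continuous_global_exp: "continuous_on UNIV (\<lambda>t. global_exp t x)"
  unfolding continuous_on_eq_continuous_at[OF open_UNIV]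
proof
  fix t
  have "isCont (\<lambda>s. global_exp s (global_exp t x)) (t - t)"
    by (simp add: isCont_global_exp_0)
  moreover have "isCont (\<lambda>s. s - t) t"
    by (intro continuous_intros)
  ultimately have "isCont (\<lambda>s. global_exp (s - t) (global_exp t x)) t"
    by (rule isCont_o2[rotated])
  moreover have "global_exp (s - t) (global_exp t x) = global_exp s x" for s
    using global_exp_add[of "s - t" t] by (simp add: fun_eq_iff)
  ultimately show "isCont (\<lambda>t. global_exp t x) t"
    by simp
qed

lemma isometry_group_global_exp: "isometry_group global_exp"
  unfolding isometry_group_def
  using linear_global_exp norm_global_exp global_exp_0 global_exp_add continuous_global_exp by blast

end

section \<open>The generator as the closure of the operator\<close>

lemma subspace_closure:
  fixes S :: "'a::real_normed_vector set"
  assumes "subspace S"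
  shows "subspace (closure S)"
proof (rule subspaceI)
  show "0 \<in> closure S"
    using subspace_0[OF assms] closure_subset by blast
next
  fix x y assume "x \<in> closure S" "y \<in> closure S"
  then obtain f g where "\<And>n. f n \<in> S" "f \<longlonglongrightarrow> x" "\<And>n. g n \<in> S" "g \<longlonglongrightarrow> y"
    unfolding closure_sequential by blast
  then show "x + y \<in> closure S"
    unfolding closure_sequential
    by (intro exI[of _ "\<lambda>n. f n + g n"]) (auto intro: tendsto_add subspace_add[OF assms])
next
  fix c x assume "x \<in> closure S"
  then obtain f where "\<And>n. f n \<in> S" "f \<longlonglongrightarrow> x"
    unfolding closure_sequential by blast
  then show "c *\<^sub>R x \<in> closure S"
    unfolding closure_sequential
    by (intro exI[of _ "\<lambda>n. c *\<^sub>R f n"])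
      (auto intro: tendsto_scaleR[OF tendsto_const] subspace_scale[OF assms])
qed

text \<open>Riemann sums lie in the subspace and approximate the integral. Applied to a closed
  graph, this moves a closed operator under the integral sign.\<close>

lemma has_integral_closed_subspace:
  fixes f :: "real \<Rightarrow> 'a::real_normed_vector"
  assumes "(f has_integral I) {a..b}" "\<And>t. t \<in> {a..b} \<Longrightarrow> f t \<in> S" "subspace S" "closed S"
  shows "I \<in> S"
proof -
  have "\<exists>y\<in>S. dist y I < e" if "e > 0" for e
  proof -
    obtain g where g: "gauge g" "\<And>p. p tagged_division_of {a..b} \<Longrightarrow> g fine p \<Longrightarrow>
        norm ((\<Sum>(x, k)\<in>p. measure lborel k *\<^sub>R f x) - I) < e"
      using assms(1)[unfolded has_integral_real, rule_format, OF \<open>e > 0\<close>] by auto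
    obtain p where p: "p tagged_division_of {a..b}" "g fine p"
      using fine_division_exists_real[OF g(1)] by metis
    have "(\<Sum>(x, k)\<in>p. measure lborel k *\<^sub>R f x) \<in> S"
      using tag_in_interval[OF p(1)] assms(2)
      by (intro subspace_sum[OF assms(3)]) (auto intro: subspace_scale[OF assms(3)])
    then show ?thesis
      using g(2)[OF p] by (auto simp: dist_norm)
  qed
  then have "I \<in> closure S"
    by (simp add: closure_approachable)
  then show ?thesis
    using assms(4) by simp
qed

context analytic_skew_operator
begin

definition closed_graph :: "('a \<times> 'a) set" where
  "closed_graph = closure {(x, X x) | x. x \<in> D}"

lemma subspace_closed_graph: "subspace closed_graph"
  unfolding closed_graph_def
proof (intro subspace_closure subspaceI)
  have "X (0 *\<^sub>R 0) = 0 *\<^sub>R X 0"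
    by (rule scale) (rule subspace_0[OF subspace])
  then show "0 \<in> {(x, X x) | x. x \<in> D}"
    by (auto simp: zero_prod_def subspace_0[OF subspace])
qed (auto simp: add scale subspace_add[OF subspace] subspace_scale[OF subspace])

lemma closed_closed_graph: "closed closed_graph"
  by (simp add: closed_graph_def)

lemma graph_subset: "x \<in> D \<Longrightarrow> (x, X x) \<in> closed_graph"
  unfolding closed_graph_def by (rule subsetD[OF closure_subset]) blast

text \<open>On \<open>D\<close> the pair of limits is approximated by pairs of partial sums, which
  lie on the graph of \<open>X\<close>; continuity of \<open>local_exp\<close> covers the
  closure.\<close>

lemma closed_graph_invariant:
  assumes t: "\<bar>t\<bar> < r" and pq: "(p, q) \<in> closed_graph"
  shows "(local_exp t p, local_exp t q) \<in> closed_graph"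
proof -
  let ?T = "{w. (local_exp t (fst w), local_exp t (snd w)) \<in> closed_graph}"
  have "continuous_on UNIV (\<lambda>w. (local_exp t (fst w), local_exp t (snd w)))"
    by (intro continuous_on_Pair continuous_local_exp_compose t continuous_intros)
  then have "closed ?T"
    using closed_vimage[OF closed_closed_graph] by (simp add: vimage_def)
  moreover have "{(x, X x) | x. x \<in> D} \<subseteq> ?T"
  proof clarsimp
    fix x assume x: "x \<in> D"
    have "(\<lambda>n. (partial_exp n t x, partial_exp n t (X x))) \<longlonglongrightarrow> (exp_series t x, exp_series t (X x))"
      using t x by (intro tendsto_Pair partial_exp_LIMSEQ maps) auto
    moreover have "(partial_exp n t x, partial_exp n t (X x)) \<in> closed_graph" for n
      using graph_subset[OF partial_exp_maps[OF x]] by (simp add: X_partial_exp x)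
    ultimately have "(exp_series t x, exp_series t (X x)) \<in> closed_graph"
      by (rule closed_sequentially[OF closed_closed_graph, rotated])
    then show "(local_exp t x, local_exp t (X x)) \<in> closed_graph"
      by (simp add: local_exp_eq[OF t] x maps)
  qed
  ultimately have "closed_graph \<subseteq> ?T"
    unfolding closed_graph_def by (intro closure_minimal)
  then show ?thesis
    using pq by auto
qed

lemma global_exp_integrable: "(\<lambda>t. global_exp t x) integrable_on {a..b}"
  using continuous_global_exp continuous_on_subset by (intro integrable_continuous_real) blast

text \<open>Averaging regularises: every vector, in the domain or not, has its time average in the
  domain of the closure. For \<open>x\<close> in \<open>D\<close> the pair is the integral of
  \<open>(global_exp t x, global_exp t (X x))\<close> and both components are bounded linear in
  \<open>x\<close>, so density applies.\<close>

lemma averaged_in_closed_graph: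
  assumes e: "0 \<le> e" "e < r"
  shows "(integral {0..e} (\<lambda>t. global_exp t x), global_exp e x - x) \<in> closed_graph"
proof (rule dense_induct[OF dense, where x = x])
  have "bounded_linear (\<lambda>x. integral {0..e} (\<lambda>t. global_exp t x))"
  proof (rule bounded_linear_intro)
    show "integral {0..e} (\<lambda>t. global_exp t (x + y))
        = integral {0..e} (\<lambda>t. global_exp t x) + integral {0..e} (\<lambda>t. global_exp t y)" for x y
      by (simp add: linear_add[OF linear_global_exp] integral_add global_exp_integrable)
    show "integral {0..e} (\<lambda>t. global_exp t (c *\<^sub>R x)) = c *\<^sub>R integral {0..e} (\<lambda>t. global_exp t x)" for c x
      by (simp add: linear_scale[OF linear_global_exp])
    show "norm (integral {0..e} (\<lambda>t. global_exp t x)) \<le> norm x * (e - 0)" for x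
      using e continuous_on_subset[OF continuous_global_exp]
      by (intro integral_bound) (auto simp: norm_global_exp)
  qed
  then have "continuous_on UNIV (\<lambda>x. (integral {0..e} (\<lambda>t. global_exp t x), global_exp e x - x))"
    using bounded_linear_isometry_group[OF isometry_group_global_exp, of e]
    by (intro continuous_on_Pair continuous_on_diff linear_continuous_on bounded_linear_ident)
  from closed_vimage[OF closed_closed_graph this]
  show "closed {x. (integral {0..e} (\<lambda>t. global_exp t x), global_exp e x - x) \<in> closed_graph}"
    by (simp add: vimage_def)
next
  fix x assume x: "x \<in> D"
  have "(x, X x) \<in> group_generator global_exp"
    by (simp add: group_generator_def global_exp_derivative_0 x)
  then have 2: "((\<lambda>t. global_exp t (X x)) has_integral global_exp e x - global_exp 0 x) {0..e}"
    using e group_generator_derivative[OF isometry_group_global_exp]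
    by (intro fundamental_theorem_of_calculus) (auto intro: has_vector_derivative_at_within)
  let ?f = "\<lambda>t. (global_exp t x, global_exp t (X x))"
  have "continuous_on {0..e} ?f"
    by (intro continuous_on_Pair continuous_on_subset[OF continuous_global_exp]) auto
  then obtain I where I: "(?f has_integral I) {0..e}"
    using integrable_continuous_real by blast
  have "fst I = integral {0..e} (\<lambda>t. global_exp t x)" "snd I = global_exp e x - x"
    using has_integral_linear[OF I bounded_linear_fst] has_integral_linear[OF I bounded_linear_snd]
      has_integral_unique[OF _ 2]
    by (auto simp: o_def global_exp_0 integral_unique)
  moreover have "I \<in> closed_graph"
  proof (rule has_integral_closed_subspace[OF I _ subspace_closed_graph closed_closed_graph])
    fix t assume "t \<in> {0..e}"
    then show "?f t \<in> closed_graph"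
      using e closed_graph_invariant[OF _ graph_subset[OF x], of t]
      by (simp add: global_exp_eq_local)
  qed
  ultimately show "(integral {0..e} (\<lambda>t. global_exp t x), global_exp e x - x) \<in> closed_graph"
    by (metis prod.collapse)
qed

text \<open>The second inclusion is the substantial one. Normalised averages of a vector in the
  domain of the generator, paired with its difference quotients, lie in the closed graph and tend to
  the given pair.\<close>

theorem group_generator_global_exp: "group_generator global_exp = closed_graph"
proof
  show "closed_graph \<subseteq> group_generator global_exp"
    unfolding closed_graph_def
  proof (rule closure_minimal)
    show "{(x, X x) |x. x \<in> D} \<subseteq> group_generator global_exp"
      by (auto simp: group_generator_def global_exp_derivative_0)
  qed (rule closed_group_generator[OF isometry_group_global_exp])
  show "group_generator global_exp \<subseteq> closed_graph"
  proof clarify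
    fix x z assume "(x, z) \<in> group_generator global_exp"
    then have deriv: "((\<lambda>t. global_exp t x) has_derivative (\<lambda>h. h *\<^sub>R z)) (at 0)"
      by (simp add: group_generator_def has_vector_derivative_def)
    have "\<exists>w\<in>closed_graph. dist w (x, z) < e" if "e > 0" for e
    proof -
      have e3: "e / 3 > 0"
        using that by simp
      obtain d1 where d1: "d1 > 0"
        "\<And>t. \<bar>t\<bar> < d1 \<Longrightarrow> norm (global_exp t x - x - t *\<^sub>R z) \<le> e / 3 * \<bar>t\<bar>"
        using deriv[unfolded has_derivative_at_alt, THEN conjunct2, rule_format, OF e3]
        by (auto simp: global_exp_0)
      have int: "((\<lambda>u. integral {0..u} (\<lambda>t. global_exp t x)) has_vector_derivative global_exp 0 x) (at 0 within {0..r})"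
        using radius_pos continuous_on_subset[OF continuous_global_exp]
        by (intro integral_has_vector_derivative) auto
      obtain d2 where d2: "d2 > 0"
        "\<And>t. t \<in> {0..r} \<Longrightarrow> \<bar>t\<bar> < d2 \<Longrightarrow>
          norm (integral {0..t} (\<lambda>t. global_exp t x) - t *\<^sub>R x) \<le> e / 3 * \<bar>t\<bar>"
        using int[unfolded has_vector_derivative_def has_derivative_within_alt, THEN conjunct2,
            rule_format, OF e3]
        by (auto simp: global_exp_0)
      \<comment> \<open>Below \<open>r\<close>, as the averaging lemma demands, and below both
        \<open>d1\<close> and \<open>d2\<close>, which puts each component of \<open>w\<close>
        within a third of \<open>e\<close>.\<close>
      define t where "t = min (r / 2) (min (d1 / 2) (d2 / 2))"
      have t: "0 < t" "t < r" "t < d1" "t < d2"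
        using radius_pos d1(1) d2(1) by (auto simp: t_def)
      define w where "w = (1 / t) *\<^sub>R (integral {0..t} (\<lambda>t. global_exp t x), global_exp t x - x)"
      have scaled: "norm ((1 / t) *\<^sub>R y - y') \<le> e / 3" if "norm (y - t *\<^sub>R y') \<le> e / 3 * \<bar>t\<bar>" for y y' :: 'a
      proof -
        have "(1 / t) *\<^sub>R y - y' = (1 / t) *\<^sub>R (y - t *\<^sub>R y')"
          using t by (simp add: scaleR_diff_right)
        then have "norm ((1 / t) *\<^sub>R y - y') = norm (y - t *\<^sub>R y') / t"
          using t by (metis norm_scaleR abs_of_pos divide_inverse_commute mult_1 divide_inverse inverse_positive_iff_positive mult.commute)
        then show ?thesis
          using that t by (simp add: pos_divide_le_eq)
      qed
      have "w \<in> closed_graph"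
        unfolding w_def using t
        by (intro subspace_scale[OF subspace_closed_graph] averaged_in_closed_graph) auto
      moreover have "dist w (x, z) < e"
      proof -
        have "dist w (x, z) \<le> norm (fst w - x) + norm (snd w - z)"
          using norm_Pair_le[of "fst w - x" "snd w - z"]
          by (simp add: dist_norm minus_prod_def)
        also have "\<dots> \<le> e / 3 + e / 3"
          unfolding w_def using t scaled[OF d1(2)[of t]] scaled[OF d2(2)[of t]]
          by (intro add_mono) simp_all
        finally show ?thesis
          using \<open>e > 0\<close> by linarith
      qed
      ultimately show ?thesis
        by blast
    qed
    then have "(x, z) \<in> closure closed_graph"
      by (simp add: closure_approachable)
    then show "(x, z) \<in> closed_graph"
      by (simp add: closed_graph_def)
  qed
qed

end

section \<open>Finite-particle vectors\<close>

type_synonym 'n state = "('n \<Rightarrow> nat) \<Rightarrow> complex"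

definition finite_support :: "('a \<Rightarrow> complex) \<Rightarrow> bool" where
  "finite_support \<psi> \<longleftrightarrow> finite {k. \<psi> k \<noteq> 0}"

definition dot :: "('a \<Rightarrow> complex) \<Rightarrow> ('a \<Rightarrow> complex) \<Rightarrow> complex" where
  "dot \<psi> \<phi> = (\<Sum>\<^sub>\<infinity>k. cnj (\<psi> k) * \<phi> k)"

lemma finite_support_0 [simp]: "finite_support (\<lambda>k. 0)"
  by (simp add: finite_support_def)

lemma finite_support_add [simp]:
  assumes "finite_support \<psi>" "finite_support \<phi>"
  shows "finite_support (\<lambda>k. \<psi> k + \<phi> k)"
proof -
  have "{k. \<psi> k + \<phi> k \<noteq> 0} \<subseteq> {k. \<psi> k \<noteq> 0} \<union> {k. \<phi> k \<noteq> 0}"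
    by auto
  then show ?thesis
    using assms unfolding finite_support_def by (meson finite_UnI finite_subset)
qed

lemma finite_support_cmult [simp]:
  "finite_support \<psi> \<Longrightarrow> finite_support (\<lambda>k. c * \<psi> k)"
  unfolding finite_support_def by (elim finite_subset[rotated]) auto

lemma finite_support_sum [simp]:
  "(\<And>i. i \<in> I \<Longrightarrow> finite_support (\<psi> i)) \<Longrightarrow> finite_support (\<lambda>k. \<Sum>i\<in>I. \<psi> i k)"
  by (induction I rule: infinite_finite_induct) auto

lemma dot_eq_sum:
  assumes "finite S" "\<And>k. k \<notin> S \<Longrightarrow> cnj (\<psi> k) * \<phi> k = 0"
  shows "dot \<psi> \<phi> = (\<Sum>k\<in>S. cnj (\<psi> k) * \<phi> k)"
proof -
  have "dot \<psi> \<phi> = (\<Sum>\<^sub>\<infinity>k\<in>S. cnj (\<psi> k) * \<phi> k)"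
    unfolding dot_def using assms(2) by (intro infsum_cong_neutral) auto
  then show ?thesis
    using assms(1) by simp
qed

lemma cnj_dot: "cnj (dot \<psi> \<phi>) = dot \<phi> \<psi>"
  unfolding dot_def by (simp flip: infsum_cnj add: mult.commute)

context
  fixes \<psi> :: "'a \<Rightarrow> complex"
  assumes \<psi>: "finite_support \<psi>"
begin

lemma dot_finite_support: "dot \<psi> \<phi> = (\<Sum>k | \<psi> k \<noteq> 0. cnj (\<psi> k) * \<phi> k)"
  using \<psi> by (intro dot_eq_sum) (auto simp: finite_support_def)

lemma dot_add: "dot \<psi> (\<lambda>k. \<phi> k + \<xi> k) = dot \<psi> \<phi> + dot \<psi> \<xi>"
  by (simp add: dot_finite_support distrib_left sum.distrib)

lemma dot_cmult: "dot \<psi> (\<lambda>k. c * \<phi> k) = c * dot \<psi> \<phi>"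
  by (simp add: dot_finite_support sum_distrib_left mult.left_commute)

lemma dot_sum: "dot \<psi> (\<lambda>k. \<Sum>i\<in>I. \<phi> i k) = (\<Sum>i\<in>I. dot \<psi> (\<phi> i))"
  unfolding dot_finite_support by (subst sum.swap) (simp add: sum_distrib_left)

end

text \<open>Ladder operators act on plain coefficient families, while norms live on
  \<open>ell2\<close>; \<open>ket\<close> mediates. It has its intended meaning on square-summable
  families and is used on finitely supported ones.\<close>

definition ket :: "('a \<Rightarrow> complex) \<Rightarrow> 'a ell2" where
  "ket \<psi> = Abs_ell2 \<psi>"

lemma coeff_ket [simp]:
  assumes "finite_support \<psi>"
  shows "coeff_ell2 (ket \<psi>) = \<psi>"
proof -
  have "(\<lambda>k. (cmod (\<psi> k))\<^sup>2) summable_on {k. \<psi> k \<noteq> 0}"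
    using assms by (simp add: finite_support_def)
  then have "(\<lambda>k. (cmod (\<psi> k))\<^sup>2) summable_on UNIV"
    by (rule summable_on_cong_neutral[THEN iffD1, rotated -1]) auto
  then show ?thesis
    by (simp add: ket_def Abs_ell2_inverse)
qed

lemma ket_coeff [simp]: "ket (coeff_ell2 x) = x"
  by (simp add: ket_def coeff_ell2_inverse)

lemma cinner_ket: "finite_support \<psi> \<Longrightarrow> finite_support \<phi> \<Longrightarrow> cinner_ell2 (ket \<psi>) (ket \<phi>) = dot \<psi> \<phi>"
  by (simp add: cinner_ell2_def dot_def)

lemma ket_add: "finite_support \<psi> \<Longrightarrow> finite_support \<phi> \<Longrightarrow> ket (\<lambda>k. \<psi> k + \<phi> k) = ket \<psi> + ket \<phi>"
  by (rule ell2_eqI) (simp add: coeff_ell2_simps)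

lemma ket_cmult: "finite_support \<psi> \<Longrightarrow> ket (\<lambda>k. c * \<psi> k) = scaleC_ell2 c (ket \<psi>)"
  by (rule ell2_eqI) (simp add: coeff_ell2_simps)

lemma ket_0 [simp]: "ket (\<lambda>k. 0) = 0"
  by (rule ell2_eqI) (simp add: coeff_ell2_simps)

lemma ket_sum:
  "(\<And>i. i \<in> I \<Longrightarrow> finite_support (\<psi> i)) \<Longrightarrow> ket (\<lambda>k. \<Sum>i\<in>I. \<psi> i k) = (\<Sum>i\<in>I. ket (\<psi> i))"
  by (induction I rule: infinite_finite_induct) (simp_all add: ket_add)

lemma norm_ket_sum_le:
  assumes "\<And>i. i \<in> I \<Longrightarrow> finite_support (\<psi> i)" "\<And>i. i \<in> I \<Longrightarrow> norm (ket (\<psi> i)) \<le> b"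
  shows "norm (ket (\<lambda>k. \<Sum>i\<in>I. c i * \<psi> i k)) \<le> (\<Sum>i\<in>I. cmod (c i)) * b"
proof -
  have "norm (ket (\<lambda>k. \<Sum>i\<in>I. c i * \<psi> i k)) = norm (\<Sum>i\<in>I. scaleC_ell2 (c i) (ket (\<psi> i)))"
    using assms(1) by (simp add: ket_sum ket_cmult)
  also have "\<dots> \<le> (\<Sum>i\<in>I. cmod (c i) * b)"
    by (rule sum_norm_le) (simp add: norm_scaleC_ell2 assms(2) mult_left_mono)
  finally show ?thesis
    by (simp add: sum_distrib_right)
qed

lemma norm_ket_power2:
  assumes "finite_support \<psi>"
  shows "(norm (ket \<psi>))\<^sup>2 = Re (dot \<psi> \<psi>)"
  using cinner_ell2_eq_inner[of "ket \<psi>" "ket \<psi>"] assms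
  by (simp add: cinner_ket power2_norm_eq_inner)

lemma finite_particle_iff: "x \<in> finite_particle \<longleftrightarrow> finite_support (coeff_ell2 x)"
  by (simp add: finite_particle_def finite_support_def)

lemma closure_finite_particle: "closure finite_particle = (UNIV :: 'n fock set)"
proof -
  have "\<exists>y\<in>finite_particle. dist y x < e" if "e > 0" for e and x :: "'n fock"
  proof -
    \<comment> \<open>The squared norm is the supremum of the finite sums. Missing it by at most e^2
      / 4 leaves a tail of norm at most e / 2.\<close>
    obtain F where F: "finite F" "(\<Sum>k\<in>F. (cmod (coeff_ell2 x k))\<^sup>2) > (norm x)\<^sup>2 - e\<^sup>2 / 4"
    proof (rule ccontr)
      note F_that = that
      assume "\<not> thesis"
      then have "(\<Sum>k\<in>F. (cmod (coeff_ell2 x k))\<^sup>2) \<le> (norm x)\<^sup>2 - e\<^sup>2 / 4" if "finite F" for F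
        using that \<open>\<not> thesis\<close> F_that by (meson not_le)
      then have "(norm x)\<^sup>2 \<le> (norm x)\<^sup>2 - e\<^sup>2 / 4"
        unfolding norm_ell2_power2[of x] by (intro infsum_le_finite_sums[OF summable_ell2])
      then show False
        using \<open>e > 0\<close> by simp
    qed
    define \<psi> where "\<psi> k = (if k \<in> F then coeff_ell2 x k else 0)" for k
    have \<psi>: "finite_support \<psi>"
      using F(1) by (auto simp: finite_support_def \<psi>_def)
    have "norm (ket \<psi> - x) \<le> e / 2"
    proof (rule norm_ell2_leI)
      fix F' :: "('n \<Rightarrow> nat) set" assume F': "finite F'"
      have "(\<Sum>k\<in>F'. (cmod (coeff_ell2 (ket \<psi> - x) k))\<^sup>2) = (\<Sum>k\<in>F' - F. (cmod (coeff_ell2 x k))\<^sup>2)"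
        using F' \<psi> by (intro sum.mono_neutral_cong_right) (auto simp: coeff_ell2_simps \<psi>_def)
      also have "\<dots> = (\<Sum>k\<in>(F' - F) \<union> F. (cmod (coeff_ell2 x k))\<^sup>2) - (\<Sum>k\<in>F. (cmod (coeff_ell2 x k))\<^sup>2)"
        using F' F(1) by (subst sum.union_disjoint) auto
      also have "\<dots> \<le> (norm x)\<^sup>2 - ((norm x)\<^sup>2 - e\<^sup>2 / 4)"
        using F F' sum_coeff_le_norm_ell2[of "(F' - F) \<union> F" x] by (intro diff_mono) auto
      finally show "(\<Sum>k\<in>F'. (cmod (coeff_ell2 (ket \<psi> - x) k))\<^sup>2) \<le> (e / 2)\<^sup>2"
        by (simp add: power_divide)
    qed (use that in simp)
    then show ?thesis
      using \<psi> that by (intro bexI[of _ "ket \<psi>"]) (auto simp: dist_norm finite_particle_iff)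
  qed
  then show ?thesis
    by (auto simp: closure_approachable)
qed

section \<open>Ladder operators: support, adjoints and number bounds\<close>

lemma finite_support_creat [simp]:
  assumes "finite_support \<psi>"
  shows "finite_support (creat i \<psi>)"
proof -
  have "{k. creat i \<psi> k \<noteq> 0} \<subseteq> (\<lambda>k. k(i := k i + 1)) ` {k. \<psi> k \<noteq> 0}"
  proof
    fix k assume "k \<in> {k. creat i \<psi> k \<noteq> 0}"
    then show "k \<in> (\<lambda>k. k(i := k i + 1)) ` {k. \<psi> k \<noteq> 0}"
      by (intro image_eqI[of _ _ "k(i := k i - 1)"]) (auto simp: creat_def fun_eq_iff)
  qed
  then show ?thesis
    using assms unfolding finite_support_def by (rule finite_subset[OF _ finite_imageI])
qed

lemma finite_support_annihil [simp]:
  assumes "finite_support \<psi>"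
  shows "finite_support (annihil i \<psi>)"
proof -
  have "{k. annihil i \<psi> k \<noteq> 0} \<subseteq> (\<lambda>k. k(i := k i - 1)) ` {k. \<psi> k \<noteq> 0}"
  proof
    fix k assume "k \<in> {k. annihil i \<psi> k \<noteq> 0}"
    then show "k \<in> (\<lambda>k. k(i := k i - 1)) ` {k. \<psi> k \<noteq> 0}"
      by (intro image_eqI[of _ _ "k(i := k i + 1)"]) (auto simp: annihil_def fun_eq_iff)
  qed
  then show ?thesis
    using assms unfolding finite_support_def by (rule finite_subset[OF _ finite_imageI])
qed

text \<open>Reindexing along the injective map that raises mode \<open>i\<close>: outside its range
  the occupation of \<open>i\<close> is 0 and \<open>creat\<close> vanishes, inside it both sides
  carry the same square root. Reindexing \<open>infsum\<close> is unconditional, so arbitrary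
  families are allowed.\<close>

lemma dot_creat_left:
  fixes \<psi> \<phi> :: "'n state"
  shows "dot (creat i \<psi>) \<phi> = dot \<psi> (annihil i \<phi>)"
proof -
  let ?h = "\<lambda>k :: 'n \<Rightarrow> nat. k(i := k i + 1)" and ?g = "\<lambda>k. cnj (creat i \<psi> k) * \<phi> k"
  have inj: "inj ?h"
  proof (rule injI)
    fix k l :: "'n \<Rightarrow> nat" assume "k(i := k i + 1) = l(i := l i + 1)"
    then have eq: "(k(i := k i + 1)) j = (l(i := l i + 1)) j" for j
      by (rule fun_cong)
    show "k = l"
    proof
      fix j
      show "k j = l j"
        using eq[of j] by (cases "j = i") auto
    qed
  qed
  have "k \<in> range ?h" if "?g k \<noteq> 0" for k
    using that by (intro range_eqI[of _ _ "k(i := k i - 1)"]) (auto simp: creat_def fun_eq_iff)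
  then have "dot (creat i \<psi>) \<phi> = infsum ?g (range ?h)"
    unfolding dot_def by (intro infsum_cong_neutral) auto
  also have "\<dots> = (\<Sum>\<^sub>\<infinity>k. ?g (?h k))"
    by (subst infsum_reindex[OF inj]) (simp add: o_def)
  also have "\<dots> = dot \<psi> (annihil i \<phi>)"
    unfolding dot_def by (rule infsum_cong) (simp add: creat_def annihil_def mult_ac)
  finally show ?thesis .
qed

lemma dot_annihil_left: "dot (annihil i \<psi>) \<phi> = dot \<psi> (creat i \<phi>)"
  by (metis cnj_dot dot_creat_left)

lemma creat_annihil: "creat i (annihil i \<psi>) k = of_nat (k i) * \<psi> k"
proof (cases "k i")
  case (Suc m)
  have "complex_of_real (sqrt (real (Suc m))) * (complex_of_real (sqrt (real (Suc m))) * z) = of_nat (Suc m) * z" for z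
    by (simp add: mult.assoc[symmetric] of_real_mult[symmetric] del: of_real_mult of_nat_Suc)
  then show ?thesis
    using Suc by (simp add: annihil_def creat_def fun_upd_idem del: of_nat_Suc)
qed (simp add: creat_def)

lemma annihil_creat: "annihil i (creat i \<psi>) k = of_nat (k i + 1) * \<psi> k"
  using canonical_commutation[of i i \<psi> k] by (simp add: creat_annihil algebra_simps)

definition degree_le :: "nat \<Rightarrow> ('n::finite) state \<Rightarrow> bool" where
  "degree_le N \<psi> \<longleftrightarrow> finite_support \<psi> \<and> (\<forall>k. \<psi> k \<noteq> 0 \<longrightarrow> (\<Sum>i\<in>UNIV. k i) \<le> N)"

lemma degree_le_finite_support: "degree_le N \<psi> \<Longrightarrow> finite_support \<psi>"
  by (simp add: degree_le_def)

lemma degree_le_mono: "degree_le N \<psi> \<Longrightarrow> N \<le> M \<Longrightarrow> degree_le M \<psi>"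
  by (auto simp: degree_le_def)

lemma ex_degree_le:
  assumes "finite_support \<psi>"
  obtains N where "degree_le N \<psi>"
proof -
  let ?S = "(\<lambda>k. \<Sum>i\<in>UNIV. k i) ` {k. \<psi> k \<noteq> 0}"
  have "finite ?S"
    using assms by (simp add: finite_support_def)
  then have "degree_le (Max ?S) \<psi>"
    using assms by (auto simp: degree_le_def)
  then show ?thesis
    by (rule that)
qed

lemma degree_le_add:
  "degree_le N \<psi> \<Longrightarrow> degree_le N \<phi> \<Longrightarrow> degree_le N (\<lambda>k. \<psi> k + \<phi> k)"
  unfolding degree_le_def by (metis finite_support_add add.right_neutral)

lemma degree_le_cmult: "degree_le N \<psi> \<Longrightarrow> degree_le N (\<lambda>k. c * \<psi> k)"
  by (auto simp: degree_le_def)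

lemma degree_le_sum: "(\<And>i. i \<in> I \<Longrightarrow> degree_le N (\<psi> i)) \<Longrightarrow> degree_le N (\<lambda>k. \<Sum>i\<in>I. \<psi> i k)"
  by (induction I rule: infinite_finite_induct) (auto intro: degree_le_add simp: degree_le_def[of N "\<lambda>k. 0"])

lemma sum_fun_upd_nat:
  fixes k :: "'n::finite \<Rightarrow> nat"
  shows "(\<Sum>j\<in>UNIV. (k(i := m)) j) + k i = (\<Sum>j\<in>UNIV. k j) + m"
  using sum.remove[of UNIV i "k(i := m)"] sum.remove[of UNIV i k]
    sum.cong[of "UNIV - {i}" "UNIV - {i}" "k(i := m)" k] by simp

lemma degree_le_creat: "degree_le N \<psi> \<Longrightarrow> degree_le (Suc N) (creat i \<psi>)"
  unfolding degree_le_def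
proof (intro conjI allI impI)
  fix k assume \<psi>: "finite_support \<psi> \<and> (\<forall>k. \<psi> k \<noteq> 0 \<longrightarrow> (\<Sum>i\<in>UNIV. k i) \<le> N)" and "creat i \<psi> k \<noteq> 0"
  then have "k i > 0" "\<psi> (k(i := k i - 1)) \<noteq> 0"
    by (auto simp: creat_def)
  with \<psi> have "(\<Sum>j\<in>UNIV. (k(i := k i - 1)) j) \<le> N" "k i > 0"
    by blast+
  then show "(\<Sum>i\<in>UNIV. k i) \<le> Suc N"
    using sum_fun_upd_nat[of k i "k i - 1"] by linarith
qed simp

lemma degree_le_annihil: "degree_le N \<psi> \<Longrightarrow> degree_le N (annihil i \<psi>)"
  unfolding degree_le_def
proof (intro conjI allI impI)
  fix k assume \<psi>: "finite_support \<psi> \<and> (\<forall>k. \<psi> k \<noteq> 0 \<longrightarrow> (\<Sum>i\<in>UNIV. k i) \<le> N)" and "annihil i \<psi> k \<noteq> 0"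
  then have "\<psi> (k(i := k i + 1)) \<noteq> 0"
    by (auto simp: annihil_def)
  with \<psi> have "(\<Sum>j\<in>UNIV. (k(i := k i + 1)) j) \<le> N"
    by blast
  then show "(\<Sum>i\<in>UNIV. k i) \<le> N"
    using sum_fun_upd_nat[of k i "k i + 1"] by linarith
qed simp

text \<open>Common part of the two ladder bounds: the squared norm is the expectation of an operator
  diagonal in the occupation numbers, with eigenvalues at most N + 1 on the support.\<close>

lemma norm_ket_le_of_number:
  assumes "degree_le N \<psi>" "finite_support \<phi>"
    and number: "dot \<phi> \<phi> = dot \<psi> (\<lambda>k. of_nat (c k) * \<psi> k)"
    and c: "\<And>k. \<psi> k \<noteq> 0 \<Longrightarrow> c k \<le> Suc N"
  shows "norm (ket \<phi>) \<le> sqrt (Suc N) * norm (ket \<psi>)"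
proof -
  have \<psi>: "finite_support \<psi>"
    using assms(1) by (rule degree_le_finite_support)
  have sq: "Re (cnj z * (of_nat m * z)) = real m * (cmod z)\<^sup>2" for z m
    by (simp add: cmod_power2) (simp add: algebra_simps power2_eq_square)
  have "(norm (ket \<phi>))\<^sup>2 = (\<Sum>k | \<psi> k \<noteq> 0. real (c k) * (cmod (\<psi> k))\<^sup>2)"
    unfolding norm_ket_power2[OF assms(2)] number dot_finite_support[OF \<psi>] Re_sum sq ..
  also have "\<dots> \<le> (\<Sum>k | \<psi> k \<noteq> 0. real (Suc N) * (cmod (\<psi> k))\<^sup>2)"
    using c by (intro sum_mono mult_right_mono) (auto simp del: of_nat_Suc)
  also have "\<dots> = real (Suc N) * (norm (ket \<psi>))\<^sup>2"
    unfolding norm_ket_power2[OF \<psi>] dot_finite_support[OF \<psi>] Re_sum sq[of _ 1, simplified of_nat_1 mult_1]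
    by (simp add: sum_distrib_left)
  finally have "(norm (ket \<phi>))\<^sup>2 \<le> (sqrt (Suc N) * norm (ket \<psi>))\<^sup>2"
    by (simp add: power_mult_distrib)
  then show ?thesis
    by (rule power2_le_imp_le) simp
qed

lemma member_le_degree: "(k :: 'n::finite \<Rightarrow> nat) i \<le> (\<Sum>j\<in>UNIV. k j)"
  by (rule member_le_sum) auto

lemma norm_creat_le:
  assumes "degree_le N \<psi>"
  shows "norm (ket (creat i \<psi>)) \<le> sqrt (Suc N) * norm (ket \<psi>)"
proof (rule norm_ket_le_of_number[OF assms])
  show "finite_support (creat i \<psi>)"
    using assms by (simp add: degree_le_def)
  show "dot (creat i \<psi>) (creat i \<psi>) = dot \<psi> (\<lambda>k. of_nat (k i + 1) * \<psi> k)"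
    unfolding dot_creat_left annihil_creat[abs_def] ..
  show "k i + 1 \<le> Suc N" if "\<psi> k \<noteq> 0" for k
    using assms that member_le_degree[of k i] by (auto simp: degree_le_def intro: order_trans)
qed

lemma norm_annihil_le:
  assumes "degree_le N \<psi>"
  shows "norm (ket (annihil i \<psi>)) \<le> sqrt (Suc N) * norm (ket \<psi>)"
proof (rule norm_ket_le_of_number[OF assms])
  show "finite_support (annihil i \<psi>)"
    using assms by (simp add: degree_le_def)
  show "dot (annihil i \<psi>) (annihil i \<psi>) = dot \<psi> (\<lambda>k. of_nat (k i) * \<psi> k)"
    unfolding dot_annihil_left creat_annihil[abs_def] ..
  show "k i \<le> Suc N" if "\<psi> k \<noteq> 0" for k
    using assms that member_le_degree[of k i] by (auto simp: degree_le_def intro: order_trans le_SucI)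
qed

section \<open>The quadratic expression\<close>

lemma creat_linear:
  "creat i (\<lambda>k. \<psi> k + \<phi> k) = (\<lambda>k. creat i \<psi> k + creat i \<phi> k)"
  "creat i (\<lambda>k. c * \<psi> k) = (\<lambda>k. c * creat i \<psi> k)"
  "creat i (\<lambda>k. if b then \<psi> k else 0) = (\<lambda>k. if b then creat i \<psi> k else 0)"
  "creat i (\<lambda>k. \<Sum>j\<in>I. \<psi>' j k) = (\<lambda>k. \<Sum>j\<in>I. creat i (\<psi>' j) k)"
  by (simp_all add: creat_def fun_eq_iff algebra_simps sum_distrib_left)

lemma annihil_linear:
  "annihil i (\<lambda>k. \<psi> k + \<phi> k) = (\<lambda>k. annihil i \<psi> k + annihil i \<phi> k)"
  "annihil i (\<lambda>k. c * \<psi> k) = (\<lambda>k. c * annihil i \<psi> k)"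
  "annihil i (\<lambda>k. if b then \<psi> k else 0) = (\<lambda>k. if b then annihil i \<psi> k else 0)"
  "annihil i (\<lambda>k. \<Sum>j\<in>I. \<psi>' j k) = (\<lambda>k. \<Sum>j\<in>I. annihil i (\<psi>' j) k)"
  by (simp_all add: annihil_def fun_eq_iff algebra_simps sum_distrib_left)

lemma creat_commute: "creat i (creat j \<psi>) = creat j (creat i \<psi>)"
  by (cases "i = j") (auto simp: creat_def fun_eq_iff fun_upd_twist)

lemma annihil_commute: "annihil i (annihil j \<psi>) = annihil j (annihil i \<psi>)"
  by (cases "i = j") (auto simp: annihil_def fun_eq_iff fun_upd_twist)

lemma annihil_creat_commute:
  "annihil i (creat j \<psi>) = (\<lambda>k. creat j (annihil i \<psi>) k + (if i = j then \<psi> k else 0))"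
  using canonical_commutation[of i j \<psi>] by (simp add: fun_eq_iff algebra_simps)

lemma norm_ket_sum2_le:
  assumes "\<And>i j. finite_support (\<psi> i j)" "\<And>i j. norm (ket (\<psi> i j)) \<le> b"
  shows "norm (ket (\<lambda>k. \<Sum>i\<in>I. \<Sum>j\<in>J. c i j * \<psi> i j k)) \<le> (\<Sum>i\<in>I. \<Sum>j\<in>J. cmod (c i j)) * b"
proof -
  have "norm (ket (\<lambda>k. \<Sum>i\<in>I. \<Sum>j\<in>J. c i j * \<psi> i j k))
      \<le> (\<Sum>i\<in>I. norm (ket (\<lambda>k. \<Sum>j\<in>J. c i j * \<psi> i j k)))"
    using assms(1) by (simp add: ket_sum norm_sum)
  also have "\<dots> \<le> (\<Sum>i\<in>I. (\<Sum>j\<in>J. cmod (c i j)) * b)"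
    by (intro sum_mono norm_ket_sum_le assms)
  finally show ?thesis
    by (simp add: sum_distrib_right)
qed

locale quadratic_hamiltonian =
  fixes A B :: "complex^'n^'n" and h :: "complex^'n"
  assumes A_sym: "A $ i $ j = A $ j $ i"
    and B_herm: "cnj (B $ i $ j) = B $ j $ i"
begin

definition X :: "'n state \<Rightarrow> 'n state" where
  "X \<psi> k = \<i> * quadratic_expr A B h \<psi> k"

text \<open>Normal form as a sum of ladder words with scalar coefficients in front; linearity,
  support, degree and norm of \<open>X\<close> are then read off word by word.\<close>

lemma X_eq:
  "X \<psi> = (\<lambda>k. (\<Sum>i\<in>UNIV. \<Sum>j\<in>UNIV. (- A $ i $ j / 2) * creat i (creat j \<psi>) k)
     + (\<Sum>i\<in>UNIV. \<Sum>j\<in>UNIV. (cnj (A $ i $ j) / 2) * annihil i (annihil j \<psi>) k)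
     + (\<Sum>i\<in>UNIV. \<Sum>j\<in>UNIV. (\<i> * B $ i $ j) * creat i (annihil j \<psi>) k)
     + (\<Sum>i\<in>UNIV. - h $ i * creat i \<psi> k)
     + (\<Sum>i\<in>UNIV. cnj (h $ i) * annihil i \<psi> k))"
  by (rule ext) (simp add: X_def quadratic_expr_def sum_negf algebra_simps sum_distrib_left
      flip: sum_divide_distrib)

lemma X_add: "X (\<lambda>k. \<psi> k + \<phi> k) = (\<lambda>k. X \<psi> k + X \<phi> k)"
  unfolding X_eq creat_linear annihil_linear by (simp only: distrib_left sum.distrib add_ac)

lemma X_cmult: "X (\<lambda>k. c * \<psi> k) = (\<lambda>k. c * X \<psi> k)"
  unfolding X_eq creat_linear annihil_linear
  by (simp add: distrib_left sum_distrib_left mult.left_commute)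

lemma finite_support_X [simp]: "finite_support \<psi> \<Longrightarrow> finite_support (X \<psi>)"
  unfolding X_eq
  by (intro finite_support_add finite_support_sum finite_support_cmult
      finite_support_creat finite_support_annihil)

lemma dot_X:
  assumes \<psi>: "finite_support \<psi>"
  shows "dot \<psi> (X \<phi>) = (\<Sum>i\<in>UNIV. \<Sum>j\<in>UNIV. (- A $ i $ j / 2) * dot \<psi> (creat i (creat j \<phi>)))
     + (\<Sum>i\<in>UNIV. \<Sum>j\<in>UNIV. (cnj (A $ i $ j) / 2) * dot \<psi> (annihil i (annihil j \<phi>)))
     + (\<Sum>i\<in>UNIV. \<Sum>j\<in>UNIV. (\<i> * B $ i $ j) * dot \<psi> (creat i (annihil j \<phi>)))
     + (\<Sum>i\<in>UNIV. - h $ i * dot \<psi> (creat i \<phi>))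
     + (\<Sum>i\<in>UNIV. cnj (h $ i) * dot \<psi> (annihil i \<phi>))"
  unfolding X_eq by (simp only: dot_add[OF \<psi>] dot_sum[OF \<psi>] dot_cmult[OF \<psi>])

text \<open>Taking adjoints exchanges the two A-terms and the two h-terms, whose coefficients are
  negative conjugates of each other. The B-term is reproduced with the opposite sign because B is
  Hermitian.\<close>

lemma dot_X_skew:
  assumes "finite_support \<psi>" "finite_support \<phi>"
  shows "dot (X \<psi>) \<phi> = - dot \<psi> (X \<phi>)"
proof -
  have "dot (X \<psi>) \<phi> = cnj (dot \<phi> (X \<psi>))"
    by (simp add: cnj_dot)
  also have "\<dots> = (\<Sum>i\<in>UNIV. \<Sum>j\<in>UNIV. (- cnj (A $ i $ j) / 2) * dot \<psi> (annihil i (annihil j \<phi>)))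
     + (\<Sum>i\<in>UNIV. \<Sum>j\<in>UNIV. (A $ i $ j / 2) * dot \<psi> (creat i (creat j \<phi>)))
     + (\<Sum>i\<in>UNIV. \<Sum>j\<in>UNIV. (- \<i> * B $ j $ i) * dot \<psi> (creat j (annihil i \<phi>)))
     + (\<Sum>i\<in>UNIV. - cnj (h $ i) * dot \<psi> (annihil i \<phi>))
     + (\<Sum>i\<in>UNIV. h $ i * dot \<psi> (creat i \<phi>))"
    unfolding dot_X[OF assms(2)]
    by (simp add: cnj_dot dot_creat_left dot_annihil_left B_herm creat_commute annihil_commute)
  also have "\<dots> = - dot \<psi> (X \<phi>)"
    unfolding dot_X[OF assms(1)]
    \<comment> \<open>The B-terms of the two sides differ by the names of the summation
      indices.\<close>
    by (subst (5) sum.swap) (simp add: sum_negf)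
  finally show ?thesis .
qed

section \<open>Particle number and norm growth of the powers of X\<close>

lemma degree_le_X:
  assumes "degree_le N \<psi>"
  shows "degree_le (N + 2) (X \<psi>)"
proof -
  have c: "degree_le (Suc N) (creat i \<psi>)" and a: "degree_le (Suc N) (annihil i \<psi>)" for i
    using degree_le_creat[OF assms] degree_le_mono[OF degree_le_annihil[OF assms]] by auto
  have 1: "degree_le (N + 2) (creat i \<psi>)" "degree_le (N + 2) (annihil i \<psi>)" for i
    using degree_le_mono[OF c] degree_le_mono[OF a] by auto
  have 2: "degree_le (N + 2) (creat i (creat j \<psi>))" "degree_le (N + 2) (creat i (annihil j \<psi>))"
    "degree_le (N + 2) (annihil i (annihil j \<psi>))" for i j
    using degree_le_creat[OF c] degree_le_creat[OF a] degree_le_mono[OF degree_le_annihil[OF a]] by auto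
  show ?thesis
    unfolding X_eq by (intro degree_le_add degree_le_sum degree_le_cmult 1 2)
qed

text \<open>\<open>C - 1\<close> is the sum of the moduli of all coefficients in
  \<open>X_eq\<close>: the two halved A-terms add up to one, and the h-terms count twice. The extra
  1 keeps \<open>C\<close> positive for the division in \<open>radius\<close>.\<close>

definition C :: real where
  "C = 1 + (\<Sum>i\<in>UNIV. \<Sum>j\<in>UNIV. cmod (A $ i $ j) + cmod (B $ i $ j)) + 2 * (\<Sum>i\<in>UNIV. cmod (h $ i))"

lemma C_ge_1: "C \<ge> 1"
  unfolding C_def by (simp add: add_increasing2 sum_nonneg)

text \<open>A word of length two costs at most sqrt (N + 1) sqrt (N + 2), which is at most N + 2;
  shorter words cost less.\<close>

lemma norm_X_le:
  assumes "degree_le N \<psi>"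
  shows "norm (ket (X \<psi>)) \<le> C * real (N + 2) * norm (ket \<psi>)"
proof -
  let ?b = "real (N + 2) * norm (ket \<psi>)"
  have \<psi>: "finite_support \<psi>"
    using assms by (rule degree_le_finite_support)
  have sqrt_le: "sqrt (real (Suc M)) \<le> real (Suc M)" for M
    by (rule real_le_lsqrt) (simp_all add: power2_eq_square)
  have one: "sqrt (Suc N) * norm (ket \<psi>) \<le> ?b"
  proof (rule mult_right_mono)
    show "sqrt (Suc N) \<le> real (N + 2)"
      using sqrt_le[of N] by simp
  qed simp
  have two: "sqrt (Suc (Suc N)) * (sqrt (Suc N) * norm (ket \<psi>)) \<le> ?b"
  proof -
    have "sqrt (Suc (Suc N)) * sqrt (Suc N) \<le> sqrt (Suc (Suc N)) * sqrt (Suc (Suc N))"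
      by (intro mult_left_mono) auto
    then have "sqrt (Suc (Suc N)) * sqrt (Suc N) \<le> real (N + 2)"
      by simp
    then show ?thesis
      unfolding mult.assoc[symmetric] by (rule mult_right_mono) simp
  qed
  have first: "norm (ket (creat i \<psi>)) \<le> ?b" "norm (ket (annihil i \<psi>)) \<le> ?b" for i
    using norm_creat_le[OF assms, of i] norm_annihil_le[OF assms, of i] one by linarith+
  have second_aux: "x \<le> ?b"
    if "x \<le> sqrt (Suc (Suc N)) * y" "y \<le> sqrt (Suc N) * norm (ket \<psi>)" for x y
  proof -
    have "sqrt (Suc (Suc N)) * y \<le> sqrt (Suc (Suc N)) * (sqrt (Suc N) * norm (ket \<psi>))"
      using that(2) by (intro mult_left_mono) auto
    then show ?thesis
      using that(1) two by linarith
  qed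
  have a_deg: "degree_le (Suc N) (annihil j \<psi>)" for j
    using degree_le_mono[OF degree_le_annihil[OF assms]] by simp
  have second: "norm (ket (creat i (creat j \<psi>))) \<le> ?b" "norm (ket (annihil i (annihil j \<psi>))) \<le> ?b"
    "norm (ket (creat i (annihil j \<psi>))) \<le> ?b" for i j
    using second_aux[OF norm_creat_le[OF degree_le_creat[OF assms]] norm_creat_le[OF assms]]
      second_aux[OF norm_annihil_le[OF a_deg] norm_annihil_le[OF assms]]
      second_aux[OF norm_creat_le[OF a_deg] norm_annihil_le[OF assms]] by blast+
  have tri: "norm (ket (\<lambda>k. \<psi>1 k + \<psi>2 k)) \<le> a + b"
    if "finite_support \<psi>1" "finite_support \<psi>2" "norm (ket \<psi>1) \<le> a" "norm (ket \<psi>2) \<le> b"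
    for \<psi>1 \<psi>2 :: "'n state" and a b
    using norm_triangle_ineq[of "ket \<psi>1" "ket \<psi>2"] that by (simp add: ket_add)
  have "norm (ket (X \<psi>)) \<le> (\<Sum>i\<in>UNIV. \<Sum>j\<in>UNIV. cmod (- A $ i $ j / 2)) * ?b
      + (\<Sum>i\<in>UNIV. \<Sum>j\<in>UNIV. cmod (cnj (A $ i $ j) / 2)) * ?b
      + (\<Sum>i\<in>UNIV. \<Sum>j\<in>UNIV. cmod (\<i> * B $ i $ j)) * ?b
      + (\<Sum>i\<in>UNIV. cmod (- h $ i)) * ?b + (\<Sum>i\<in>UNIV. cmod (cnj (h $ i))) * ?b"
    unfolding X_eq
    by (intro tri norm_ket_sum2_le norm_ket_sum_le first second finite_support_add finite_support_sum
        finite_support_cmult finite_support_creat finite_support_annihil \<psi>)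
  also have "\<dots> = (C - 1) * ?b"
    by (simp add: C_def sum.distrib norm_divide norm_mult algebra_simps flip: sum_divide_distrib)
  also have "\<dots> \<le> C * ?b"
    by (intro mult_right_mono) auto
  finally show ?thesis
    by (simp add: mult.assoc)
qed

lemma finite_support_X_power: "finite_support \<psi> \<Longrightarrow> finite_support ((X ^^ k) \<psi>)"
  by (induction k) auto

lemma degree_le_X_power: "degree_le N \<psi> \<Longrightarrow> degree_le (N + 2 * k) ((X ^^ k) \<psi>)"
  using degree_le_X by (induction k) fastforce+

text \<open>The product of the successive bounds of \<open>norm_X_le\<close>, the degree rising by 2
  with each application.\<close>

definition growth :: "nat \<Rightarrow> nat \<Rightarrow> real" where
  "growth N k = (\<Prod>j<k. C * real (N + 2 * j + 2))"

lemma norm_X_power_le: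
  assumes "degree_le N \<psi>"
  shows "norm (ket ((X ^^ k) \<psi>)) \<le> growth N k * norm (ket \<psi>)"
proof (induction k)
  case (Suc k)
  have "norm (ket ((X ^^ Suc k) \<psi>)) \<le> C * real (N + 2 * k + 2) * norm (ket ((X ^^ k) \<psi>))"
    using norm_X_le[OF degree_le_X_power[OF assms, of k]] by simp
  also have "\<dots> \<le> C * real (N + 2 * k + 2) * (growth N k * norm (ket \<psi>))"
    using C_ge_1 by (intro mult_left_mono Suc) auto
  finally show ?case
    by (simp add: growth_def mult_ac)
qed (simp add: growth_def)

text \<open>The product telescopes. A functional that is bounded only up to a factor linear in the
  degree thus costs no more than replacing N by N + 2.\<close>

lemma growth_shift: "real (N + 2 * k + 2) * growth N k = real (N + 2) * growth (N + 2) k"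
proof (induction k)
  case (Suc k)
  have "real (N + 2 * Suc k + 2) * growth N (Suc k)
      = C * real (N + 2 * Suc k + 2) * (real (N + 2 * k + 2) * growth N k)"
    by (simp add: growth_def)
  also have "\<dots> = real (N + 2) * growth (N + 2) (Suc k)"
    unfolding Suc by (simp add: growth_def add_ac)
  finally show ?case .
qed (simp add: growth_def)

text \<open>\<open>growth N k\<close> behaves like (2 C)^k k! up to powers of k, so the exponential
  series has radius 1 / (2 C); half of it leaves room in the ratio test.\<close>

definition radius :: real where
  "radius = 1 / (4 * C)"

lemma radius_pos: "radius > 0"
  using C_ge_1 by (simp add: radius_def)

lemma growth_nonneg: "growth N k \<ge> 0"
  unfolding growth_def using C_ge_1 by (intro prod_nonneg) auto

lemma summable_growth: "summable (\<lambda>k. radius ^ k / fact k * growth N k)"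
proof (rule summable_ratio_test)
  fix k assume "k \<ge> N"
  have "radius ^ Suc k / fact (Suc k) * growth N (Suc k)
      = (radius * C * real (N + 2 * k + 2) / real (Suc k)) * (radius ^ k / fact k * growth N k)"
    by (simp add: growth_def field_simps)
  also have "\<dots> \<le> 3 / 4 * (radius ^ k / fact k * growth N k)"
  proof (rule mult_right_mono)
    \<comment> \<open>For k at least N the ratio is (N + 2 k + 2) / (4 (k + 1)), at most (3 k + 2) /
      (4 k + 4).\<close>
    have "radius * C = 1 / 4"
      using C_ge_1 by (simp add: radius_def)
    then show "radius * C * real (N + 2 * k + 2) / real (Suc k) \<le> 3 / 4"
      using \<open>k \<ge> N\<close> by (simp add: field_simps)
  qed (use radius_pos growth_nonneg in simp)
  finally show "norm (radius ^ Suc k / fact (Suc k) * growth N (Suc k))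
      \<le> 3 / 4 * norm (radius ^ k / fact k * growth N k)"
    using radius_pos growth_nonneg[of N] by (simp add: abs_mult)
qed simp

end

section \<open>The unitary group of the Hamiltonian\<close>

lemma isometry_group_of_unitary_group:
  assumes "unitary_group U"
  shows "isometry_group U"
proof -
  have scaleR: "r *\<^sub>R x = scaleC_ell2 (of_real r) x" for r and x :: "'a ell2"
    by (rule ell2_eqI) (simp add: coeff_ell2_simps scaleR_conv_of_real)
  have "linear (U t)" for t
    using assms by (intro linearI) (auto simp: unitary_group_def scaleR)
  moreover have "norm (U t x) = norm x" for t x
  proof -
    have "inner (U t x) (U t x) = inner x x"
      using assms by (metis unitary_group_def cinner_ell2_eq_inner complex.sel(1))
    then show ?thesis
      by (simp add: norm_eq_sqrt_inner)
  qed
  ultimately show ?thesis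
    using assms unfolding isometry_group_def unitary_group_def by blast
qed

lemma unitary_group_of_isometry_group:
  assumes U: "isometry_group U" and scaleC: "\<And>t c x. U t (scaleC_ell2 c x) = scaleC_ell2 c (U t x)"
  shows "unitary_group U"
proof -
  have "cinner_ell2 (U t x) (U t y) = cinner_ell2 x y" for t x y
    unfolding cinner_ell2_eq_inner by (simp add: inner_isometry_group[OF U] flip: scaleC)
  moreover have "U t (x + y) = U t x + U t y" for t x y
    using U by (simp add: isometry_group_def linear_add)
  ultimately show ?thesis
    using U scaleC unfolding isometry_group_def unitary_group_def by blast
qed

lemma group_generator_eq_stone_generator:
  "(x, z) \<in> group_generator U \<longleftrightarrow> (x, scaleC_ell2 (- \<i>) z) \<in> stone_generator U"
  by (simp add: group_generator_def stone_generator_def scaleC_ell2_simps)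

context quadratic_hamiltonian
begin

definition fock_op :: "'n fock \<Rightarrow> 'n fock" where
  "fock_op x = ket (X (coeff_ell2 x))"

lemma ket_in_finite_particle: "finite_support \<psi> \<Longrightarrow> ket \<psi> \<in> finite_particle"
  by (simp add: finite_particle_iff)

lemma fock_op_in_finite_particle: "x \<in> finite_particle \<Longrightarrow> fock_op x \<in> finite_particle"
  by (simp add: fock_op_def finite_particle_iff)

lemma fock_op_power:
  assumes "x \<in> finite_particle"
  shows "(fock_op ^^ k) x = ket ((X ^^ k) (coeff_ell2 x))"
  using assms by (induction k) (simp_all add: fock_op_def finite_particle_iff finite_support_X_power)

lemma fock_op_scaleC:
  assumes "x \<in> finite_particle"
  shows "fock_op (scaleC_ell2 c x) = scaleC_ell2 c (fock_op x)"
proof -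
  have "coeff_ell2 (scaleC_ell2 c x) = (\<lambda>k. c * coeff_ell2 x k)"
    by (simp add: fun_eq_iff coeff_ell2_simps)
  then show ?thesis
    using assms by (simp add: fock_op_def X_cmult ket_cmult finite_particle_iff)
qed

lemma scaleC_in_finite_particle: "x \<in> finite_particle \<Longrightarrow> scaleC_ell2 c x \<in> finite_particle"
  unfolding finite_particle_def by (auto elim: finite_subset[rotated] simp: coeff_ell2_simps)

lemma scaleR_eq_scaleC: "r *\<^sub>R x = scaleC_ell2 (of_real r) x"
  by (rule ell2_eqI) (simp add: coeff_ell2_simps scaleR_conv_of_real)

lemma subspace_finite_particle: "subspace (finite_particle :: 'n fock set)"
proof (rule subspaceI)
  fix x y :: "'n fock" assume "x \<in> finite_particle" "y \<in> finite_particle"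
  then show "x + y \<in> finite_particle"
    using finite_support_add[of "coeff_ell2 x" "coeff_ell2 y"]
    by (simp add: finite_particle_iff coeff_ell2_simps[abs_def])
qed (simp_all add: scaleR_eq_scaleC scaleC_in_finite_particle finite_particle_def coeff_ell2_simps)

sublocale analytic_skew_operator finite_particle fock_op radius
proof
  show "subspace (finite_particle :: 'n fock set)" "closure finite_particle = (UNIV :: 'n fock set)"
    by (rule subspace_finite_particle closure_finite_particle)+
  show "fock_op x \<in> finite_particle" if "x \<in> finite_particle" for x
    using that by (rule fock_op_in_finite_particle)
  show "fock_op (c *\<^sub>R x) = c *\<^sub>R fock_op x" if "x \<in> finite_particle" for c x
    using that by (simp add: scaleR_eq_scaleC fock_op_scaleC)
  show "fock_op (x + y) = fock_op x + fock_op y" if "x \<in> finite_particle" "y \<in> finite_particle" for x y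
    using that by (simp add: fock_op_def finite_particle_iff coeff_ell2_simps[abs_def] X_add ket_add)
  show "inner (fock_op x) y = - inner x (fock_op y)" if "x \<in> finite_particle" "y \<in> finite_particle" for x y
  proof -
    have "cinner_ell2 (fock_op x) (ket (coeff_ell2 y)) = - cinner_ell2 (ket (coeff_ell2 x)) (fock_op y)"
      using that unfolding fock_op_def finite_particle_iff by (simp only: cinner_ket finite_support_X dot_X_skew)
    then show ?thesis
      by (simp add: cinner_ell2_eq_inner complex_eq_iff)
  qed
  show "radius > 0"
    by (rule radius_pos)
  show "summable (\<lambda>k. radius ^ k / fact k * norm ((fock_op ^^ k) x))" if x: "x \<in> finite_particle" for x
  proof -
    obtain N where N: "degree_le N (coeff_ell2 x)"
      using x ex_degree_le finite_particle_iff by metis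
    show ?thesis
    proof (rule summable_comparison_test'[where N = 0])
      show "summable (\<lambda>k. (radius ^ k / fact k * growth N k) * norm x)"
        by (intro summable_mult2 summable_growth)
      show "norm (radius ^ k / fact k * norm ((fock_op ^^ k) x)) \<le> (radius ^ k / fact k * growth N k) * norm x" for k
        using norm_X_power_le[OF N, of k] radius_pos
        by (simp add: fock_op_power[OF x] mult_left_mono divide_right_mono mult.assoc)
    qed
  qed
qed

text \<open>The abstract construction is only real-linear. Each power of \<open>fock_op\<close>
  commutes with complex scalars, hence so do the series and, by density, its extension.\<close>

lemma local_exp_scaleC:
  assumes t: "\<bar>t\<bar> < radius"
  shows "local_exp t (scaleC_ell2 c x) = scaleC_ell2 c (local_exp t x)"
proof (rule dense_induct[OF closure_finite_particle, where x = x])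
  show "closed {x. local_exp t (scaleC_ell2 c x) = scaleC_ell2 c (local_exp t x)}"
    using continuous_local_exp_compose[OF t linear_continuous_on[OF bounded_linear_scaleC_ell2]]
      bounded_linear.continuous_on[OF bounded_linear_scaleC_ell2 continuous_local_exp[OF t]]
    by (rule closed_Collect_eq)
  fix x :: "'n fock" assume x: "x \<in> finite_particle"
  have "(fock_op ^^ k) (scaleC_ell2 c x) = scaleC_ell2 c ((fock_op ^^ k) x)" for k
    by (induction k) (simp_all add: fock_op_scaleC power_maps x)
  then have "exp_series t (scaleC_ell2 c x) = scaleC_ell2 c (exp_series t x)"
    unfolding exp_series_def
    using bounded_linear.suminf[OF bounded_linear_scaleC_ell2, OF summable_exp_series[of t x]] t x
    by (simp add: scaleC_ell2_simps)
  then show "local_exp t (scaleC_ell2 c x) = scaleC_ell2 c (local_exp t x)"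
    using x by (simp add: local_exp_eq[OF t] scaleC_in_finite_particle)
qed

lemma global_exp_scaleC: "global_exp t (scaleC_ell2 c x) = scaleC_ell2 c (global_exp t x)"
proof -
  obtain n where n: "n > 0" "\<bar>t\<bar> + \<bar>0\<bar> < radius * real n"
    by (rule ex_step)
  then have small: "\<bar>t / real n\<bar> < radius"
    by (simp add: field_simps)
  have "(local_exp (t / real n) ^^ k) (scaleC_ell2 c x) = scaleC_ell2 c ((local_exp (t / real n) ^^ k) x)" for k
    by (induction k) (simp_all add: local_exp_scaleC[OF small])
  then show ?thesis
    by (simp add: global_exp_eq[OF n(1) small])
qed

text \<open>Multiplying the second component by i is a homeomorphism that carries the graph of the
  quadratic expression onto the graph of \<open>fock_op\<close>, hence closure onto closure; the two
  inclusions use this map and its inverse.\<close>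

lemma hamiltonian_iff: "(x, y) \<in> hamiltonian A B h \<longleftrightarrow> (x, scaleC_ell2 \<i> y) \<in> closed_graph"
proof -
  let ?S = "{(x, y). x \<in> finite_particle \<and> coeff_ell2 y = quadratic_expr A B h (coeff_ell2 x)}"
  let ?T = "{(x, fock_op x) | x. x \<in> finite_particle}"
  let ?g = "\<lambda>c w. (fst w, scaleC_ell2 c (snd w)) :: 'n fock \<times> 'n fock"
  have cont: "continuous_on S (?g c)" for c S
    by (intro continuous_on_Pair bounded_linear.continuous_on[OF bounded_linear_scaleC_ell2]
        continuous_intros)
  have "?g \<i> ` closure ?S \<subseteq> closure ?T"
  proof (rule image_closure_subset[OF cont closed_closure])
    have "scaleC_ell2 \<i> y = fock_op x" if "(x, y) \<in> ?S" for x y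
    proof (rule ell2_eqI)
      fix k
      show "coeff_ell2 (scaleC_ell2 \<i> y) k = coeff_ell2 (fock_op x) k"
        using that by (simp add: fock_op_def finite_particle_iff X_def coeff_ell2_simps)
    qed
    then have "?g \<i> ` ?S \<subseteq> ?T"
      by auto
    then show "?g \<i> ` ?S \<subseteq> closure ?T"
      using closure_subset by blast
  qed
  moreover have "?g (- \<i>) ` closure ?T \<subseteq> closure ?S"
  proof (rule image_closure_subset[OF cont closed_closure])
    have "coeff_ell2 (scaleC_ell2 (- \<i>) (fock_op x)) = quadratic_expr A B h (coeff_ell2 x)"
      if "x \<in> finite_particle" for x
      using that by (simp add: fun_eq_iff fock_op_def finite_particle_iff X_def coeff_ell2_simps)
    then have "?g (- \<i>) ` ?T \<subseteq> ?S"
      by auto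
    then show "?g (- \<i>) ` ?T \<subseteq> closure ?S"
      using closure_subset by blast
  qed
  ultimately have "(x, y) \<in> closure ?S \<longleftrightarrow> (x, scaleC_ell2 \<i> y) \<in> closure ?T"
    by (force simp: scaleC_ell2_simps image_subset_iff)
  then show ?thesis
    by (simp add: hamiltonian_def closed_graph_def)
qed

lemma unitary_group_global_exp: "unitary_group global_exp"
  by (rule unitary_group_of_isometry_group[OF isometry_group_global_exp global_exp_scaleC])

lemma stone_generator_iff:
  "stone_generator U = hamiltonian A B h \<longleftrightarrow> group_generator U = closed_graph"
proof
  assume *: "stone_generator U = hamiltonian A B h"
  have "(x, z) \<in> group_generator U \<longleftrightarrow> (x, z) \<in> closed_graph" for x z
    unfolding group_generator_eq_stone_generator * hamiltonian_iff by (simp add: scaleC_ell2_simps)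
  then show "group_generator U = closed_graph"
    by auto
next
  assume *: "group_generator U = closed_graph"
  have "(x, y) \<in> stone_generator U \<longleftrightarrow> (x, scaleC_ell2 \<i> y) \<in> group_generator U" for x y
    unfolding group_generator_eq_stone_generator by (simp add: scaleC_ell2_simps)
  then show "stone_generator U = hamiltonian A B h"
    unfolding * hamiltonian_iff[symmetric] by auto
qed

theorem exp_i_hamiltonian: "exp_i (hamiltonian A B h) = global_exp"
  unfolding exp_i_def
proof (rule the_equality)
  show "unitary_group global_exp \<and> stone_generator global_exp = hamiltonian A B h"
    by (simp add: unitary_group_global_exp stone_generator_iff group_generator_global_exp)
  fix U assume U: "unitary_group U \<and> stone_generator U = hamiltonian A B h"
  show "U = global_exp"
  proof (rule isometry_group_unique)
    show "isometry_group U" "isometry_group global_exp"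
      using U isometry_group_of_unitary_group isometry_group_global_exp by auto
    show gen: "group_generator U = group_generator global_exp"
      using U by (simp add: stone_generator_iff group_generator_global_exp)
    have "finite_particle \<subseteq> fst ` group_generator U"
      using graph_subset by (force simp: gen group_generator_global_exp)
    then show "closure (fst ` group_generator U) = UNIV"
      using closure_mono closure_finite_particle by blast
  qed
qed

text \<open>The row vector obtained from the vacuum and the evolution, as a functional on states. It
  is phrased with \<open>exp_i\<close>, so that its value at the vacuum is the amplitude in
  question.\<close>

definition vac_functional :: "real \<Rightarrow> 'n state \<Rightarrow> complex" where
  "vac_functional t \<psi> = cinner_ell2 vacuum (exp_i (hamiltonian A B h) t (ket \<psi>))"

lemma bounded_linear_vac: "bounded_linear (\<lambda>x. cinner_ell2 vacuum (global_exp t x))"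
  using bounded_linear_compose[OF bounded_linear_cinner_ell2_right
      bounded_linear_isometry_group[OF isometry_group_global_exp]] .

lemma vac_functional_add:
  "finite_support \<psi> \<Longrightarrow> finite_support \<phi> \<Longrightarrow>
    vac_functional t (\<lambda>k. \<psi> k + \<phi> k) = vac_functional t \<psi> + vac_functional t \<phi>"
  by (simp add: vac_functional_def exp_i_hamiltonian ket_add
      linear_add[OF bounded_linear.linear[OF bounded_linear_vac]])

lemma vac_functional_cmult:
  "finite_support \<psi> \<Longrightarrow> vac_functional t (\<lambda>k. c * \<psi> k) = c * vac_functional t \<psi>"
  by (simp add: vac_functional_def exp_i_hamiltonian ket_cmult global_exp_scaleC cinner_ell2_scaleC_right)

lemma vac_functional_sum:
  "(\<And>i. i \<in> I \<Longrightarrow> finite_support (\<psi> i)) \<Longrightarrow>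
    vac_functional t (\<lambda>k. \<Sum>i\<in>I. \<psi> i k) = (\<Sum>i\<in>I. vac_functional t (\<psi> i))"
  by (simp add: vac_functional_def exp_i_hamiltonian ket_sum
      linear_sum[OF bounded_linear.linear[OF bounded_linear_vac]])

lemma vac_functional_0:
  assumes "finite_support \<psi>"
  shows "vac_functional 0 \<psi> = \<psi> (\<lambda>_. 0)"
proof -
  have "finite_support (coeff_ell2 (vacuum :: 'n fock))"
    by (simp add: finite_support_def vacuum.rep_eq)
  then have "vac_functional 0 \<psi> = dot (coeff_ell2 vacuum) \<psi>"
    using assms cinner_ket[of "coeff_ell2 vacuum" \<psi>]
    by (simp add: vac_functional_def exp_i_hamiltonian global_exp_0)
  also have "\<dots> = (\<Sum>k\<in>{\<lambda>_. 0}. cnj (coeff_ell2 vacuum k) * \<psi> k)"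
    by (rule dot_eq_sum) (auto simp: vacuum.rep_eq)
  finally show ?thesis
    by (simp add: vacuum.rep_eq)
qed

lemma norm_vac_functional_le: "cmod (vac_functional t \<psi>) \<le> norm (vacuum :: 'n fock) * norm (ket \<psi>)"
  using norm_cinner_ell2_le[of vacuum "global_exp t (ket \<psi>)"]
  by (simp add: vac_functional_def exp_i_hamiltonian norm_global_exp)

lemma vac_functional_derivative:
  assumes "finite_support \<psi>"
  shows "((\<lambda>t. vac_functional t \<psi>) has_vector_derivative vac_functional t (X \<psi>)) (at t)"
proof -
  have "(ket \<psi>, fock_op (ket \<psi>)) \<in> group_generator global_exp"
    unfolding group_generator_global_exp using assms by (intro graph_subset ket_in_finite_particle)
  from bounded_linear.has_vector_derivative[OF bounded_linear_cinner_ell2_right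
      group_generator_derivative[OF isometry_group_global_exp this]]
  show ?thesis
    using assms by (simp add: vac_functional_def exp_i_hamiltonian fock_op_def)
qed

end

section \<open>Heisenberg evolution of the ladder operators\<close>

lemma sum_UNIV_Plus: "(\<Sum>p\<in>UNIV. f p) = (\<Sum>i\<in>UNIV. f (Inl i)) + (\<Sum>i\<in>UNIV. f (Inr i))"
  for f :: "'a::finite + 'b::finite \<Rightarrow> 'c::comm_monoid_add"
  by (simp add: sum.Plus flip: UNIV_Plus_UNIV)

lemma sum_mult_delta:
  fixes c :: "'n::finite \<Rightarrow> 'n \<Rightarrow> complex" and c' f :: "'n \<Rightarrow> complex"
  shows "(\<Sum>i\<in>UNIV. \<Sum>l\<in>UNIV. c i l * (if i = j then f l else 0)) = (\<Sum>l\<in>UNIV. c j l * f l)"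
    and "(\<Sum>i\<in>UNIV. \<Sum>l\<in>UNIV. c i l * (if l = j then f i else 0)) = (\<Sum>i\<in>UNIV. c i j * f i)"
    and "(\<Sum>i\<in>UNIV. c' i * (if i = j then x else 0)) = c' j * x"
  by (subst sum.swap) (simp_all add: if_distrib[of "\<lambda>y. z * y" for z] cong: if_cong)

text \<open>The index type matches the blocks of \<open>G_mat\<close>: \<open>Inl\<close> for
  annihilation, \<open>Inr\<close> for creation.\<close>

definition ladder :: "'n + 'n \<Rightarrow> 'n state \<Rightarrow> 'n state" where
  "ladder p \<psi> = (case p of Inl i \<Rightarrow> annihil i \<psi> | Inr i \<Rightarrow> creat i \<psi>)"

lemma finite_support_ladder [simp]: "finite_support \<psi> \<Longrightarrow> finite_support (ladder p \<psi>)"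
  by (cases p) (simp_all add: ladder_def)

lemma norm_ladder_le: "degree_le N \<psi> \<Longrightarrow> norm (ket (ladder p \<psi>)) \<le> sqrt (Suc N) * norm (ket \<psi>)"
  by (cases p) (simp_all add: ladder_def norm_creat_le norm_annihil_le del: of_nat_Suc)

context quadratic_hamiltonian
begin

text \<open>Moving \<open>creat j\<close> to the left through two annihilators leaves two
  contractions. Symmetry of A makes them equal, which cancels the factor 1/2.\<close>

lemma X_creat:
  "X (creat j \<psi>) = (\<lambda>k. creat j (X \<psi>) k + (\<Sum>l\<in>UNIV. cnj (A $ j $ l) * annihil l \<psi> k)
     + (\<Sum>i\<in>UNIV. \<i> * B $ i $ j * creat i \<psi> k) + cnj (h $ j) * \<psi> k)"
proof
  fix k
  have 1: "creat i (creat l (creat j \<psi>)) = creat j (creat i (creat l \<psi>))" for i l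
    by (metis creat_commute)
  have 2: "annihil i (annihil l (creat j \<psi>)) = (\<lambda>k. creat j (annihil i (annihil l \<psi>)) k
      + (if i = j then annihil l \<psi> k else 0) + (if l = j then annihil i \<psi> k else 0))" for i l
    by (simp add: annihil_creat_commute annihil_linear)
  have 3: "creat i (annihil l (creat j \<psi>)) = (\<lambda>k. creat j (creat i (annihil l \<psi>)) k
      + (if l = j then creat i \<psi> k else 0))" for i l
    by (simp add: annihil_creat_commute creat_linear creat_commute[of i j])
  have sym: "(\<Sum>i\<in>UNIV. cnj (A $ i $ j) / 2 * annihil i \<psi> k) = (\<Sum>l\<in>UNIV. cnj (A $ j $ l) / 2 * annihil l \<psi> k)"
    by (simp add: A_sym[of _ j])
  have half: "(\<Sum>l\<in>UNIV. cnj (A $ j $ l) * annihil l \<psi> k)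
      = (\<Sum>l\<in>UNIV. cnj (A $ j $ l) / 2 * annihil l \<psi> k) + (\<Sum>l\<in>UNIV. cnj (A $ j $ l) / 2 * annihil l \<psi> k)"
    unfolding sum.distrib[symmetric] by (rule sum.cong) (simp_all add: field_simps)
  show "X (creat j \<psi>) k = creat j (X \<psi>) k + (\<Sum>l\<in>UNIV. cnj (A $ j $ l) * annihil l \<psi> k)
     + (\<Sum>i\<in>UNIV. \<i> * B $ i $ j * creat i \<psi> k) + cnj (h $ j) * \<psi> k"
    unfolding X_eq creat_linear 2 3
    unfolding 1 annihil_creat_commute[of _ j] creat_commute[of _ j] half
    by (simp only: distrib_left sum.distrib sum_mult_delta sym add_ac)
qed

text \<open>Here the right side is normal ordered: \<open>annihil j\<close> passes the creators
  inside \<open>X \<psi>\<close>, and the contractions cancel against the explicit terms, which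
  therefore carry the opposite sign.\<close>

lemma X_annihil:
  "X (annihil j \<psi>) = (\<lambda>k. annihil j (X \<psi>) k + (\<Sum>l\<in>UNIV. A $ j $ l * creat l \<psi> k)
     + (\<Sum>l\<in>UNIV. - \<i> * B $ j $ l * annihil l \<psi> k) + h $ j * \<psi> k)"
proof
  fix k
  have 1: "annihil j (annihil i (annihil l \<psi>)) = annihil i (annihil l (annihil j \<psi>))" for i l
    by (metis annihil_commute)
  have if_sym: "(if j = i then x else 0) = (if i = j then x else 0)" for i and x :: complex
    by auto
  have 2: "annihil j (creat i (creat l \<psi>)) = (\<lambda>k. creat i (creat l (annihil j \<psi>)) k
      + (if i = j then creat l \<psi> k else 0) + (if l = j then creat i \<psi> k else 0))" for i l
    by (auto simp: annihil_creat_commute creat_linear fun_eq_iff)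
  have 3: "annihil j (creat i (annihil l \<psi>)) = (\<lambda>k. creat i (annihil l (annihil j \<psi>)) k
      + (if i = j then annihil l \<psi> k else 0))" for i l
    by (auto simp: annihil_creat_commute fun_eq_iff annihil_commute[of j l])
  have 4: "annihil j (creat i \<psi>) = (\<lambda>k. creat i (annihil j \<psi>) k + (if i = j then \<psi> k else 0))" for i
    by (auto simp: annihil_creat_commute)
  have sym: "(\<Sum>i\<in>UNIV. - A $ i $ j / 2 * creat i \<psi> k) = (\<Sum>l\<in>UNIV. - A $ j $ l / 2 * creat l \<psi> k)"
    by (simp add: A_sym[of _ j])
  have half: "(\<Sum>l\<in>UNIV. A $ j $ l * creat l \<psi> k)
      = - ((\<Sum>l\<in>UNIV. - A $ j $ l / 2 * creat l \<psi> k) + (\<Sum>l\<in>UNIV. - A $ j $ l / 2 * creat l \<psi> k))"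
    unfolding sum.distrib[symmetric] sum_negf[symmetric]
    by (rule sum.cong) (simp_all add: field_simps)
  have neg: "(\<Sum>l\<in>UNIV. - \<i> * B $ j $ l * annihil l \<psi> k) = - (\<Sum>l\<in>UNIV. \<i> * B $ j $ l * annihil l \<psi> k)"
    by (simp add: sum_negf)
  show "X (annihil j \<psi>) k = annihil j (X \<psi>) k + (\<Sum>l\<in>UNIV. A $ j $ l * creat l \<psi> k)
     + (\<Sum>l\<in>UNIV. - \<i> * B $ j $ l * annihil l \<psi> k) + h $ j * \<psi> k"
    unfolding X_eq annihil_linear 1 2 3 4 annihil_commute[of j] half neg
    by (simp only: distrib_left sum.distrib sum_mult_delta sym) simp
qed

lemma X_ladder:
  "X (ladder p \<psi>) = (\<lambda>k. ladder p (X \<psi>) k + (\<Sum>q\<in>UNIV. G_mat A B $ p $ q * ladder q \<psi> k)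
     + doubled h $ p * \<psi> k)"
proof (cases p)
  case (Inl j)
  then show ?thesis
    by (simp add: ladder_def X_annihil sum_UNIV_Plus G_mat_def doubled_def algebra_simps)
next
  case (Inr j)
  then show ?thesis
    by (simp add: ladder_def X_creat sum_UNIV_Plus G_mat_def doubled_def B_herm add.assoc)
qed

text \<open>Taylor's formula at \<open>s\<close> has only the remainder \<open>u ^ n / fact n * M _ ((X ^^ n) \<psi>)\<close>, which the
  growth bounds force to \<open>0\<close> within a radius that does not depend on \<open>s\<close>.\<close>

lemma evolving_functional_eq_0:
  fixes M :: "real \<Rightarrow> 'n state \<Rightarrow> complex"
  assumes deriv: "\<And>\<psi> t. finite_support \<psi> \<Longrightarrow> ((\<lambda>t. M t \<psi>) has_vector_derivative M t (X \<psi>)) (at t)"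
    and bound: "\<And>T. \<exists>K. \<forall>t \<psi> N. \<bar>t\<bar> \<le> T \<longrightarrow> degree_le N \<psi> \<longrightarrow>
        cmod (M t \<psi>) \<le> K * real (N + 2) * norm (ket \<psi>)"
    and init: "\<And>\<psi>. finite_support \<psi> \<Longrightarrow> M 0 \<psi> = 0"
    and \<psi>: "finite_support \<psi>"
  shows "M t \<psi> = 0"
proof -
  have step: "M (s + u) \<psi> = 0"
    if s: "\<And>\<psi>. finite_support \<psi> \<Longrightarrow> M s \<psi> = 0" and u: "\<bar>u\<bar> \<le> radius" and \<psi>: "finite_support \<psi>"
    for s u :: real and \<psi> :: "'n state"
  proof -
    obtain N where N: "degree_le N \<psi>"
      by (rule ex_degree_le[OF \<psi>])
    obtain K where K: "\<And>t \<psi> N. \<bar>t\<bar> \<le> \<bar>s\<bar> + radius \<Longrightarrow> degree_le N \<psi> \<Longrightarrow>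
        cmod (M t \<psi>) \<le> K * real (N + 2) * norm (ket \<psi>)"
      using bound[of "\<bar>s\<bar> + radius"] by blast
    \<comment> \<open>Taylor's formula with a single remainder term is a real statement; the factors
      1 and \<open>\<i>\<close> for \<open>c\<close> recover the complex value.\<close>
    have "Re (c * M (s + u) \<psi>) = 0" if c: "cmod c = 1" for c
    proof -
      define diff where "diff m x = Re (c * M (s + x) ((X ^^ m) \<psi>))" for m x
      have D: "\<forall>m x. DERIV (diff m) x :> diff (Suc m) x"
      proof (intro allI)
        fix m x
        have "((\<lambda>x. s + x) has_vector_derivative 1) (at x)"
          by (auto intro!: derivative_eq_intros)
        from vector_diff_chain_at[OF this deriv[OF finite_support_X_power[OF \<psi>, of m]]]
        have "((\<lambda>x. M (s + x) ((X ^^ m) \<psi>)) has_vector_derivative M (s + x) (X ((X ^^ m) \<psi>))) (at x)"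
          by (simp add: o_def)
        from bounded_linear.has_vector_derivative[OF bounded_linear_compose[OF bounded_linear_Re bounded_linear_mult_right] this]
        show "DERIV (diff m) x :> diff (Suc m) x"
          by (simp add: diff_def[abs_def] has_real_derivative_iff_has_vector_derivative)
      qed
      have "\<bar>diff 0 u\<bar> \<le> (radius ^ n / fact n * growth (N + 2) n) * (\<bar>K\<bar> * real (N + 2) * norm (ket \<psi>))" for n
      proof -
        have "diff m 0 = 0" for m
          by (simp add: diff_def s finite_support_X_power \<psi>)
        then obtain x where x: "\<bar>x\<bar> \<le> \<bar>u\<bar>" "diff 0 u = diff n x / fact n * u ^ n"
          using Maclaurin_all_le[of diff "diff 0" u n, OF refl D] by auto
        have "\<bar>diff n x\<bar> \<le> cmod (M (s + x) ((X ^^ n) \<psi>))"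
          unfolding diff_def using abs_Re_le_cmod[of "c * M (s + x) ((X ^^ n) \<psi>)"] c
          by (simp add: norm_mult)
        also have "\<dots> \<le> K * real (N + 2 * n + 2) * norm (ket ((X ^^ n) \<psi>))"
          using x(1) u by (intro K degree_le_X_power N) linarith
        also have "\<dots> \<le> \<bar>K\<bar> * real (N + 2 * n + 2) * (growth N n * norm (ket \<psi>))"
          using growth_nonneg[of N n] by (intro mult_mono norm_X_power_le N) auto
        also have "\<dots> = \<bar>K\<bar> * (real (N + 2 * n + 2) * growth N n) * norm (ket \<psi>)"
          by simp
        also have "\<dots> = growth (N + 2) n * (\<bar>K\<bar> * real (N + 2) * norm (ket \<psi>))"
          unfolding growth_shift by simp
        finally have d: "\<bar>diff n x\<bar> \<le> growth (N + 2) n * (\<bar>K\<bar> * real (N + 2) * norm (ket \<psi>))" .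
        have "\<bar>diff 0 u\<bar> = \<bar>u\<bar> ^ n / fact n * \<bar>diff n x\<bar>"
          by (simp add: x(2) abs_mult power_abs)
        also have "\<dots> \<le> radius ^ n / fact n * (growth (N + 2) n * (\<bar>K\<bar> * real (N + 2) * norm (ket \<psi>)))"
          using u d radius_pos by (intro mult_mono divide_right_mono power_mono) auto
        finally show ?thesis
          by (simp add: mult.assoc)
      qed
      moreover have "(\<lambda>n. (radius ^ n / fact n * growth (N + 2) n) * (\<bar>K\<bar> * real (N + 2) * norm (ket \<psi>)))
          \<longlonglongrightarrow> 0 * (\<bar>K\<bar> * real (N + 2) * norm (ket \<psi>))"
        by (intro tendsto_mult tendsto_const summable_LIMSEQ_zero[OF summable_growth])
      ultimately have "\<bar>diff 0 u\<bar> \<le> 0"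
        using LIMSEQ_le_const by (metis (no_types, lifting) mult_zero_left)
      then show ?thesis
        by (simp add: diff_def)
    qed
    from this[of 1] this[of \<i>] show ?thesis
      by (simp add: complex_eq_iff)
  qed
  have "\<forall>t \<psi>. \<bar>t\<bar> \<le> real n * radius \<longrightarrow> finite_support \<psi> \<longrightarrow> M t \<psi> = 0" for n
  proof (induction n)
    case (Suc n)
    show ?case
    proof (intro allI impI)
      fix t and \<psi> :: "'n state" assume t: "\<bar>t\<bar> \<le> real (Suc n) * radius" and \<psi>: "finite_support \<psi>"
      \<comment> \<open>Equal steps: \<open>real n * u\<close> is covered by the induction
        hypothesis, and one more step of length \<open>u\<close> reaches \<open>t\<close>.\<close>
      define u where "u = t / real (Suc n)"
      have "\<bar>u\<bar> \<le> radius"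
        using t by (simp add: u_def field_simps)
      moreover have tu: "t = real n * u + u"
      proof -
        have "real n * u + u = real (Suc n) * u"
          by (simp add: algebra_simps)
        then show ?thesis
          by (simp add: u_def del: of_nat_Suc)
      qed
      moreover have "\<bar>real n * u\<bar> \<le> real n * radius"
        using \<open>\<bar>u\<bar> \<le> radius\<close> by (simp add: abs_mult mult_left_mono)
      ultimately show "M t \<psi> = 0"
        using step[where s = "real n * u" and u = u and \<psi> = \<psi>] Suc \<psi> by blast
    qed
  qed (simp add: init)
  moreover obtain n where "\<bar>t\<bar> \<le> real n * radius"
    using reals_Archimedean3[OF radius_pos, rule_format, of "\<bar>t\<bar>"] less_imp_le by blast
  ultimately show ?thesis
    using \<psi> by blast
qed

end

section \<open>The classical flow\<close>

context
  fixes M :: "complex^'m^'m"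
begin

definition matrix_power :: "nat \<Rightarrow> complex^'m^'m" where
  "matrix_power k = ((\<lambda>X. M ** X) ^^ k) (mat 1)"

lemma matrix_power_0 [simp]: "matrix_power 0 = mat 1"
  by (simp add: matrix_power_def)

lemma matrix_power_Suc: "matrix_power (Suc k) = M ** matrix_power k"
  by (simp add: matrix_power_def)

lemma matrix_power_Suc2: "matrix_power (Suc k) = matrix_power k ** M"
  by (induction k) (simp_all add: matrix_power_Suc matrix_mul_assoc)

lemma matrix_power_nth_le:
  obtains K :: real where "K \<ge> 0" "\<And>k i j. cmod (matrix_power k $ i $ j) \<le> K ^ k"
proof
  define K where "K = (\<Sum>i\<in>UNIV. \<Sum>j\<in>UNIV. cmod (M $ i $ j))"
  show "K \<ge> 0"
    by (simp add: K_def sum_nonneg)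
  show "cmod (matrix_power k $ i $ j) \<le> K ^ k" for k i j
  proof (induction k arbitrary: i j)
    case 0
    then show ?case
      by (simp add: mat_def)
  next
    case (Suc k)
    have "cmod (matrix_power (Suc k) $ i $ j) = cmod (\<Sum>l\<in>UNIV. M $ i $ l * matrix_power k $ l $ j)"
      by (simp add: matrix_power_Suc matrix_matrix_mult_def)
    also have "\<dots> \<le> (\<Sum>l\<in>UNIV. cmod (M $ i $ l) * K ^ k)"
      by (rule sum_norm_le) (simp add: norm_mult mult_left_mono Suc)
    also have "\<dots> = (\<Sum>l\<in>UNIV. cmod (M $ i $ l)) * K ^ k"
      by (simp add: sum_distrib_right)
    also have "(\<Sum>l\<in>UNIV. cmod (M $ i $ l)) \<le> K"
      unfolding K_def by (rule member_le_sum) (auto intro: sum_nonneg)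
    finally show ?case
      using \<open>K \<ge> 0\<close> by (simp add: mult_right_mono)
  qed
qed

lemma summable_matrix_exp_nth: "summable (\<lambda>k. matrix_power k $ i $ j / fact k * z ^ k)"
proof -
  obtain K where K: "K \<ge> 0" "\<And>k i j. cmod (matrix_power k $ i $ j) \<le> K ^ k"
    using matrix_power_nth_le by blast
  show ?thesis
  proof (rule summable_comparison_test'[where N = 0])
    show "summable (\<lambda>k. inverse (fact k) * (K * cmod z) ^ k)"
      by (rule summable_exp)
    show "norm (matrix_power k $ i $ j / fact k * z ^ k) \<le> inverse (fact k) * (K * cmod z) ^ k" for k
      using mult_right_mono[OF K(2)[of k i j], of "cmod z ^ k / fact k"]
      by (simp add: norm_mult norm_divide norm_power power_mult_distrib field_simps)
  qed
qed

text \<open>Each entry is a scalar power series in \<open>t\<close>, so termwise differentiation of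
  complex power series can be used.\<close>

lemma matrix_exp_nth:
  "matrix_exp (t *\<^sub>R M) $ i $ j = (\<Sum>k. matrix_power k $ i $ j / fact k * of_real t ^ k)"
proof -
  have pow: "((\<lambda>X. (t *\<^sub>R M) ** X) ^^ k) (mat 1) = t ^ k *\<^sub>R matrix_power k" for k
  proof (induction k)
    case (Suc k)
    have "(t *\<^sub>R M) ** (t ^ k *\<^sub>R P) = t ^ Suc k *\<^sub>R (M ** P)" for P :: "complex^'m^'m"
      by (simp add: vec_eq_iff matrix_matrix_mult_def scaleR_sum_right mult.commute[of t])
    then show ?case
      by (simp add: Suc matrix_power_Suc)
  qed simp
  have nth: "((1 / fact k) *\<^sub>R (t ^ k *\<^sub>R matrix_power k)) $ i $ j
      = matrix_power k $ i $ j / fact k * of_real t ^ k" for k i j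
    by (simp add: scaleR_conv_of_real[where 'a = complex] mult_ac)
  have "(\<lambda>n. \<Sum>k<n. (1 / fact k) *\<^sub>R (t ^ k *\<^sub>R matrix_power k)) \<longlonglongrightarrow>
      (\<chi> i j. \<Sum>k. matrix_power k $ i $ j / fact k * of_real t ^ k)"
    by (intro vec_tendstoI) (simp only: sum_component nth vec_lambda_beta summable_LIMSEQ[OF summable_matrix_exp_nth])
  then have "(\<lambda>k. (1 / fact k) *\<^sub>R (t ^ k *\<^sub>R matrix_power k)) sums
      (\<chi> i j. \<Sum>k. matrix_power k $ i $ j / fact k * of_real t ^ k)"
    by (simp add: sums_def)
  then show ?thesis
    unfolding matrix_exp_def pow by (simp add: sums_iff)
qed

lemma matrix_exp_0: "matrix_exp (0 *\<^sub>R M) = mat 1"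
proof -
  have "(\<Sum>k. matrix_power k $ i $ j / fact k * 0 ^ k) = (\<Sum>k\<in>{0}. matrix_power k $ i $ j / fact k * 0 ^ k)" for i j
    by (rule suminf_finite) auto
  then show ?thesis
    unfolding vec_eq_iff matrix_exp_nth by simp
qed

lemma matrix_exp_nth_derivative:
  "((\<lambda>t. matrix_exp (t *\<^sub>R M) $ i $ j) has_vector_derivative
      (\<Sum>k. matrix_power (Suc k) $ i $ j / fact k * of_real t ^ k)) (at t)"
proof -
  let ?c = "\<lambda>k. matrix_power k $ i $ j / fact k"
  have "((\<lambda>z. \<Sum>k. ?c k * z ^ k) has_field_derivative (\<Sum>k. diffs ?c k * of_real t ^ k)) (at (of_real t))"
    by (rule termdiffs_strong_converges_everywhere) (rule summable_matrix_exp_nth)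
  moreover have "diffs ?c k = matrix_power (Suc k) $ i $ j / fact k" for k
    by (simp add: diffs_def del: of_nat_Suc)
  ultimately show ?thesis
    unfolding matrix_exp_nth using has_vector_derivative_real_field by fastforce
qed

lemma matrix_exp_derivative_left:
  "((\<lambda>t. matrix_exp (t *\<^sub>R M) $ i $ j) has_vector_derivative
      (\<Sum>l\<in>UNIV. M $ i $ l * matrix_exp (t *\<^sub>R M) $ l $ j)) (at t)"
proof -
  have "(\<Sum>k. matrix_power (Suc k) $ i $ j / fact k * of_real t ^ k)
      = (\<Sum>k. \<Sum>l\<in>UNIV. M $ i $ l * (matrix_power k $ l $ j / fact k * of_real t ^ k))"
    unfolding matrix_power_Suc matrix_matrix_mult_def vec_lambda_beta sum_divide_distrib sum_distrib_right
    by (simp add: mult.assoc)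
  also have "\<dots> = (\<Sum>l\<in>UNIV. \<Sum>k. M $ i $ l * (matrix_power k $ l $ j / fact k * of_real t ^ k))"
    by (rule suminf_sum) (intro summable_mult summable_matrix_exp_nth)
  also have "\<dots> = (\<Sum>l\<in>UNIV. M $ i $ l * matrix_exp (t *\<^sub>R M) $ l $ j)"
    unfolding matrix_exp_nth suminf_mult[OF summable_matrix_exp_nth] ..
  finally show ?thesis
    using matrix_exp_nth_derivative[of i j t] by simp
qed

lemma matrix_exp_derivative_right:
  "((\<lambda>t. matrix_exp (t *\<^sub>R M) $ i $ j) has_vector_derivative
      (\<Sum>l\<in>UNIV. matrix_exp (t *\<^sub>R M) $ i $ l * M $ l $ j)) (at t)"
proof -
  have "(\<Sum>k. matrix_power (Suc k) $ i $ j / fact k * of_real t ^ k)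
      = (\<Sum>k. \<Sum>l\<in>UNIV. M $ l $ j * (matrix_power k $ i $ l / fact k * of_real t ^ k))"
    unfolding matrix_power_Suc2 matrix_matrix_mult_def vec_lambda_beta sum_divide_distrib sum_distrib_right
    by (simp add: mult_ac)
  also have "\<dots> = (\<Sum>l\<in>UNIV. \<Sum>k. M $ l $ j * (matrix_power k $ i $ l / fact k * of_real t ^ k))"
    by (rule suminf_sum) (intro summable_mult summable_matrix_exp_nth)
  also have "\<dots> = (\<Sum>l\<in>UNIV. matrix_exp (t *\<^sub>R M) $ i $ l * M $ l $ j)"
    unfolding matrix_exp_nth suminf_mult[OF summable_matrix_exp_nth] by (simp add: mult.commute)
  finally show ?thesis
    using matrix_exp_nth_derivative[of i j t] by simp
qed

end

lemma constant_of_zero_derivative: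
  fixes f :: "real \<Rightarrow> 'a::real_normed_vector"
  assumes "\<And>t. (f has_vector_derivative 0) (at t)"
  shows "f t = f s"
  using has_vector_derivative_zero_constant[of UNIV f] assms
  by (metis UNIV_I convex_UNIV has_vector_derivative_at_within)

text \<open>The exchange of the two blocks. Combined with complex conjugation it is a symmetry of
  \<open>G_mat\<close>, \<open>flow\<close> and \<open>doubled\<close>, which accounts for the
  conjugate lower blocks.\<close>

definition swap_sum :: "'a + 'a \<Rightarrow> 'a + 'a" where
  "swap_sum p = (case p of Inl i \<Rightarrow> Inr i | Inr i \<Rightarrow> Inl i)"

lemma sum_swap_sum: "(\<Sum>p\<in>UNIV. f (swap_sum p)) = (\<Sum>p\<in>UNIV. f p)"
  for f :: "'a::finite + 'a \<Rightarrow> 'b::comm_monoid_add"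
  unfolding sum_UNIV_Plus by (simp add: swap_sum_def add.commute)

lemma doubled_swap: "doubled h $ swap_sum p = cnj (doubled h $ p)"
  by (cases p) (simp_all add: doubled_def swap_sum_def)

context quadratic_hamiltonian
begin

abbreviation G :: "complex^('n + 'n)^('n + 'n)" where "G \<equiv> G_mat A B"
abbreviation E :: "real \<Rightarrow> complex^('n + 'n)^('n + 'n)" where "E \<equiv> flow A B"

lemmas flow_derivative_left = matrix_exp_derivative_left[of G, folded flow_def]
lemmas flow_derivative_right = matrix_exp_derivative_right[of G, folded flow_def]

lemma flow_0: "E 0 = mat 1"
  unfolding flow_def by (rule matrix_exp_0)

lemma flow_derivative_uminus:
  "((\<lambda>t. E (- t) $ p $ q) has_vector_derivative - (\<Sum>r\<in>UNIV. E (- t) $ p $ r * G $ r $ q)) (at t)"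
proof -
  have "((\<lambda>t. - t) has_vector_derivative - 1) (at t)"
    by (auto intro!: derivative_eq_intros)
  from vector_diff_chain_at[OF this flow_derivative_right]
  show ?thesis
    by (simp add: o_def)
qed

lemma flow_uminus_left: "E (- t) ** E t = mat 1"
proof -
  let ?f = "\<lambda>p q t. \<Sum>r\<in>UNIV. E (- t) $ p $ r * E t $ r $ q"
  have "(?f p q has_vector_derivative 0) (at t)" for p q t
  proof -
    have "(?f p q has_vector_derivative (\<Sum>r\<in>UNIV. E (- t) $ p $ r * (\<Sum>s\<in>UNIV. G $ r $ s * E t $ s $ q)
        + (- (\<Sum>s\<in>UNIV. E (- t) $ p $ s * G $ s $ r)) * E t $ r $ q)) (at t)"
      by (intro has_vector_derivative_sum has_vector_derivative_mult flow_derivative_left flow_derivative_uminus)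
    moreover have "(\<Sum>r\<in>UNIV. E (- t) $ p $ r * (\<Sum>s\<in>UNIV. G $ r $ s * E t $ s $ q))
        = (\<Sum>r\<in>UNIV. (\<Sum>s\<in>UNIV. E (- t) $ p $ s * G $ s $ r) * E t $ r $ q)"
      unfolding sum_distrib_left sum_distrib_right by (subst sum.swap) (simp add: mult.assoc)
    ultimately show ?thesis
      by (simp add: sum.distrib sum_negf sum_subtractf)
  qed
  then have "?f p q t = ?f p q 0" for p q
    by (rule constant_of_zero_derivative)
  moreover have "?f p q 0 = mat 1 $ p $ q" for p q
  proof -
    have "?f p q 0 = (E 0 ** E 0) $ p $ q"
      by (simp add: matrix_matrix_mult_def)
    then show ?thesis
      by (simp add: flow_0)
  qed
  ultimately show ?thesis
    by (simp add: vec_eq_iff matrix_matrix_mult_def)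
qed

lemma flow_uminus_right: "E t ** E (- t) = mat 1"
  using flow_uminus_left[of "- t"] by simp

section \<open>Symmetries of the classical flow and invertibility of Phi\<close>

lemma G_swap: "G $ swap_sum p $ swap_sum q = cnj (G $ p $ q)"
  by (cases p; cases q) (simp_all add: G_mat_def swap_sum_def)

lemma matrix_power_swap: "matrix_power G k $ swap_sum p $ swap_sum q = cnj (matrix_power G k $ p $ q)"
proof (induction k arbitrary: p q)
  case 0
  then show ?case
    by (cases p; cases q) (simp_all add: mat_def swap_sum_def)
next
  case (Suc k)
  have "matrix_power G (Suc k) $ swap_sum p $ swap_sum q
      = (\<Sum>r\<in>UNIV. G $ swap_sum p $ swap_sum r * matrix_power G k $ swap_sum r $ swap_sum q)"
    unfolding sum_swap_sum[of "\<lambda>r. G $ swap_sum p $ r * matrix_power G k $ r $ swap_sum q"]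
    by (simp add: matrix_power_Suc matrix_matrix_mult_def)
  then show ?case
    by (simp add: G_swap Suc matrix_power_Suc matrix_matrix_mult_def)
qed

lemma flow_swap: "E t $ swap_sum p $ swap_sum q = cnj (E t $ p $ q)"
proof -
  have "cnj (\<Sum>k. matrix_power G k $ p $ q / fact k * of_real t ^ k)
      = (\<Sum>k. cnj (matrix_power G k $ p $ q / fact k * of_real t ^ k))"
    using bounded_linear.suminf[OF bounded_linear_cnj summable_matrix_exp_nth] .
  then show ?thesis
    unfolding flow_def matrix_exp_nth by (simp add: matrix_power_swap)
qed

lemma flow_blocks:
  "E t $ Inl i $ Inl j = Phi A B t $ i $ j" "E t $ Inl i $ Inr j = Psi A B t $ i $ j"
  "E t $ Inr i $ Inl j = cnj (Psi A B t $ i $ j)" "E t $ Inr i $ Inr j = cnj (Phi A B t $ i $ j)"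
  using flow_swap[of t "Inl i" "Inr j"] flow_swap[of t "Inl i" "Inl j"]
  by (simp_all add: Phi_def Psi_def swap_sum_def)

text \<open>The diagonal of the indefinite form J = diag (1, -1) that the flow preserves.\<close>

definition signature :: "'n + 'n \<Rightarrow> complex" where
  "signature p = (case p of Inl i \<Rightarrow> 1 | Inr i \<Rightarrow> - 1)"

lemma G_signature: "cnj (G $ q $ p) * signature q = - signature p * G $ p $ q"
  by (cases p; cases q) (simp_all add: G_mat_def signature_def A_sym B_herm)

text \<open>E* J E = J, because G* J = - J G makes the derivative of the left side vanish and E is
  the identity at time 0.\<close>

lemma flow_signature:
  "(\<Sum>p\<in>UNIV. signature p * cnj (E t $ p $ q) * E t $ p $ r) = (if q = r then signature q else 0)"
proof -
  let ?f = "\<lambda>t. \<Sum>p\<in>UNIV. signature p * (cnj (E t $ p $ q) * E t $ p $ r)"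
  have "(?f has_vector_derivative 0) (at t)" for t
  proof -
    let ?D = "\<lambda>p r. \<Sum>s\<in>UNIV. G $ p $ s * E t $ s $ r"
    have cnj: "((\<lambda>t. cnj (E t $ p $ q)) has_vector_derivative cnj (?D p q)) (at t)" for p
      by (rule bounded_linear.has_vector_derivative[OF bounded_linear_cnj flow_derivative_left])
    have "(?f has_vector_derivative (\<Sum>p\<in>UNIV. signature p * (cnj (E t $ p $ q) * ?D p r
        + cnj (?D p q) * E t $ p $ r))) (at t)"
      by (intro has_vector_derivative_sum has_vector_derivative_mult_right has_vector_derivative_mult
          flow_derivative_left cnj)
    moreover have "(\<Sum>p\<in>UNIV. signature p * (cnj (?D p q) * E t $ p $ r))
        = - (\<Sum>p\<in>UNIV. signature p * (cnj (E t $ p $ q) * ?D p r))"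
    proof -
      have "(\<Sum>p\<in>UNIV. signature p * (cnj (?D p q) * E t $ p $ r))
          = (\<Sum>p\<in>UNIV. \<Sum>s\<in>UNIV. (cnj (G $ p $ s) * signature p) * cnj (E t $ s $ q) * E t $ p $ r)"
        by (simp add: sum_distrib_left sum_distrib_right mult_ac)
      also have "\<dots> = (\<Sum>p\<in>UNIV. \<Sum>s\<in>UNIV. (- signature s * G $ s $ p) * cnj (E t $ s $ q) * E t $ p $ r)"
        by (simp only: G_signature)
      also have "\<dots> = - (\<Sum>s\<in>UNIV. \<Sum>p\<in>UNIV. signature s * (cnj (E t $ s $ q) * (G $ s $ p * E t $ p $ r)))"
        by (subst sum.swap) (simp add: sum_negf mult_ac)
      finally show ?thesis
        by (simp add: sum_distrib_left)
    qed
    ultimately show ?thesis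
      by (simp add: distrib_left sum.distrib)
  qed
  then have "?f t = ?f 0"
    by (rule constant_of_zero_derivative)
  also have "?f 0 = (\<Sum>p\<in>UNIV. if p = q then (if q = r then signature q else 0) else 0)"
    unfolding flow_0 by (intro sum.cong) (auto simp: mat_def)
  finally show ?thesis
    by (simp add: mult.assoc)
qed

text \<open>If Phi v = 0, the flow maps (v, 0) to (0, w). Preservation of the form reads |v|^2 = -
  |w|^2, so v = 0.\<close>

lemma invertible_Phi: "invertible (Phi A B t)"
  unfolding invertible_left_inverse matrix_left_invertible_ker
proof (intro allI impI)
  fix v assume v: "Phi A B t *v v = 0"
  define w where "w p = (\<Sum>j\<in>UNIV. E t $ p $ Inl j * v $ j)" for p
  have "(\<Sum>p\<in>UNIV. signature p * (cnj (w p) * w p))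
      = (\<Sum>i\<in>UNIV. \<Sum>j\<in>UNIV. (\<Sum>p\<in>UNIV. signature p * cnj (E t $ p $ Inl i) * E t $ p $ Inl j) * (cnj (v $ i) * v $ j))"
  proof -
    have "(\<Sum>p\<in>UNIV. signature p * (cnj (w p) * w p))
        = (\<Sum>p\<in>UNIV. \<Sum>i\<in>UNIV. \<Sum>j\<in>UNIV. signature p * cnj (E t $ p $ Inl i) * E t $ p $ Inl j * (cnj (v $ i) * v $ j))"
      by (simp add: w_def sum_product sum_distrib_left mult_ac)
    also have "\<dots> = (\<Sum>i\<in>UNIV. \<Sum>p\<in>UNIV. \<Sum>j\<in>UNIV. signature p * cnj (E t $ p $ Inl i) * E t $ p $ Inl j * (cnj (v $ i) * v $ j))"
      by (rule sum.swap)
    also have "\<dots> = (\<Sum>i\<in>UNIV. \<Sum>j\<in>UNIV. \<Sum>p\<in>UNIV. signature p * cnj (E t $ p $ Inl i) * E t $ p $ Inl j * (cnj (v $ i) * v $ j))"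
      by (rule sum.cong[OF refl], rule sum.swap)
    finally show ?thesis
      by (simp add: sum_distrib_right)
  qed
  also have "\<dots> = (\<Sum>i\<in>UNIV. \<Sum>j\<in>UNIV. if j = i then cnj (v $ i) * v $ i else 0)"
    unfolding flow_signature by (intro sum.cong refl) (auto simp: signature_def)
  also have "\<dots> = of_real (\<Sum>i\<in>UNIV. (cmod (v $ i))\<^sup>2)"
    by (simp add: complex_norm_square mult.commute del: of_real_power)
  finally have eq: "(\<Sum>p\<in>UNIV. signature p * (cnj (w p) * w p)) = of_real (\<Sum>i\<in>UNIV. (cmod (v $ i))\<^sup>2)" .
  have "w (Inl i) = (Phi A B t *v v) $ i" for i
    by (simp add: w_def matrix_vector_mult_def flow_blocks)
  then have "(\<Sum>p\<in>UNIV. signature p * (cnj (w p) * w p)) = - of_real (\<Sum>i\<in>UNIV. (cmod (w (Inr i)))\<^sup>2)"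
    by (simp add: sum_UNIV_Plus signature_def v complex_norm_square sum_negf mult.commute
        del: of_real_power)
  with eq have "complex_of_real (\<Sum>i\<in>UNIV. (cmod (v $ i))\<^sup>2) = of_real (- (\<Sum>i\<in>UNIV. (cmod (w (Inr i)))\<^sup>2))"
    by simp
  then have "(\<Sum>i\<in>UNIV. (cmod (v $ i))\<^sup>2) = - (\<Sum>i\<in>UNIV. (cmod (w (Inr i)))\<^sup>2)"
    unfolding of_real_eq_iff .
  moreover have "(\<Sum>i\<in>UNIV. (cmod (w (Inr i)))\<^sup>2) \<ge> 0" "(\<Sum>i\<in>UNIV. (cmod (v $ i))\<^sup>2) \<ge> 0"
    by (auto intro: sum_nonneg)
  ultimately have "(\<Sum>i\<in>UNIV. (cmod (v $ i))\<^sup>2) = 0"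
    by linarith
  then show "v = 0"
    by (simp add: sum_nonneg_eq_0_iff vec_eq_iff)
qed

end

section \<open>The vacuum amplitude\<close>

lemma interval_integral_has_vector_derivative:
  fixes f :: "real \<Rightarrow> 'a::euclidean_space"
  assumes "continuous_on UNIV f"
  shows "((\<lambda>u. LBINT y=0..u. f y) has_vector_derivative f t) (at t)"
proof -
  \<comment> \<open>Room on both sides of 0 and \<open>t\<close>: the base point may lie on either
    side of \<open>t\<close>, and \<open>t\<close> is interior, so the derivative is
    two-sided.\<close>
  define a b where "a = min 0 t - 1" and "b = max 0 t + 1"
  have ab: "a \<le> 0" "0 \<le> b" "a < t" "t < b"
    by (auto simp: a_def b_def)
  have "((\<lambda>u. LBINT y=ereal 0..ereal u. f y) has_vector_derivative f t) (at t within {a..b})"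
    using ab assms by (intro interval_integral_FTC2) (auto intro: continuous_on_subset)
  moreover have "at t within {a..b} = at t"
    using ab by (intro at_within_interior) auto
  ultimately show ?thesis
    by (simp add: zero_ereal_def)
qed

lemma continuous_on_det:
  fixes M :: "'a::topological_space \<Rightarrow> complex^'n^'n"
  assumes "\<And>i j. continuous_on S (\<lambda>t. M t $ i $ j)"
  shows "continuous_on S (\<lambda>t. det (M t))"
  unfolding det_def by (intro continuous_on_sum continuous_on_mult continuous_on_prod continuous_on_const assms)

lemma matrix_inv_inverse:
  fixes M :: "'a::field^'n^'n"
  assumes "invertible M"
  shows "M ** matrix_inv M = mat 1" "matrix_inv M ** M = mat 1"
proof -
  have "M ** matrix_inv M = mat 1 \<and> matrix_inv M ** M = mat 1"
    using assms unfolding invertible_def matrix_inv_def by (rule someI_ex)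
  then show "M ** matrix_inv M = mat 1" "matrix_inv M ** M = mat 1"
    by blast+
qed

text \<open>Cramer's rule writes each entry of the inverse as a quotient of determinants, which are
  polynomials in the entries.\<close>

lemma continuous_on_matrix_inv_nth:
  fixes M :: "'a::topological_space \<Rightarrow> complex^'n^'n"
  assumes cont: "\<And>i j. continuous_on S (\<lambda>t. M t $ i $ j)" and inv: "\<And>t. invertible (M t)"
  shows "continuous_on S (\<lambda>t. matrix_inv (M t) $ k $ l)"
proof -
  have det: "det (M t) \<noteq> 0" for t
    using inv invertible_det_nz by blast
  have "matrix_inv (M t) $ k $ l = det (\<chi> i j. if j = k then axis l 1 $ i else M t $ i $ j) / det (M t)" for t
  proof -
    have "M t *v (matrix_inv (M t) *v axis l 1) = axis l 1"
      by (simp add: matrix_vector_mul_assoc matrix_inv_inverse inv)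
    then have "(matrix_inv (M t) *v axis l 1) $ k
        = det (\<chi> i j. if j = k then axis l 1 $ i else M t $ i $ j) / det (M t)"
      unfolding cramer[OF det] by simp
    moreover have "(matrix_inv (M t) *v axis l 1) $ k = matrix_inv (M t) $ k $ l"
      by (simp add: matrix_vector_mult_def axis_def if_distrib[of "\<lambda>x. _ * x"] cong: if_cong)
    ultimately show ?thesis
      by (rule trans[OF sym, rotated])
  qed
  moreover have "continuous_on S (\<lambda>t. (\<chi> i j. if j = k then axis l 1 $ i else M t $ i $ j) $ i $ j)" for i j
    using cont by (cases "j = k") auto
  ultimately show ?thesis
    using det by (simp add: continuous_on_divide continuous_on_det cont del: vec_lambda_beta)
qed

context quadratic_hamiltonian
begin

abbreviation L :: "real \<Rightarrow> 'n state \<Rightarrow> complex" where "L \<equiv> vac_functional"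

definition shift :: "real \<Rightarrow> complex^('n + 'n)" where
  "shift t = (LBINT \<tau>=0..t. E \<tau> *v doubled h)"

lemma continuous_flow_nth: "continuous_on S (\<lambda>t. E t $ p $ q)"
  by (intro continuous_at_imp_continuous_on ballI has_vector_derivative_continuous[OF flow_derivative_left])

lemma shift_derivative: "((\<lambda>t. shift t $ p) has_vector_derivative (E t *v doubled h) $ p) (at t)"
proof -
  have "continuous_on UNIV (\<lambda>t. E t *v doubled h)"
    unfolding matrix_vector_mult_def
    by (intro continuous_on_vec_lambda continuous_on_sum continuous_on_mult continuous_flow_nth continuous_on_const)
  from bounded_linear.has_vector_derivative[OF bounded_linear_vec_nth interval_integral_has_vector_derivative[OF this]]
  show ?thesis
    unfolding shift_def .
qed

lemma continuous_shift_nth: "continuous_on S (\<lambda>t. shift t $ p)"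
  by (intro continuous_at_imp_continuous_on ballI has_vector_derivative_continuous[OF shift_derivative])

lemma shift_0: "shift 0 = 0"
  by (simp add: shift_def zero_ereal_def)

text \<open>Both sides have the same derivative and agree at 0. Hence \<open>shift\<close> solves
  the inhomogeneous equation with matrix \<open>G\<close> and source \<open>doubled h\<close>, the
  same affine equation that the commutators produce.\<close>

lemma flow_doubled: "(E t *v doubled h) $ p = doubled h $ p + (\<Sum>q\<in>UNIV. G $ p $ q * shift t $ q)"
proof -
  let ?f = "\<lambda>t. (E t *v doubled h) $ p - (\<Sum>q\<in>UNIV. G $ p $ q * shift t $ q)"
  have "(?f has_vector_derivative 0) (at t)" for t
  proof -
    have "(?f has_vector_derivative ((\<Sum>r\<in>UNIV. (\<Sum>q\<in>UNIV. G $ p $ q * E t $ q $ r) * doubled h $ r)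
        - (\<Sum>q\<in>UNIV. G $ p $ q * (E t *v doubled h) $ q))) (at t)"
      unfolding matrix_vector_mult_def vec_lambda_beta
      by (intro has_vector_derivative_diff has_vector_derivative_sum has_vector_derivative_mult_left
          has_vector_derivative_mult_right flow_derivative_left
          shift_derivative[unfolded matrix_vector_mult_def vec_lambda_beta])
    moreover have "(\<Sum>r\<in>UNIV. (\<Sum>q\<in>UNIV. G $ p $ q * E t $ q $ r) * doubled h $ r)
        = (\<Sum>q\<in>UNIV. G $ p $ q * (E t *v doubled h) $ q)"
      unfolding matrix_vector_mult_def vec_lambda_beta sum_distrib_left sum_distrib_right
      by (subst sum.swap) (simp add: mult.assoc)
    ultimately show ?thesis
      by simp
  qed
  then have "?f t = ?f 0"
    by (rule constant_of_zero_derivative)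
  then show ?thesis
    by (simp add: flow_0 shift_0 diff_eq_eq)
qed

lemma shift_swap: "shift t $ swap_sum p = cnj (shift t $ p)"
proof -
  let ?f = "\<lambda>t. shift t $ swap_sum p - cnj (shift t $ p)"
  have "(E t *v doubled h) $ swap_sum p = cnj ((E t *v doubled h) $ p)" for t
  proof -
    have "(E t *v doubled h) $ swap_sum p
        = (\<Sum>q\<in>UNIV. E t $ swap_sum p $ swap_sum q * doubled h $ swap_sum q)"
      unfolding sum_swap_sum[of "\<lambda>q. E t $ swap_sum p $ q * doubled h $ q"]
      by (simp add: matrix_vector_mult_def)
    then show ?thesis
      by (simp add: flow_swap doubled_swap matrix_vector_mult_def)
  qed
  then have "(?f has_vector_derivative 0) (at t)" for t
    using has_vector_derivative_diff[OF shift_derivative[of "swap_sum p" t]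
        bounded_linear.has_vector_derivative[OF bounded_linear_cnj shift_derivative[of p t]]]
    by simp
  then have "?f t = ?f 0"
    by (rule constant_of_zero_derivative)
  then show ?thesis
    by (simp add: shift_0)
qed

lemma shift_blocks: "shift t $ Inl i = h_vec A B h t $ i" "shift t $ Inr i = cnj (h_vec A B h t $ i)"
  using shift_swap[of t "Inl i"] by (simp_all add: shift_def h_vec_def swap_sum_def)

text \<open>Subtracting the classical trajectory removes the source term: apart from
  \<open>X\<close> acting on \<open>\<psi>\<close>, the centred values obey the homogeneous linear
  system with matrix \<open>G\<close>.\<close>

definition centred :: "real \<Rightarrow> 'n state \<Rightarrow> 'n + 'n \<Rightarrow> complex" where
  "centred t \<psi> q = L t (ladder q \<psi>) - shift t $ q * L t \<psi>"

text \<open>Formally \<open>evolved p t \<psi>\<close> is the inner product of the vacuum with \<open>ladder p\<close> applied to the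
  evolved vector; the Heisenberg form used here needs no statement about its domain.\<close>

definition evolved :: "'n + 'n \<Rightarrow> real \<Rightarrow> 'n state \<Rightarrow> complex" where
  "evolved p t \<psi> = (\<Sum>q\<in>UNIV. E (- t) $ p $ q * centred t \<psi> q)"

lemma L_X_ladder:
  assumes "finite_support \<psi>"
  shows "L t (X (ladder p \<psi>)) = L t (ladder p (X \<psi>)) + (\<Sum>q\<in>UNIV. G $ p $ q * L t (ladder q \<psi>))
     + doubled h $ p * L t \<psi>"
  using assms unfolding X_ladder by (simp add: vac_functional_add vac_functional_sum vac_functional_cmult)

lemma centred_derivative:
  assumes \<psi>: "finite_support \<psi>"
  shows "((\<lambda>t. centred t \<psi> q) has_vector_derivative
      centred t (X \<psi>) q + (\<Sum>r\<in>UNIV. G $ q $ r * centred t \<psi> r)) (at t)"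
proof -
  have "((\<lambda>t. centred t \<psi> q) has_vector_derivative
      L t (X (ladder q \<psi>)) - (shift t $ q * L t (X \<psi>) + (E t *v doubled h) $ q * L t \<psi>)) (at t)"
    unfolding centred_def
    by (intro has_vector_derivative_diff has_vector_derivative_mult vac_functional_derivative
        finite_support_ladder shift_derivative \<psi>)
  moreover have "L t (X (ladder q \<psi>)) - (shift t $ q * L t (X \<psi>) + (E t *v doubled h) $ q * L t \<psi>)
      = centred t (X \<psi>) q + (\<Sum>r\<in>UNIV. G $ q $ r * centred t \<psi> r)"
    unfolding L_X_ladder[OF \<psi>] flow_doubled centred_def
    by (simp add: algebra_simps sum_subtractf sum_distrib_left)
  ultimately show ?thesis
    by simp
qed

text \<open>\<open>E (- t)\<close> is an integrating factor: its derivative cancels the term with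
  \<open>G\<close> in \<open>centred_derivative\<close>.\<close>

lemma evolved_derivative:
  assumes \<psi>: "finite_support \<psi>"
  shows "((\<lambda>t. evolved p t \<psi>) has_vector_derivative evolved p t (X \<psi>)) (at t)"
proof -
  have "((\<lambda>t. evolved p t \<psi>) has_vector_derivative (\<Sum>q\<in>UNIV.
      E (- t) $ p $ q * (centred t (X \<psi>) q + (\<Sum>r\<in>UNIV. G $ q $ r * centred t \<psi> r))
      + (- (\<Sum>r\<in>UNIV. E (- t) $ p $ r * G $ r $ q)) * centred t \<psi> q)) (at t)"
    unfolding evolved_def
    by (intro has_vector_derivative_sum has_vector_derivative_mult flow_derivative_uminus
        centred_derivative \<psi>)
  moreover have "(\<Sum>q\<in>UNIV. E (- t) $ p $ q * (\<Sum>r\<in>UNIV. G $ q $ r * centred t \<psi> r))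
      = (\<Sum>q\<in>UNIV. (\<Sum>r\<in>UNIV. E (- t) $ p $ r * G $ r $ q) * centred t \<psi> q)"
    unfolding sum_distrib_left sum_distrib_right by (subst sum.swap) (simp add: mult.assoc)
  ultimately show ?thesis
    by (simp add: evolved_def distrib_left sum.distrib sum_subtractf)
qed

text \<open>The coefficients are continuous, hence bounded on compact time intervals. The degree
  enters through the ladder operator, whose square root is weakened to the linear factor that
  \<open>growth_shift\<close> absorbs.\<close>

lemma evolved_bound:
  "\<exists>K. \<forall>t \<psi> N. \<bar>t\<bar> \<le> T \<longrightarrow> degree_le N \<psi> \<longrightarrow>
     cmod (evolved p t \<psi>) \<le> K * real (N + 2) * norm (ket \<psi>)"
proof -
  let ?V = "norm (vacuum :: 'n fock)"
  let ?g = "\<lambda>t. \<Sum>q\<in>UNIV. cmod (E (- t) $ p $ q) * ((1 + cmod (shift t $ q)) * ?V)"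
  have "continuous_on {-T..T} (\<lambda>t. E (- t) $ p $ q)" for q
    by (rule continuous_on_compose2[OF continuous_flow_nth[of UNIV]]) (auto intro: continuous_intros)
  then have "continuous_on {-T..T} ?g"
    by (intro continuous_on_sum continuous_on_mult continuous_on_add continuous_on_norm
        continuous_shift_nth continuous_on_const)
  then have "bounded (?g ` {-T..T})"
    by (intro compact_imp_bounded compact_continuous_image) auto
  then obtain K where bound: "\<forall>x\<in>?g ` {-T..T}. norm x \<le> K"
    unfolding bounded_iff by blast
  have K: "?g t \<le> K" if "t \<in> {-T..T}" for t
    using bspec[OF bound imageI[OF that]] by (simp add: abs_le_iff)
  show ?thesis
  proof (intro exI allI impI)
    fix t N and \<psi> :: "'n state" assume t: "\<bar>t\<bar> \<le> T" and \<psi>: "degree_le N \<psi>"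
    have sqrt_le: "sqrt (Suc N) \<le> real (N + 2)"
    proof -
      have "sqrt (Suc N) \<le> real (Suc N)"
        by (rule real_le_lsqrt) (simp_all add: power2_eq_square)
      then show ?thesis
        by simp
    qed
    have centred_le: "cmod (centred t \<psi> q) \<le> (1 + cmod (shift t $ q)) * ?V * (real (N + 2) * norm (ket \<psi>))" for q
    proof -
      have "cmod (L t (ladder q \<psi>)) \<le> ?V * (sqrt (Suc N) * norm (ket \<psi>))"
        by (rule order_trans[OF norm_vac_functional_le mult_left_mono[OF norm_ladder_le[OF \<psi>]]]) simp
      also have "\<dots> \<le> ?V * (real (N + 2) * norm (ket \<psi>))"
        by (intro mult_left_mono mult_right_mono sqrt_le) auto
      finally have 1: "cmod (L t (ladder q \<psi>)) \<le> ?V * (real (N + 2) * norm (ket \<psi>))" .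
      have "norm (ket \<psi>) \<le> real (N + 2) * norm (ket \<psi>)"
        by (simp add: mult_le_cancel_right1)
      then have "?V * norm (ket \<psi>) \<le> ?V * (real (N + 2) * norm (ket \<psi>))"
        by (intro mult_left_mono) auto
      then have "cmod (L t \<psi>) \<le> ?V * (real (N + 2) * norm (ket \<psi>))"
        using norm_vac_functional_le[of t \<psi>] by linarith
      then have 2: "cmod (shift t $ q * L t \<psi>) \<le> cmod (shift t $ q) * (?V * (real (N + 2) * norm (ket \<psi>)))"
        unfolding norm_mult by (intro mult_left_mono) auto
      have "cmod (centred t \<psi> q) \<le> cmod (L t (ladder q \<psi>)) + cmod (shift t $ q * L t \<psi>)"
        unfolding centred_def by (rule norm_triangle_ineq4)
      also have "\<dots> \<le> (1 + cmod (shift t $ q)) * ?V * (real (N + 2) * norm (ket \<psi>))"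
        using 1 2 by (simp only: distrib_right mult_1 mult.assoc)
      finally show ?thesis .
    qed
    have "cmod (evolved p t \<psi>) \<le> (\<Sum>q\<in>UNIV. cmod (E (- t) $ p $ q)
        * ((1 + cmod (shift t $ q)) * ?V * (real (N + 2) * norm (ket \<psi>))))"
      unfolding evolved_def by (rule sum_norm_le) (simp only: norm_mult centred_le mult_left_mono norm_ge_zero)
    also have "\<dots> = ?g t * (real (N + 2) * norm (ket \<psi>))"
      by (simp add: sum_distrib_right mult.assoc del: of_nat_add)
    also have "\<dots> \<le> K * (real (N + 2) * norm (ket \<psi>))"
    proof (rule mult_right_mono)
      show "?g t \<le> K"
        using K[of t] t by (simp add: abs_le_iff minus_le_iff)
    qed simp
    finally show "cmod (evolved p t \<psi>) \<le> K * real (N + 2) * norm (ket \<psi>)"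
      by (simp only: mult.assoc)
  qed
qed

lemma evolved_creat_eq_0:
  assumes "finite_support \<psi>"
  shows "evolved (Inr i) t \<psi> = 0"
proof (rule evolving_functional_eq_0[OF evolved_derivative evolved_bound _ assms])
  fix \<phi> :: "'n state" assume "finite_support \<phi>"
  then have "evolved (Inr i) 0 \<phi> = L 0 (ladder (Inr i) \<phi>)"
    by (simp add: evolved_def flow_0 mat_def centred_def shift_0 if_distrib[of "\<lambda>x. x * _"] cong: if_cong)
  then show "evolved (Inr i) 0 \<phi> = 0"
    \<comment> \<open>At time 0 the functional reads the vacuum coefficient, and a created state has
      none because of the factor sqrt 0.\<close>
    using \<open>finite_support \<phi>\<close> by (simp add: ladder_def vac_functional_0 creat_def)
qed

text \<open>The centred values are the flow applied to a vector whose lower half vanishes. The upper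
  half is \<open>Phi\<close> times \<open>y\<close>, the lower one the conjugate of
  \<open>Psi\<close> times \<open>y\<close>, and eliminating \<open>y\<close> produces
  \<open>rho_bar\<close>.\<close>

lemma centred_creat:
  assumes "finite_support \<psi>"
  shows "centred t \<psi> (Inr i) = (\<Sum>k\<in>UNIV. rho_bar A B t $ i $ k * centred t \<psi> (Inl k))"
proof -
  define y where "y = (\<chi> j. evolved (Inl j) t \<psi>)"
  have centred_eq: "centred t \<psi> p = (\<Sum>j\<in>UNIV. E t $ p $ Inl j * y $ j)" for p
  proof -
    have "(\<Sum>r\<in>UNIV. E t $ p $ r * evolved r t \<psi>) = (\<Sum>q\<in>UNIV. (E t ** E (- t)) $ p $ q * centred t \<psi> q)"
      unfolding evolved_def matrix_matrix_mult_def vec_lambda_beta sum_distrib_left sum_distrib_right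
      by (subst sum.swap) (simp add: mult.assoc)
    also have "\<dots> = centred t \<psi> p"
      by (simp add: flow_uminus_right mat_def if_distrib[of "\<lambda>x. x * _"] cong: if_cong)
    finally show ?thesis
      by (simp add: sum_UNIV_Plus evolved_creat_eq_0 assms y_def)
  qed
  have up: "(\<chi> k. centred t \<psi> (Inl k)) = Phi A B t *v y"
    by (simp add: vec_eq_iff centred_eq flow_blocks matrix_vector_mult_def)
  have "(\<chi> i. centred t \<psi> (Inr i)) = map_matrix cnj (Psi A B t) *v y"
    by (simp add: vec_eq_iff centred_eq flow_blocks matrix_vector_mult_def)
  also have "\<dots> = rho_bar A B t *v (Phi A B t *v y)"
    by (simp add: rho_bar_def matrix_vector_mul_assoc matrix_inv_inverse[OF invertible_Phi]
        flip: matrix_mul_assoc)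
  finally have "(\<chi> i. centred t \<psi> (Inr i)) $ i = (rho_bar A B t *v (\<chi> k. centred t \<psi> (Inl k))) $ i"
    by (simp add: up)
  then show ?thesis
    by (simp add: matrix_vector_mult_def)
qed

abbreviation f_bar :: "real \<Rightarrow> complex^'n" where "f_bar t \<equiv> cnjv (f_vec A B h t)"

lemma f_bar_nth: "f_bar t $ i = cnj (h_vec A B h t $ i) - (\<Sum>k\<in>UNIV. rho_bar A B t $ i $ k * h_vec A B h t $ k)"
  by (simp add: cnjv_def f_vec_def rho_def matrix_vector_mult_def)

lemma L_creat:
  assumes "finite_support \<psi>"
  shows "L t (creat i \<psi>) = (\<Sum>k\<in>UNIV. rho_bar A B t $ i $ k * L t (annihil k \<psi>)) + f_bar t $ i * L t \<psi>"
  using centred_creat[OF assms, of t i]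
  by (simp add: centred_def ladder_def shift_blocks f_bar_nth algebra_simps sum_subtractf sum_distrib_left)

section \<open>The differential equation for the vacuum amplitude\<close>

definition vac :: "'n state" where
  "vac k = (if k = (\<lambda>_. 0) then 1 else 0)"

lemma finite_support_vac [simp]: "finite_support vac"
  by (simp add: finite_support_def vac_def)

lemma ket_vac: "ket vac = vacuum"
  by (rule ell2_eqI) (simp add: vacuum.rep_eq vac_def)

lemma annihil_vac: "annihil i vac = (\<lambda>k. 0)"
proof -
  have "k(i := k i + 1) \<noteq> (\<lambda>_. 0)" for k :: "'n \<Rightarrow> nat"
    by (metis add_is_0 fun_upd_same one_neq_zero)
  then show ?thesis
    by (simp add: annihil_def vac_def fun_eq_iff)
qed

lemma L_zero [simp]: "L t (\<lambda>k. 0) = 0"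
  by (simp add: vac_functional_def exp_i_hamiltonian linear_0[OF bounded_linear.linear[OF bounded_linear_vac]])

lemma L_creat_vac: "L t (creat i vac) = f_bar t $ i * L t vac"
  by (simp add: L_creat annihil_vac)

lemma L_creat_creat_vac:
  "L t (creat i (creat j vac)) = (rho_bar A B t $ i $ j + f_bar t $ i * f_bar t $ j) * L t vac"
proof -
  have "annihil k (creat j vac) = (if k = j then vac else (\<lambda>_. 0))" for k
    by (auto simp: annihil_creat_commute annihil_vac creat_def)
  then have "L t (annihil k (creat j vac)) = (if k = j then L t vac else 0)" for k
    by simp
  then show ?thesis
    by (simp add: L_creat L_creat_vac distrib_right mult.assoc if_distrib[of "\<lambda>x. _ * x"] cong: if_cong)
qed

definition rate :: "real \<Rightarrow> complex" where
  "rate t = bilin (f_bar t) h + 1 / 2 * bilin (f_bar t) (A *v f_bar t) + 1 / 2 * trace (rho_bar A B t ** A)"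

text \<open>Words ending in an annihilator kill the vacuum, so only creators remain and
  \<open>L_creat\<close> evaluates them. Symmetry of A turns the contraction with
  \<open>rho_bar\<close> into a trace.\<close>

lemma L_X_vac: "L t (X vac) = - rate t * L t vac"
proof -
  have "L t (X vac) = (\<Sum>i\<in>UNIV. \<Sum>j\<in>UNIV. (- A $ i $ j / 2) * L t (creat i (creat j vac)))
      + (\<Sum>i\<in>UNIV. - h $ i * L t (creat i vac))"
  proof -
    have "annihil i (\<lambda>k. 0) = (\<lambda>k. 0)" "creat i (\<lambda>k. 0) = (\<lambda>k. 0)" for i :: 'n
      by (simp_all add: annihil_def creat_def fun_eq_iff)
    then have "X vac = (\<lambda>k. (\<Sum>i\<in>UNIV. \<Sum>j\<in>UNIV. (- A $ i $ j / 2) * creat i (creat j vac) k)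
        + (\<Sum>i\<in>UNIV. - h $ i * creat i vac k))"
      unfolding X_eq annihil_vac by simp
    then show ?thesis
      by (simp only: vac_functional_add vac_functional_sum vac_functional_cmult finite_support_sum
          finite_support_cmult finite_support_creat finite_support_vac)
  qed
  also have "\<dots> = - rate t * L t vac"
  proof -
    have "(- A $ i $ j / 2) * L t (creat i (creat j vac))
        = (- L t vac / 2) * (f_bar t $ i * (A $ i $ j * f_bar t $ j))
          + (- L t vac / 2) * (rho_bar A B t $ i $ j * A $ j $ i)" for i j
      by (simp add: L_creat_creat_vac A_sym[of j i] algebra_simps add_divide_distrib)
    then have "(\<Sum>i\<in>UNIV. \<Sum>j\<in>UNIV. (- A $ i $ j / 2) * L t (creat i (creat j vac)))
        = (- L t vac / 2) * (\<Sum>i\<in>UNIV. \<Sum>j\<in>UNIV. f_bar t $ i * (A $ i $ j * f_bar t $ j))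
          + (- L t vac / 2) * (\<Sum>i\<in>UNIV. \<Sum>j\<in>UNIV. rho_bar A B t $ i $ j * A $ j $ i)"
      by (simp only: sum.distrib sum_distrib_left)
    moreover have "bilin (f_bar t) (A *v f_bar t) = (\<Sum>i\<in>UNIV. \<Sum>j\<in>UNIV. f_bar t $ i * (A $ i $ j * f_bar t $ j))"
      by (simp add: bilin_def matrix_vector_mult_def sum_distrib_left)
    moreover have "trace (rho_bar A B t ** A) = (\<Sum>i\<in>UNIV. \<Sum>j\<in>UNIV. rho_bar A B t $ i $ j * A $ j $ i)"
      by (simp add: trace_def matrix_matrix_mult_def)
    moreover have "(\<Sum>i\<in>UNIV. - h $ i * L t (creat i vac)) = - bilin (f_bar t) h * L t vac"
      unfolding L_creat_vac bilin_def sum_distrib_right sum_negf[symmetric]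
      by (intro sum.cong refl) simp
    ultimately show ?thesis
      by (simp add: rate_def algebra_simps)
  qed
  finally show ?thesis .
qed

lemma continuous_Phi_nth: "continuous_on S (\<lambda>t. Phi A B t $ i $ j)"
  and continuous_Psi_nth: "continuous_on S (\<lambda>t. Psi A B t $ i $ j)"
  unfolding flow_blocks(1,2)[symmetric] by (rule continuous_flow_nth)+

lemma continuous_rho_bar_nth: "continuous_on S (\<lambda>t. rho_bar A B t $ i $ j)"
  unfolding rho_bar_def matrix_matrix_mult_def vec_lambda_beta nth_map_matrix
  by (intro continuous_on_sum continuous_on_mult continuous_on_cnj continuous_Psi_nth
      continuous_on_matrix_inv_nth continuous_Phi_nth invertible_Phi)

lemma continuous_f_bar_nth: "continuous_on S (\<lambda>t. f_bar t $ i)"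
  unfolding f_bar_nth shift_blocks(1)[symmetric]
  by (intro continuous_on_diff continuous_on_cnj continuous_on_sum continuous_on_mult
      continuous_shift_nth continuous_rho_bar_nth)

lemma continuous_rate: "continuous_on S rate"
  unfolding rate_def[abs_def] bilin_def matrix_vector_mult_def trace_def matrix_matrix_mult_def vec_lambda_beta
  by (intro continuous_on_sum continuous_on_mult continuous_on_add continuous_on_const
      continuous_f_bar_nth continuous_rho_bar_nth)

definition exponent :: "real \<Rightarrow> complex" where
  "exponent t = - (LBINT \<tau>=0..t. rate \<tau>)"

lemma exponent_derivative: "(exponent has_vector_derivative - rate t) (at t)"
  unfolding exponent_def[abs_def]
  by (intro has_vector_derivative_minus interval_integral_has_vector_derivative continuous_rate)

lemma exponent_0: "exponent 0 = 0"
  by (simp add: exponent_def zero_ereal_def)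

text \<open>Multiplying the amplitude by \<open>exp (- exponent t)\<close> gives a constant, which
  avoids taking a logarithm of a function not yet known to be nonzero.\<close>

theorem vacuum_amplitude:
  "cinner_ell2 vacuum (exp_i (hamiltonian A B h) t vacuum) = exp (exponent t)"
proof -
  let ?f = "\<lambda>t. L t vac * exp (- exponent t)"
  have "(?f has_vector_derivative 0) (at t)" for t
  proof -
    have "((\<lambda>t. - exponent t) has_vector_derivative rate t) (at t)"
      using has_vector_derivative_minus[OF exponent_derivative[of t]] by simp
    from field_vector_diff_chain_at[OF this DERIV_exp]
    have "((\<lambda>t. exp (- exponent t)) has_vector_derivative rate t * exp (- exponent t)) (at t)"
      by (simp add: o_def)
    from has_vector_derivative_mult[OF vac_functional_derivative[OF finite_support_vac] this]
    show ?thesis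
      by (simp add: L_X_vac algebra_simps)
  qed
  then have "?f t = ?f 0"
    by (rule constant_of_zero_derivative)
  then have "L t vac * exp (- exponent t) = 1"
    by (simp add: vac_functional_0 vac_def exponent_0)
  then have "L t vac = exp (exponent t)"
    by (simp add: exp_minus field_simps)
  then show ?thesis
    by (simp add: vac_functional_def ket_vac)
qed

end

text \<open>The difference takes values in the integer multiples of 2 pi i, which are at least 2 pi
  apart; a continuous function on a connected set with such values is constant.\<close>

lemma continuous_log_unique:
  fixes f g :: "real \<Rightarrow> complex"
  assumes "continuous_on UNIV f" "continuous_on UNIV g" "f 0 = g 0" "\<And>t. exp (f t) = exp (g t)"
  shows "f t = g t"
proof -
  have exp1: "exp (f t - g t) = 1" for t
    by (simp add: exp_diff assms(4))
  have "(\<lambda>t. f t - g t) constant_on UNIV"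
  proof (rule continuous_discrete_range_constant)
    show "continuous_on UNIV (\<lambda>t. f t - g t)"
      by (intro continuous_on_diff assms)
    fix t :: real
    show "\<exists>e>0. \<forall>y. y \<in> UNIV \<and> f y - g y \<noteq> f t - g t \<longrightarrow> e \<le> cmod (f y - g y - (f t - g t))"
    proof (intro exI[of _ "2 * pi"] conjI allI impI)
      fix y assume ne: "y \<in> UNIV \<and> f y - g y \<noteq> f t - g t"
      obtain m n :: int where mn: "Re (f y - g y) = 0" "Re (f t - g t) = 0"
        "Im (f y - g y) = of_int (2 * m) * pi" "Im (f t - g t) = of_int (2 * n) * pi"
        using exp1[of y] exp1[of t] unfolding exp_eq_1 by blast
      then have "m \<noteq> n"
        using ne by (auto simp: complex_eq_iff)
      then have "\<bar>real_of_int (m - n)\<bar> \<ge> 1"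
        by linarith
      then have "2 * pi * 1 \<le> 2 * pi * \<bar>real_of_int (m - n)\<bar>"
        by (intro mult_left_mono) auto
      also have "\<dots> = \<bar>Im (f y - g y - (f t - g t))\<bar>"
      proof -
        have "Im (f y - g y - (f t - g t)) = Im (f y - g y) - Im (f t - g t)"
          by simp
        also have "\<dots> = 2 * pi * real_of_int (m - n)"
          unfolding mn(3,4) by (simp add: algebra_simps)
        finally show ?thesis
          by (simp only: abs_mult abs_numeral abs_of_nonneg[OF pi_ge_zero])
      qed
      also have "\<dots> \<le> cmod (f y - g y - (f t - g t))"
        by (rule abs_Im_le_cmod)
      finally show "2 * pi \<le> cmod (f y - g y - (f t - g t))"
        by simp
    qed simp
  qed simp
  then have "f t - g t = f 0 - g 0"
    unfolding constant_on_def by (metis UNIV_I)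
  then show ?thesis
    using assms(3) by simp
qed

text \<open>The equivalence contains both existence and uniqueness: the integral is a continuous
  logarithm of the amplitude vanishing at 0, and no other function is.\<close>

theorem lemma2:
  fixes A B :: "complex^'n^'n" and h :: "complex^'n" and s :: "real \<Rightarrow> complex"
  assumes "transpose A = A"
    and "map_matrix cnj (transpose B) = B"
  shows "(continuous_on UNIV s \<and> s 0 = 0 \<and>
            (\<forall>t. exp (s t) = cinner_ell2 vacuum (exp_i (hamiltonian A B h) t vacuum)))
     \<longleftrightarrow>
         (\<forall>t. s t = - (LBINT \<tau>=0..t.
              bilin (cnjv (f_vec A B h \<tau>)) h
            + 1 / 2 * bilin (cnjv (f_vec A B h \<tau>)) (A *v cnjv (f_vec A B h \<tau>))
            + 1 / 2 * trace (rho_bar A B \<tau> ** A)))"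
proof -
  interpret quadratic_hamiltonian A B h
  proof
    fix i j
    show "A $ i $ j = A $ j $ i"
      using arg_cong[OF assms(1), of "\<lambda>M. M $ i $ j"] by (simp add: transpose_def)
    show "cnj (B $ i $ j) = B $ j $ i"
      using arg_cong[OF assms(2), of "\<lambda>M. M $ j $ i"] by (simp add: transpose_def)
  qed
  have cont: "continuous_on UNIV exponent"
    by (intro continuous_at_imp_continuous_on ballI has_vector_derivative_continuous[OF exponent_derivative])
  show ?thesis
    unfolding rate_def[symmetric] exponent_def[symmetric] vacuum_amplitude
  proof
    assume "continuous_on UNIV s \<and> s 0 = 0 \<and> (\<forall>t. exp (s t) = exp (exponent t))"
    then show "\<forall>t. s t = exponent t"
      using continuous_log_unique[of s exponent] cont exponent_0 by auto
  next
    assume "\<forall>t. s t = exponent t"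
    then have "s = exponent"
      by blast
    then show "continuous_on UNIV s \<and> s 0 = 0 \<and> (\<forall>t. exp (s t) = exp (exponent t))"
      using cont exponent_0 by simp
  qed
qed

end
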